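(* For every $p\in[1,\infty]$ there are constants $c,C>0$ and $\epsilon_0\in(0,1)$, depending only on $p$, such that for every $\epsilon\in(0,\epsilon_0]$: (i) if $1\le p\le2$, there is a dimension $d$ such that every two-sided, adaptive $(\epsilon,\ell_p)$-tester for real symmetric $d\times d$ matrices must make at least $c\,\epsilon^{-p}$ vector-matrix-vector queries; (ii) if $2<p<\infty$, then for every $d\ge C\epsilon^{-p}$, every two-sided, adaptive $(\epsilon,\ell_p)$-tester for real symmetric $d\times d$ matrices must make at least $c\,\frac{1}{\epsilon^2}d^{1-2/p}$ vector-matrix-vector queries; (iii) if $p=\infty$, then for every $d\ge1$, every two-sided, adaptive $(\epsilon,\ell_\infty)$-tester for real symmetric $d\times d$ matrices must make at least $c\,d$ vector-matrix-vector queries.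
   Context: For a real symmetric matrix $A$, $\|A\|_p$ denotes the Schatten-$p$ norm (the $\ell_p$ norm of the vector of singular values; $\|A\|_\infty$ is the operator norm), and $\lambda_{\min}(A)$ its smallest eigenvalue. PSD means positive semidefinite. A randomized algorithm has access to an unknown real symmetric $d\times d$ matrix $A$ only through vector-matrix-vector queries: it chooses $v,w\in\mathbb{R}^d$ and receives $v^TAw$. It is adaptive if queries may depend on previous answers (and on the algorithm's random coins). Computation is otherwise free; the number of queries is counted in the worst case over inputs and coins. For $p\in[1,\infty]$ and $\epsilon\in(0,1)$, an $(\epsilon,\ell_p)$-tester is such an algorithm that outputs True with probability at least $2/3$ if $A$ is PSD, and outputs False with probability at least $2/3$ if $A\neq 0$ and $\lambda_{\min}(A)\le-\epsilon\|A\|_p$. "Two-sided" means that errors are allowed on both PSD and non-PSD inputs. *)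

theory Defs
  imports "HOL-Probability.Probability" "Jordan_Normal_Form.Char_Poly"
begin

no_notation inner (infix "\<bullet>" 70)

definition sym_mats :: "nat \<Rightarrow> real mat set" where
  "sym_mats d = {A \<in> carrier_mat d d. transpose_mat A = A}"

definition psd_mat :: "real mat \<Rightarrow> bool" where
  "psd_mat A \<longleftrightarrow> A \<in> sym_mats (dim_row A) \<and>
     (\<forall>v \<in> carrier_vec (dim_row A). 0 \<le> v \<bullet> (A *\<^sub>v v))"

text \<open>For symmetric matrices, the smallest eigenvalue and the norm for \<open>p = \<infinity>\<close> below are unspecified
  on the \<open>0 \<times> 0\<close> matrix only.\<close>

definition lambda_min :: "real mat \<Rightarrow> real" where
  "lambda_min A = Min {k. eigenvalue A k}"

text \<open>Singular values of a square matrix, with multiplicity.\<close>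

definition singular_values :: "real mat \<Rightarrow> real multiset" where
  "singular_values A = image_mset sqrt (proots (char_poly (transpose_mat A * A)))"

definition schatten_norm :: "ereal \<Rightarrow> real mat \<Rightarrow> real" where
  "schatten_norm p A =
     (if p = \<infinity> then Max (set_mset (singular_values A))
      else (\<Sum>s\<in>#singular_values A. s powr real_of_ereal p) powr (1 / real_of_ereal p))"

text \<open>
  A randomized adaptive algorithm fixes all of its coins at the start. From the coins and the list
  of answers received so far (the earlier queries are determined by these) it decides whether to
  halt; if so it outputs its verdict, otherwise it issues the query given by a left and a right
  vector. The coins are an arbitrary probability space on (a subset of) the reals. Nothing is lost
  by fixing the carrier type: the jointly measurable decision rules below depend on the coins
  only through countably many events, so any other coin space can be pushed forward to the reals.
\<close>

record vmv_algorithm =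
  coins :: "real measure"
  halts :: "real \<Rightarrow> real list \<Rightarrow> bool"
  left_vec :: "real \<Rightarrow> real list \<Rightarrow> real Matrix.vec"
  right_vec :: "real \<Rightarrow> real list \<Rightarrow> real Matrix.vec"
  verdict :: "real \<Rightarrow> real list \<Rightarrow> bool"

text \<open>Coins together with a list of \<open>n\<close> answers, the latter encoded as a point of \<open>{..<n} \<rightarrow> \<real>\<close>.\<close>

definition history_space :: "vmv_algorithm \<Rightarrow> nat \<Rightarrow> (real \<times> (nat \<Rightarrow> real)) measure" where
  "history_space T n = coins T \<Otimes>\<^sub>M (\<Pi>\<^sub>M i\<in>{..<n}. (borel :: real measure))"

definition on_history :: "nat \<Rightarrow> (real \<Rightarrow> real list \<Rightarrow> 'b) \<Rightarrow> real \<times> (nat \<Rightarrow> real) \<Rightarrow> 'b" where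
  "on_history n f = (\<lambda>(\<omega>, y). f \<omega> (map y [0..<n]))"

text \<open>
  Measurability is all that is required of the decision rules; no computational restriction is
  imposed. Vectors in \<open>\<real>\<^sup>d\<close> are measurable iff their coordinates are.
\<close>

definition is_vmv_algorithm :: "nat \<Rightarrow> vmv_algorithm \<Rightarrow> bool" where
  "is_vmv_algorithm d T \<longleftrightarrow>
     prob_space (coins T) \<and>
     (\<forall>\<omega> \<in> space (coins T). \<forall>h.
        left_vec T \<omega> h \<in> carrier_vec d \<and> right_vec T \<omega> h \<in> carrier_vec d) \<and>
     (\<forall>n. Measurable.pred (history_space T n) (on_history n (halts T)) \<and>
          Measurable.pred (history_space T n) (on_history n (verdict T)) \<and>
          (\<forall>i<d. on_history n (\<lambda>\<omega> h. vec_index (left_vec T \<omega> h) i)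
                    \<in> borel_measurable (history_space T n)) \<and>
          (\<forall>i<d. on_history n (\<lambda>\<omega> h. vec_index (right_vec T \<omega> h) i)
                    \<in> borel_measurable (history_space T n)))"

text \<open>The answers after \<open>n\<close> steps on input \<open>A\<close>; the list stays constant once the algorithm halts.\<close>

primrec answers :: "vmv_algorithm \<Rightarrow> real mat \<Rightarrow> real \<Rightarrow> nat \<Rightarrow> real list" where
  "answers T A \<omega> 0 = []"
| "answers T A \<omega> (Suc n) =
     (let h = answers T A \<omega> n
      in if halts T \<omega> h then h
         else h @ [left_vec T \<omega> h \<bullet> (A *\<^sub>v right_vec T \<omega> h)])"

text \<open>The number of queries is \<open>\<infinity>\<close> on runs that never halt; such runs produce no output.\<close>

definition query_count :: "vmv_algorithm \<Rightarrow> real mat \<Rightarrow> real \<Rightarrow> enat" where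
  "query_count T A \<omega> = (INF n \<in> {n. halts T \<omega> (answers T A \<omega> n)}. enat n)"

definition outputs :: "vmv_algorithm \<Rightarrow> real mat \<Rightarrow> real \<Rightarrow> bool \<Rightarrow> bool" where
  "outputs T A \<omega> b \<longleftrightarrow>
     (\<exists>n. halts T \<omega> (answers T A \<omega> n) \<and> verdict T \<omega> (answers T A \<omega> n) = b)"

definition worst_case_queries :: "nat \<Rightarrow> vmv_algorithm \<Rightarrow> enat" where
  "worst_case_queries d T = (SUP A \<in> sym_mats d. SUP \<omega> \<in> space (coins T). query_count T A \<omega>)"

definition output_prob :: "vmv_algorithm \<Rightarrow> real mat \<Rightarrow> bool \<Rightarrow> real" where
  "output_prob T A b = measure (coins T) {\<omega> \<in> space (coins T). outputs T A \<omega> b}"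

definition psd_tester :: "nat \<Rightarrow> real \<Rightarrow> ereal \<Rightarrow> vmv_algorithm \<Rightarrow> bool" where
  "psd_tester d \<epsilon> p T \<longleftrightarrow>
     is_vmv_algorithm d T \<and>
     (\<forall>A \<in> sym_mats d.
        (psd_mat A \<longrightarrow> output_prob T A True \<ge> 2/3) \<and>
        (A \<noteq> 0\<^sub>m d d \<and> lambda_min A \<le> - \<epsilon> * schatten_norm p A \<longrightarrow>
           output_prob T A False \<ge> 2/3))"

definition tester_lower_bound :: "nat \<Rightarrow> real \<Rightarrow> ereal \<Rightarrow> real \<Rightarrow> bool" where
  "tester_lower_bound d \<epsilon> p b \<longleftrightarrow>
     (\<forall>T. psd_tester d \<epsilon> p T \<longrightarrow> ereal b \<le> ereal_of_enat (worst_case_queries d T))"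

end

theory Submission
  imports Defs "Jordan_Normal_Form.Schur_Decomposition"
    "HOL-Computational_Algebra.Fundamental_Theorem_Algebra"
begin

text \<open>
  The hard instances are \<open>t I + W\<close>, where \<open>W\<close> is symmetric with zero diagonal and independent standard
  Gaussian entries above it and \<open>t\<close> is a multiple of \<open>sqrt d\<close>, and the same matrix with a spike \<open>s\<close> added
  to one off-diagonal entry chosen at random. By a net argument the former is positive semidefinite
  with high probability, while the latter has smallest eigenvalue at most \<open>2 t - s\<close> and Schatten norm at
  most \<open>4 t d\<^bsup>1/p\<^esup> + 4 s\<close>.
  Every query is a linear functional of the Gaussian entries. Normalised and restricted to what the
  earlier answers leave undetermined, it is a unit vector \<open>u\<close>, and it contributes
  \<open>s\<^sup>2 u\<^sub>a\<^sup>2 / 2\<close> to the relative entropy between the instance without spike and the one with a spike at \<open>a\<close>.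
  Averaging over the \<open>d (d - 1) / 2\<close> positions \<open>a\<close>, one needs \<open>k \<ge> c d\<^sup>2 / s\<^sup>2\<close> queries. The choices
  \<open>s \<approx> \<epsilon> d\<^bsup>1/2 + 1/p\<^esup>\<close> for \<open>p < \<infinity>\<close> and \<open>s \<approx> d\<^bsup>1/2\<^esup>\<close> for \<open>p = \<infinity>\<close> give all three bounds.
\<close>

text \<open>The order of the two laws in the relative entropy shapes the proof. The expectation is
  taken under the instance without spike, so the queries follow the same law for every position
  \<open>a\<close>, and the squares of the coordinates of one unit vector sum to 1. A query
  therefore costs \<open>s^2 / 2\<close> for all positions together, however adaptively it was
  chosen. In the opposite order the queries could home in on the spike. The spike sits off the
  diagonal because that gives it order \<open>d^2\<close> hiding places; the diagonal has only
  \<open>d\<close>. To be rejected, the spiked matrix must satisfy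
  \<open>s - 2 t \<ge> \<epsilon> (4 t d^(1/p) + 4 s)\<close>. For small \<open>\<epsilon>\<close> a
  large multiple of \<open>t\<close> times the maximum of 1 and \<open>\<epsilon> d^(1/p)\<close>
  suffices as \<open>s\<close>, and \<open>d \<ge> \<epsilon>^(-p)\<close> makes the second of these
  at least 1. Then \<open>d^2 / s^2\<close> has order \<open>\<epsilon>^(-2) d^(1 - 2/p)\<close>,
  which is \<open>\<epsilon>^(-p)\<close> when \<open>d\<close> is close to
  \<open>\<epsilon>^(-p)\<close>. Bounded scores and their exponential moments stand in for the laws
  of transcripts, so that the induction on the queries needs no conditional distributions: it
  resamples the Gaussian vector along the first query instead.\<close>

unbundle no vec_syntax

section \<open>Spectra of real symmetric matrices\<close>

text \<open>Over the complex numbers there is a root \<open>z\<close> with eigenvector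
  \<open>v\<close>. With \<open>S\<close> the squared norm of \<open>v\<close>, the number
  \<open>z * S\<close> is the value of a Hermitian form at \<open>v\<close> and hence its own
  conjugate. Since \<open>S\<close> is nonzero, \<open>z\<close> is real and a root of the real
  characteristic polynomial.\<close>

lemma symmetric_mat_has_eigenvalue:
  fixes A :: "real mat"
  assumes A: "A \<in> carrier_mat n n" and sym: "transpose_mat A = A" and n: "n \<noteq> 0"
  shows "\<exists>e. eigenvalue A e"
proof -
  define B where "B = map_mat complex_of_real A"
  have B: "B \<in> carrier_mat n n" using A by (auto simp: B_def)
  have "degree (char_poly B) = n" using degree_monic_char_poly[OF B] by simp
  then have "\<not> constant (poly (char_poly B))" using n by (simp add: constant_degree)
  then obtain z where z: "poly (char_poly B) z = 0" using fundamental_theorem_of_algebra by blast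
  then have "eigenvalue B z" using eigenvalue_root_char_poly[OF B] by simp
  then obtain v where v: "v \<in> carrier_vec n" "v \<noteq> 0\<^sub>v n" "B *\<^sub>v v = z \<cdot>\<^sub>v v"
    using B unfolding eigenvalue_def eigenvector_def by auto
  have Bsym: "B $$ (i,j) = B $$ (j,i)" if "i < n" "j < n" for i j
  proof -
    have "A $$ (i,j) = transpose_mat A $$ (j,i)" using A that by simp
    then show ?thesis using A that sym by (simp add: B_def)
  qed
  have Bcnj: "cnj (B $$ (i,j)) = B $$ (i,j)" if "i < n" "j < n" for i j
    using A that by (simp add: B_def)
  have Bv: "(\<Sum>j<n. B $$ (i,j) * v $ j) = z * v $ i" if "i < n" for i
  proof -
    have "(B *\<^sub>v v) $ i = (\<Sum>j<n. B $$ (i,j) * v $ j)"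
      using B v(1) that by (simp add: scalar_prod_def lessThan_atLeast0)
    then show ?thesis using v that by simp
  qed
  define S where "S = (\<Sum>i<n. cnj (v $ i) * v $ i)"
  have "z * S = (\<Sum>i<n. cnj (v $ i) * (\<Sum>j<n. B $$ (i,j) * v $ j))"
    unfolding S_def sum_distrib_left[of z] by (intro sum.cong refl) (simp add: Bv)
  also have "\<dots> = (\<Sum>i<n. \<Sum>j<n. cnj (v $ i) * B $$ (i,j) * v $ j)"
    by (simp add: sum_distrib_left mult_ac)
  also have "\<dots> = (\<Sum>j<n. \<Sum>i<n. cnj (v $ i) * B $$ (i,j) * v $ j)" by (rule sum.swap)
  also have "\<dots> = (\<Sum>j<n. v $ j * cnj (\<Sum>i<n. B $$ (j,i) * v $ i))"
    by (auto simp: sum_distrib_left mult_ac Bcnj Bsym intro!: sum.cong)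
  also have "\<dots> = cnj z * S"
    unfolding S_def sum_distrib_left[of "cnj z"] by (intro sum.cong refl) (simp add: Bv)
  finally have zS: "z * S = cnj z * S" .
  have S: "S = of_real (\<Sum>i<n. (cmod (v $ i))\<^sup>2)"
    unfolding S_def of_real_sum by (intro sum.cong refl) (simp add: complex_norm_square mult.commute del: of_real_power)
  obtain i where i: "i < n" "v $ i \<noteq> 0" using v by (metis carrier_vecD eq_vecI index_zero_vec)
  have "0 < (\<Sum>i<n. (cmod (v $ i))\<^sup>2)" by (rule sum_pos2[of _ i]) (use i in auto)
  then have "S \<noteq> 0" unfolding S by (metis less_irrefl of_real_eq_0_iff)
  with zS have "z = cnj z" by simp
  then obtain e where e: "z = of_real e" by (metis Reals_cases Reals_cnj_iff)
  have "char_poly B = map_poly of_real (char_poly A)"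
    unfolding B_def by (rule of_real_hom.char_poly_hom[OF A])
  with z e have "of_real (poly (char_poly A) e) = (0::complex)"
    by (simp add: of_real_hom.poly_map_poly)
  then have "eigenvalue A e" using eigenvalue_root_char_poly[OF A] by simp
  then show ?thesis ..
qed

definition orthogonal_real_mat :: "nat \<Rightarrow> real mat \<Rightarrow> bool" where
  "orthogonal_real_mat n Q \<longleftrightarrow> Q \<in> carrier_mat n n \<and> transpose_mat Q * Q = 1\<^sub>m n"

lemma orthogonal_real_mat_mult:
  assumes "orthogonal_real_mat n P" "orthogonal_real_mat n Q"
  shows "orthogonal_real_mat n (P * Q)"
proof -
  have P: "P \<in> carrier_mat n n" "transpose_mat P * P = 1\<^sub>m n"
    and Q: "Q \<in> carrier_mat n n" "transpose_mat Q * Q = 1\<^sub>m n"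
    using assms by (auto simp: orthogonal_real_mat_def)
  have "transpose_mat (P * Q) * (P * Q) = transpose_mat Q * transpose_mat P * (P * Q)"
    using P Q by (simp add: transpose_mult)
  also have "\<dots> = transpose_mat Q * (transpose_mat P * P) * Q"
    using P(1) Q(1) by (smt (verit) assoc_mult_mat mult_carrier_mat transpose_carrier_mat)
  also have "\<dots> = 1\<^sub>m n" using P Q by simp
  finally show ?thesis using P Q by (simp add: orthogonal_real_mat_def)
qed

text \<open>Complete \<open>v\<close> to a basis, orthogonalise, and divide by the lengths;
  \<open>c\<close> is the reciprocal of the length of \<open>v\<close>.\<close>

lemma orthogonal_real_mat_completion:
  fixes v :: "real vec"
  assumes v: "v \<in> carrier_vec n" "v \<noteq> 0\<^sub>v n"
  shows "\<exists>Q c. orthogonal_real_mat n Q \<and> col Q 0 = c \<cdot>\<^sub>v v"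
proof -
  interpret cof_vec_space n "TYPE(real)" .
  define ws where "ws = gram_schmidt n (basis_completion v)"
  note bc = basis_completion[OF v]
  have gs: "corthogonal ws" "set ws \<subseteq> carrier_vec n" "length ws = length (basis_completion v)"
    using gram_schmidt_result[OF bc(2) bc(4) bc(5) ws_def] by blast+
  have len: "length ws = n" using gs(3) bc(6) by simp
  have n: "0 < n" using v by (cases n) auto
  have hd: "ws ! 0 = v"
  proof -
    \<comment> \<open>Gram-Schmidt subtracts nothing from the first vector of the list.\<close>
    have "hd ws = v" unfolding ws_def basis_completion_def Let_def using v by simp
    then show ?thesis using n len by (metis hd_conv_nth length_0_conv not_less0)
  qed
  define r where "r i = 1 / sqrt (ws ! i \<bullet> ws ! i)" for i
  define Q where "Q = mat n n (\<lambda>(i,j). r j * ws ! j $ i)"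
  have wsc: "ws ! i \<in> carrier_vec n" if "i < n" for i using gs(2) len that by auto
  have colQ: "col Q j = r j \<cdot>\<^sub>v ws ! j" if "j < n" for j
    using that wsc[OF that] by (auto simp: Q_def)
  have orth: "ws ! i \<bullet> ws ! j = 0 \<longleftrightarrow> i \<noteq> j" if "i < n" "j < n" for i j
    using corthogonalD[OF gs(1), of i j] that len by simp
  have "transpose_mat Q * Q = 1\<^sub>m n"
  proof (rule eq_matI)
    fix i j assume ij: "i < dim_row (1\<^sub>m n)" "j < dim_col (1\<^sub>m n :: real mat)"
    then have "(transpose_mat Q * Q) $$ (i,j) = col Q i \<bullet> col Q j"
      by (simp add: Q_def)
    also have "\<dots> = r i * r j * (ws ! i \<bullet> ws ! j)"
      using ij wsc[of i] wsc[of j] by (simp add: colQ smult_scalar_prod_distrib[of _ n] scalar_prod_smult_distrib[of _ n])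
    also have "\<dots> = (1\<^sub>m n) $$ (i,j)"
    proof (cases "i = j")
      case True
      have "0 \<le> ws ! i \<bullet> ws ! i" by (simp add: scalar_prod_def sum_nonneg)
      then have "0 < ws ! i \<bullet> ws ! i" using orth[of i i] ij by (simp add: less_le)
      then show ?thesis using ij True by (simp add: r_def)
    next
      case False
      then show ?thesis using orth ij by simp
    qed
    finally show "(transpose_mat Q * Q) $$ (i,j) = (1\<^sub>m n) $$ (i,j)" .
  qed (auto simp: Q_def)
  moreover have "col Q 0 = r 0 \<cdot>\<^sub>v v" using colQ[OF n] hd by simp
  ultimately show ?thesis unfolding orthogonal_real_mat_def by (metis Q_def mat_carrier)
qed

definition spectral_decomposition :: "nat \<Rightarrow> real mat \<Rightarrow> real mat \<Rightarrow> (nat \<Rightarrow> real) \<Rightarrow> bool" where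
  "spectral_decomposition n A Q d \<longleftrightarrow>
     orthogonal_real_mat n Q \<and> transpose_mat Q * A * Q = mat n n (\<lambda>(i,j). if i = j then d i else 0)"

text \<open>Deflation: conjugation by an orthogonal matrix whose first column is an eigenvector
  turns the first column of \<open>A\<close> into a multiple of the first unit vector. By symmetry
  the first row has the same shape, and the induction hypothesis diagonalises the remaining
  block.\<close>

theorem symmetric_mat_spectral_decomposition:
  fixes A :: "real mat"
  assumes "A \<in> carrier_mat n n" "transpose_mat A = A"
  shows "\<exists>Q d. spectral_decomposition n A Q d"
  using assms
proof (induction n arbitrary: A)
  case 0
  show ?case
    unfolding spectral_decomposition_def orthogonal_real_mat_def
    using 0 by (intro exI[of _ "1\<^sub>m 0"] exI[of _ "\<lambda>_. 0"]) auto
next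
  case (Suc n A)
  let ?N = "Suc n"
  note A = Suc.prems(1) and sym = Suc.prems(2)
  obtain e where "eigenvalue A e" using symmetric_mat_has_eigenvalue[OF A sym] by auto
  then obtain v where v: "v \<in> carrier_vec ?N" "v \<noteq> 0\<^sub>v ?N" "A *\<^sub>v v = e \<cdot>\<^sub>v v"
    using A unfolding eigenvalue_def eigenvector_def by auto
  obtain P c where P: "orthogonal_real_mat ?N P" and col: "col P 0 = c \<cdot>\<^sub>v v"
    using orthogonal_real_mat_completion[OF v(1,2)] by blast
  have Pc: "P \<in> carrier_mat ?N ?N" "transpose_mat P * P = 1\<^sub>m ?N"
    using P by (auto simp: orthogonal_real_mat_def)
  define B where "B = transpose_mat P * A * P"
  have B: "B \<in> carrier_mat ?N ?N" using A Pc by (simp add: B_def)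
  have Bsym: "transpose_mat B = B"
    using A Pc sym by (simp add: B_def transpose_mult[of _ ?N ?N _ ?N] assoc_mult_mat[of _ ?N ?N _ ?N _ ?N])
  have Bij: "B $$ (i,j) = B $$ (j,i)" if "i < ?N" "j < ?N" for i j
    using Bsym B that by (metis carrier_matD index_transpose_mat(1))
  have Acol: "A *\<^sub>v col P 0 = e \<cdot>\<^sub>v col P 0"
    using A v col by (simp add: mult_mat_vec[of _ ?N ?N] smult_smult_assoc mult.commute)
  have B0: "B $$ (i,0) = (if i = 0 then e else 0)" if "i < ?N" for i
  proof -
    have "B $$ (i,0) = (transpose_mat P * (A * P)) $$ (i,0)"
      using A Pc by (simp add: B_def assoc_mult_mat[of _ ?N ?N _ ?N _ ?N])
    also have "\<dots> = col P i \<bullet> (A *\<^sub>v col P 0)"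
      using A Pc(1) that by (simp add: col_mult2[of _ ?N ?N] mult_mat_vec_def)
    also have "\<dots> = e * (col P i \<bullet> col P 0)"
      unfolding Acol using Pc that by simp
    also have "col P i \<bullet> col P 0 = (transpose_mat P * P) $$ (i,0)"
      using Pc(1) that by simp
    finally show ?thesis unfolding Pc(2) using that by auto
  qed
  define B3 where "B3 = mat n n (\<lambda>(i,j). B $$ (Suc i, Suc j))"
  have B3: "B3 \<in> carrier_mat n n" by (simp add: B3_def)
  have "transpose_mat B3 = B3" using Bij by (auto simp: B3_def)
  from Suc.IH[OF B3 this] obtain Q d where "spectral_decomposition n B3 Q d" by blast
  then have Q: "Q \<in> carrier_mat n n" "transpose_mat Q * Q = 1\<^sub>m n"
    and D: "transpose_mat Q * B3 * Q = mat n n (\<lambda>(i,j). if i = j then d i else 0)"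
    by (auto simp: spectral_decomposition_def orthogonal_real_mat_def)
  let ?E = "mat 1 1 (\<lambda>_. e)"
  have Bblock: "B = four_block_mat ?E (0\<^sub>m 1 n) (0\<^sub>m n 1) B3"
  proof (rule eq_matI)
    fix i j assume "i < dim_row (four_block_mat ?E (0\<^sub>m 1 n) (0\<^sub>m n 1) B3)"
      "j < dim_col (four_block_mat ?E (0\<^sub>m 1 n) (0\<^sub>m n 1) B3)"
    then have "i < ?N" "j < ?N" by (auto simp: B3_def)
    then show "B $$ (i,j) = four_block_mat ?E (0\<^sub>m 1 n) (0\<^sub>m n 1) B3 $$ (i,j)"
      using B0 Bij[of 0 j] by (cases i; cases j) (auto simp: B3_def)
  qed (use B B3 in auto)
  \<comment> \<open>Diagonalises the lower block and leaves the eigenvector already split off in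
    place.\<close>
  define R where "R = four_block_mat (1\<^sub>m 1) (0\<^sub>m 1 n) (0\<^sub>m n 1) Q"
  have Rc: "R \<in> carrier_mat ?N ?N" unfolding R_def using four_block_carrier_mat[of "1\<^sub>m 1" 1 1 Q n n] Q by simp
  have RT: "transpose_mat R = four_block_mat (1\<^sub>m 1) (0\<^sub>m 1 n) (0\<^sub>m n 1) (transpose_mat Q)"
    unfolding R_def using transpose_four_block_mat[of "1\<^sub>m 1" 1 1 "0\<^sub>m 1 n" n "0\<^sub>m n 1" n Q] Q by simp
  have RR: "transpose_mat R * R = 1\<^sub>m ?N"
  proof -
    have "transpose_mat R * R = four_block_mat (1\<^sub>m 1) (0\<^sub>m 1 n) (0\<^sub>m n 1) (transpose_mat Q * Q)"
      unfolding RT unfolding R_def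
      using mult_four_block_mat[of "1\<^sub>m 1" 1 1 "0\<^sub>m 1 n" n "0\<^sub>m n 1" n "transpose_mat Q"
          "1\<^sub>m 1" 1 "0\<^sub>m 1 n" n "0\<^sub>m n 1" Q] Q by simp
    also have "\<dots> = 1\<^sub>m ?N" unfolding Q(2) by (rule eq_matI) auto
    finally show ?thesis .
  qed
  have RBR: "transpose_mat R * B * R = four_block_mat ?E (0\<^sub>m 1 n) (0\<^sub>m n 1) (transpose_mat Q * B3 * Q)"
  proof -
    have "transpose_mat R * B = four_block_mat ?E (0\<^sub>m 1 n) (0\<^sub>m n 1) (transpose_mat Q * B3)"
      unfolding RT Bblock
      using mult_four_block_mat[of "1\<^sub>m 1" 1 1 "0\<^sub>m 1 n" n "0\<^sub>m n 1" n "transpose_mat Q"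
          ?E 1 "0\<^sub>m 1 n" n "0\<^sub>m n 1" B3] Q B3 by simp
    then show ?thesis
      unfolding R_def
      using mult_four_block_mat[of ?E 1 1 "0\<^sub>m 1 n" n "0\<^sub>m n 1" n "transpose_mat Q * B3"
          "1\<^sub>m 1" 1 "0\<^sub>m 1 n" n "0\<^sub>m n 1" Q] Q B3 by simp
  qed
  define d' where "d' i = (case i of 0 \<Rightarrow> e | Suc j \<Rightarrow> d j)" for i
  have fbm: "four_block_mat ?E (0\<^sub>m 1 n) (0\<^sub>m n 1) (transpose_mat Q * B3 * Q)
      = mat ?N ?N (\<lambda>(i,j). if i = j then d' i else 0)"
    unfolding D by (rule eq_matI) (auto simp: d'_def split: nat.splits)
  have "transpose_mat (P * R) * A * (P * R) = transpose_mat R * B * R"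
    using A Pc Rc by (simp add: B_def transpose_mult[of _ ?N ?N _ ?N] assoc_mult_mat[of _ ?N ?N _ ?N _ ?N])
  moreover have "orthogonal_real_mat ?N (P * R)"
    using P Rc RR by (intro orthogonal_real_mat_mult) (auto simp: orthogonal_real_mat_def)
  ultimately show ?case
    unfolding spectral_decomposition_def fbm RBR by blast
qed

section \<open>Eigenvalues, Schatten norms and Rayleigh quotients\<close>

definition quad_form :: "nat \<Rightarrow> real mat \<Rightarrow> (nat \<Rightarrow> real) \<Rightarrow> real" where
  "quad_form n A y = (\<Sum>k<n. \<Sum>l<n. A $$ (k,l) * y k * y l)"

lemma orthogonal_real_mat_cols:
  assumes "orthogonal_real_mat n Q" "i < n" "j < n"
  shows "(\<Sum>k<n. Q $$ (k,i) * Q $$ (k,j)) = (if i = j then 1 else 0)"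
proof -
  have "(transpose_mat Q * Q) $$ (i,j) = (\<Sum>k<n. Q $$ (k,i) * Q $$ (k,j))"
  proof -
    have "Q \<in> carrier_mat n n" using assms by (simp add: orthogonal_real_mat_def)
    then show ?thesis using assms(2,3) by (simp add: scalar_prod_def lessThan_atLeast0)
  qed
  then show ?thesis using assms by (auto simp: orthogonal_real_mat_def)
qed

lemma orthogonal_real_mat_right_inverse:
  assumes "orthogonal_real_mat n Q"
  shows "Q * transpose_mat Q = 1\<^sub>m n"
  using assms mat_mult_left_right_inverse[of "transpose_mat Q" n Q]
  by (simp add: orthogonal_real_mat_def)

lemma orthogonal_real_mat_rows:
  assumes "orthogonal_real_mat n Q" "i < n" "j < n"
  shows "(\<Sum>k<n. Q $$ (i,k) * Q $$ (j,k)) = (if i = j then 1 else 0)"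
proof -
  have Q: "Q \<in> carrier_mat n n" using assms by (simp add: orthogonal_real_mat_def)
  have "(Q * transpose_mat Q) $$ (i,j) = (\<Sum>k<n. Q $$ (i,k) * Q $$ (j,k))"
    using assms Q by (simp add: scalar_prod_def lessThan_atLeast0)
  then show ?thesis using assms by (simp add: orthogonal_real_mat_right_inverse)
qed

context
  fixes n :: nat and A Q :: "real mat" and d :: "nat \<Rightarrow> real"
  assumes A: "A \<in> carrier_mat n n" and sym: "transpose_mat A = A"
    and spec: "spectral_decomposition n A Q d"
begin

private abbreviation "D \<equiv> mat n n (\<lambda>(i,j). if i = j then d i else 0)"

private lemma Q: "orthogonal_real_mat n Q" "Q \<in> carrier_mat n n" "transpose_mat Q * Q = 1\<^sub>m n"
  "Q * transpose_mat Q = 1\<^sub>m n"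
  using spec orthogonal_real_mat_right_inverse
  by (auto simp: spectral_decomposition_def orthogonal_real_mat_def)

lemma spectral_decomposition_similar: "similar_mat_wit A D Q (transpose_mat Q)"
proof -
  have "A = (Q * transpose_mat Q) * A * (Q * transpose_mat Q)" using A by (simp add: Q)
  also have "\<dots> = Q * (transpose_mat Q * A * Q) * transpose_mat Q"
    using A Q(2) by (simp add: assoc_mult_mat[of _ n n _ n _ n])
  finally have "A = Q * D * transpose_mat Q" using spec by (simp add: spectral_decomposition_def)
  then show ?thesis
    by (intro similar_mat_witI[of _ _ n]) (use A Q in auto)
qed

lemma spectral_decomposition_eigenvalues: "{k. eigenvalue A k} = d ` {..<n}"
proof -
  have "char_poly A = char_poly D"
    using spectral_decomposition_similar by (intro char_poly_similar) (auto simp: similar_mat_def)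
  also have "\<dots> = (\<Prod>a\<leftarrow>diag_mat D. [:- a, 1:])"
    by (rule char_poly_upper_triangular[of _ n]) (auto simp: upper_triangular_def)
  finally have "poly (char_poly A) k = 0 \<longleftrightarrow> k \<in> set (diag_mat D)" for k
    by (force simp: poly_prod_list o_def prod_list_zero_iff)
  then show ?thesis using eigenvalue_root_char_poly[OF A] by (auto simp: diag_mat_def)
qed

text \<open>By symmetry the product in the definition is \<open>A * A\<close>, which is similar to
  the diagonal matrix of the squares of the \<open>d i\<close>; the square root leaves absolute
  values.\<close>

lemma spectral_decomposition_singular_values:
  "singular_values A = image_mset (\<lambda>i. \<bar>d i\<bar>) (mset_set {..<n})"
proof -
  have "similar_mat_wit (A * A) (D * D) Q (transpose_mat Q)"
    using similar_mat_wit_pow[OF spectral_decomposition_similar, of 2] A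
    by (simp add: numeral_2_eq_2)
  then have "char_poly (A * A) = char_poly (D * D)"
    by (intro char_poly_similar) (auto simp: similar_mat_def)
  also have DD: "D * D = mat n n (\<lambda>(i,j). if i = j then (d i)\<^sup>2 else 0)"
    by (rule eq_matI) (auto simp: scalar_prod_def sum.delta if_distrib[of "\<lambda>x. x * _"] power2_eq_square cong: if_cong)
  then have "char_poly (D * D) = (\<Prod>a\<leftarrow>diag_mat (D * D). [:- a, 1:])"
    by (intro char_poly_upper_triangular[of _ n]) (auto simp: upper_triangular_def)
  also have "diag_mat (D * D) = map (\<lambda>i. (d i)\<^sup>2) [0..<n]"
    unfolding DD by (auto simp: diag_mat_def)
  finally have cp: "char_poly (A * A) = (\<Prod>i\<leftarrow>[0..<n]. [:- ((d i)\<^sup>2), 1:])" by (simp add: o_def)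
  have "proots (\<Prod>i\<leftarrow>xs. [:- ((d i)\<^sup>2), 1:]) = mset (map (\<lambda>i. (d i)\<^sup>2) xs)" for xs
  proof (induction xs)
    case (Cons x xs)
    have "(\<Prod>i\<leftarrow>xs. [:- ((d i)\<^sup>2), 1:]) \<noteq> 0" by (auto simp: prod_list_zero_iff)
    then show ?case using Cons by (simp add: proots_mult del: mult_pCons_left)
  qed simp
  then have "proots (char_poly (transpose_mat A * A)) = image_mset (\<lambda>i. (d i)\<^sup>2) (mset_set {..<n})"
    unfolding sym cp by (simp add: lessThan_atLeast0 flip: mset_upt)
  then show ?thesis by (simp add: singular_values_def image_mset.compositionality o_def)
qed

lemma spectral_decomposition_schatten_norm:
  "schatten_norm p A = (if p = \<infinity> then Max ((\<lambda>i. \<bar>d i\<bar>) ` {..<n})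
     else (\<Sum>i<n. \<bar>d i\<bar> powr real_of_ereal p) powr (1 / real_of_ereal p))"
  unfolding schatten_norm_def spectral_decomposition_singular_values
  by (simp add: image_mset.compositionality o_def sum_unfold_sum_mset)

lemma spectral_decomposition_eigenvalue_quad_form:
  assumes "i < n" shows "d i = quad_form n A (\<lambda>k. Q $$ (k,i))"
proof -
  have "(transpose_mat Q * A * Q) $$ (i,i) = quad_form n A (\<lambda>k. Q $$ (k,i))"
  proof -
    have "(transpose_mat Q * A * Q) $$ (i,i) = (transpose_mat Q * (A * Q)) $$ (i,i)"
      using A Q(2) by (simp add: assoc_mult_mat[of _ n n _ n _ n])
    also have "\<dots> = quad_form n A (\<lambda>k. Q $$ (k,i))"
      using A Q(2) assms
      by (auto simp: quad_form_def scalar_prod_def lessThan_atLeast0 sum_distrib_left mult_ac intro!: sum.cong)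
    finally show ?thesis .
  qed
  then show ?thesis using spec assms by (simp add: spectral_decomposition_def)
qed

lemma spectral_decomposition_quad_form:
  "quad_form n A y = (\<Sum>i<n. d i * (\<Sum>k<n. Q $$ (k,i) * y k)\<^sup>2)"
proof -
  have "A = Q * D * transpose_mat Q" using spectral_decomposition_similar A
    by (simp add: similar_mat_wit_def Let_def)
  moreover have "(Q * D * transpose_mat Q) $$ (k,l) = (\<Sum>i<n. d i * Q $$ (k,i) * Q $$ (l,i))"
    if "k < n" "l < n" for k l
    using Q(2) that
    by (auto simp: scalar_prod_def lessThan_atLeast0 if_distrib[of "\<lambda>x. _ * x"] sum.delta mult_ac
        cong: if_cong intro!: sum.cong)
  ultimately have "quad_form n A y = (\<Sum>k<n. \<Sum>l<n. \<Sum>i<n. d i * (Q $$ (k,i) * y k) * (Q $$ (l,i) * y l))"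
    unfolding quad_form_def
    by (intro sum.cong refl) (simp add: sum_distrib_left sum_distrib_right mult_ac)
  also have "\<dots> = (\<Sum>k<n. \<Sum>i<n. \<Sum>l<n. d i * (Q $$ (k,i) * y k) * (Q $$ (l,i) * y l))"
    by (intro sum.cong refl sum.swap)
  also have "\<dots> = (\<Sum>i<n. \<Sum>k<n. \<Sum>l<n. d i * (Q $$ (k,i) * y k) * (Q $$ (l,i) * y l))"
    by (rule sum.swap)
  also have "\<dots> = (\<Sum>i<n. d i * (\<Sum>k<n. Q $$ (k,i) * y k)\<^sup>2)"
    by (simp add: power2_eq_square sum_distrib_left sum_distrib_right mult_ac)
  finally show ?thesis .
qed

lemma spectral_decomposition_parseval:
  "(\<Sum>i<n. (\<Sum>k<n. Q $$ (k,i) * y k)\<^sup>2) = (\<Sum>k<n. (y k)\<^sup>2)"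
proof -
  have "(\<Sum>i<n. (\<Sum>k<n. Q $$ (k,i) * y k)\<^sup>2)
      = (\<Sum>i<n. \<Sum>k<n. \<Sum>l<n. (Q $$ (k,i) * y k) * (Q $$ (l,i) * y l))"
    by (simp add: power2_eq_square sum_product)
  also have "\<dots> = (\<Sum>k<n. \<Sum>i<n. \<Sum>l<n. (Q $$ (k,i) * y k) * (Q $$ (l,i) * y l))"
    by (rule sum.swap)
  also have "\<dots> = (\<Sum>k<n. \<Sum>l<n. \<Sum>i<n. (Q $$ (k,i) * y k) * (Q $$ (l,i) * y l))"
    by (intro sum.cong refl sum.swap)
  also have "\<dots> = (\<Sum>k<n. \<Sum>l<n. y k * y l * (\<Sum>i<n. Q $$ (k,i) * Q $$ (l,i)))"
    by (simp add: sum_distrib_left mult_ac)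
  also have "\<dots> = (\<Sum>k<n. (y k)\<^sup>2)"
  proof (intro sum.cong refl)
    fix k assume k: "k \<in> {..<n}"
    have "(\<Sum>l<n. y k * y l * (\<Sum>i<n. Q $$ (k,i) * Q $$ (l,i))) = (\<Sum>l<n. if k = l then y k * y l else 0)"
      using k by (intro sum.cong refl) (simp add: orthogonal_real_mat_rows[OF Q(1)])
    also have "\<dots> = (y k)\<^sup>2" using k by (simp add: power2_eq_square)
    finally show "(\<Sum>l<n. y k * y l * (\<Sum>i<n. Q $$ (k,i) * Q $$ (l,i))) = (y k)\<^sup>2" .
  qed
  finally show ?thesis .
qed

text \<open>The form at \<open>y\<close> is the sum of the eigenvalues weighted by the squared
  coordinates of \<open>y\<close> in the eigenbasis, and by Parseval these weights add up to the
  squared norm. If all eigenvalues exceeded \<open>c\<close>, so would the Rayleigh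
  quotient.\<close>

lemma lambda_min_le_of_quad_form:
  assumes "quad_form n A y \<le> c * (\<Sum>k<n. (y k)\<^sup>2)" and "0 < (\<Sum>k<n. (y k)\<^sup>2)"
  shows "lambda_min A \<le> c"
proof -
  have "\<exists>i<n. d i \<le> c"
  proof (rule ccontr)
    assume "\<not> ?thesis"
    then have gt: "c < d i" if "i < n" for i using that by force
    let ?w = "\<lambda>i. (\<Sum>k<n. Q $$ (k,i) * y k)\<^sup>2"
    have "0 < (\<Sum>i<n. ?w i)" using assms(2) by (simp only: spectral_decomposition_parseval)
    then obtain i where i: "i < n" "0 < ?w i" by (meson lessThan_iff not_le sum_nonpos)
    have "(\<Sum>i<n. c * ?w i) < (\<Sum>i<n. d i * ?w i)"
    proof (rule sum_strict_mono_ex1)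
      show "\<forall>j\<in>{..<n}. c * ?w j \<le> d j * ?w j"
        by (simp add: mult_right_mono less_imp_le[OF gt])
      show "\<exists>j\<in>{..<n}. c * ?w j < d j * ?w j"
        using gt i by (intro bexI[of _ i]) auto
    qed simp
    also have "\<dots> = quad_form n A y" by (rule spectral_decomposition_quad_form[symmetric])
    also have "(\<Sum>i<n. c * ?w i) = c * (\<Sum>k<n. (y k)\<^sup>2)"
      by (simp only: spectral_decomposition_parseval flip: sum_distrib_left)
    finally show False using assms(1) by simp
  qed
  then obtain i where "i < n" "d i \<le> c" by blast
  then show ?thesis unfolding lambda_min_def spectral_decomposition_eigenvalues
    by (meson Min_le finite_imageI finite_lessThan imageI lessThan_iff order_trans)
qed

text \<open>The excess of the spectrum over \<open>[0, 2 * t]\<close> is charged to the mass that the eigenvectors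
  put on the two coordinates of the spike; this mass has total 2.\<close>

lemma spiked_spectrum:
  assumes ab: "a < n" "b < n" "a \<noteq> b" and "0 \<le> s"
    and nn: "\<And>y. 0 \<le> quad_form n A y - 2 * s * y a * y b"
    and le: "\<And>y. quad_form n A y - 2 * s * y a * y b \<le> 2 * t * (\<Sum>k<n. (y k)\<^sup>2)"
  defines "r \<equiv> \<lambda>i. (Q $$ (a,i))\<^sup>2 + (Q $$ (b,i))\<^sup>2"
  shows "i < n \<Longrightarrow> \<bar>d i\<bar> \<le> 2 * t + s * r i" "i < n \<Longrightarrow> r i \<le> 1" "(\<Sum>i<n. r i) = 2"
proof -
  assume i: "i < n"
  have unit: "(\<Sum>k<n. (Q $$ (k,i))\<^sup>2) = 1"
    using orthogonal_real_mat_cols[OF Q(1) i i] by (simp add: power2_eq_square)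
  \<comment> \<open>An eigenvalue is the form at its unit eigenvector, so the spike contributes
    \<open>2 * s * Q $$ (a,i) * Q $$ (b,i)\<close> to it, which is at most \<open>s * r i\<close> in
    absolute value.\<close>
  have "\<bar>2 * (Q $$ (a,i) * Q $$ (b,i))\<bar> \<le> r i"
  proof -
    have "0 \<le> (Q $$ (a,i) + Q $$ (b,i))\<^sup>2" "0 \<le> (Q $$ (a,i) - Q $$ (b,i))\<^sup>2" by simp_all
    then show ?thesis unfolding power2_sum power2_diff r_def abs_le_iff by linarith
  qed
  then have "\<bar>2 * s * Q $$ (a,i) * Q $$ (b,i)\<bar> \<le> s * r i"
    using mult_left_mono[OF _ \<open>0 \<le> s\<close>] by (fastforce simp: abs_mult \<open>0 \<le> s\<close> mult_ac)
  moreover note nn[of "\<lambda>k. Q $$ (k,i)"] le[of "\<lambda>k. Q $$ (k,i)"]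
  moreover have "0 \<le> t" using nn[of "\<lambda>k. Q $$ (k,i)"] le[of "\<lambda>k. Q $$ (k,i)"] unit by simp
  ultimately show "\<bar>d i\<bar> \<le> 2 * t + s * r i"
    unfolding spectral_decomposition_eigenvalue_quad_form[OF i] unit by linarith
  have "r i = (\<Sum>k\<in>{a,b}. (Q $$ (k,i))\<^sup>2)" using ab by (simp add: r_def)
  also have "\<dots> \<le> (\<Sum>k<n. (Q $$ (k,i))\<^sup>2)" using ab by (intro sum_mono2) auto
  finally show "r i \<le> 1" using unit by simp
next
  \<comment> \<open>The sum collects the rows \<open>a\<close> and \<open>b\<close> of
    \<open>Q\<close>, each of norm 1.\<close>
  show "(\<Sum>i<n. r i) = 2"
    using orthogonal_real_mat_rows[OF Q(1) ab(1) ab(1)] orthogonal_real_mat_rows[OF Q(1) ab(2) ab(2)]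
    by (simp add: r_def sum.distrib power2_eq_square)
qed

end

text \<open>The test vector is the difference of the unit vectors at \<open>a\<close> and
  \<open>b\<close>: its squared norm is 2 and the spike contributes \<open>- 2 * s\<close>.\<close>

lemma spiked_lambda_min:
  fixes A :: "real mat"
  assumes A: "A \<in> carrier_mat n n" "transpose_mat A = A"
    and ab: "a < n" "b < n" "a \<noteq> b"
    and le: "\<And>y. quad_form n A y - 2 * s * y a * y b \<le> 2 * t * (\<Sum>k<n. (y k)\<^sup>2)"
  shows "lambda_min A \<le> - (s - 2 * t)"
proof -
  obtain Q d where spec: "spectral_decomposition n A Q d"
    using symmetric_mat_spectral_decomposition[OF A] by blast
  define y where "y = (\<lambda>k. if k = a then 1 else if k = b then - 1 else (0::real))"
  have "(\<Sum>k<n. (y k)\<^sup>2) = (\<Sum>k\<in>{a,b}. (y k)\<^sup>2)"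
    using ab by (intro sum.mono_neutral_right) (auto simp: y_def)
  also have "\<dots> = 2" using ab by (simp add: y_def)
  finally have y2: "(\<Sum>k<n. (y k)\<^sup>2) = 2" .
  then show ?thesis using le[of y] ab
    by (intro lambda_min_le_of_quad_form[OF A spec, of y]) (auto simp: y_def y2 algebra_simps)
qed

lemma spiked_schatten_norm_infinity:
  fixes A :: "real mat"
  assumes A: "A \<in> carrier_mat n n" "transpose_mat A = A"
    and ab: "a < n" "b < n" "a \<noteq> b" and s: "0 \<le> s"
    and nn: "\<And>y. 0 \<le> quad_form n A y - 2 * s * y a * y b"
    and le: "\<And>y. quad_form n A y - 2 * s * y a * y b \<le> 2 * t * (\<Sum>k<n. (y k)\<^sup>2)"
  shows "schatten_norm \<infinity> A \<le> 2 * t + s"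
proof -
  obtain Q d where spec: "spectral_decomposition n A Q d"
    using symmetric_mat_spectral_decomposition[OF A] by blast
  note sp = spiked_spectrum[OF A spec ab s nn le]
  have "\<bar>d i\<bar> \<le> 2 * t + s" if "i < n" for i
    using sp(1)[OF that] mult_left_mono[OF sp(2)[OF that] s] by simp
  then show ?thesis
    using ab by (auto simp: spectral_decomposition_schatten_norm[OF A spec] intro!: Max.boundedI)
qed

text \<open>The spike must not be multiplied by a power of \<open>n\<close>. From
  \<open>2 * t + s * r i \<le> max (4 * t) (2 * s * r i)\<close> the \<open>p\<close>-th powers
  separate, and \<open>r i \<le> 1\<close> with \<open>p \<ge> 1\<close> bounds
  \<open>r i powr p\<close> by \<open>r i\<close>; since the \<open>r i\<close> sum to 2, the spike
  enters the sum of \<open>p\<close>-th powers at most as \<open>2 * (2 * s) powr p\<close>.\<close>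

lemma spiked_schatten_norm_finite:
  fixes A :: "real mat"
  assumes A: "A \<in> carrier_mat n n" "transpose_mat A = A"
    and ab: "a < n" "b < n" "a \<noteq> b" and s: "0 \<le> s"
    and nn: "\<And>y. 0 \<le> quad_form n A y - 2 * s * y a * y b"
    and le: "\<And>y. quad_form n A y - 2 * s * y a * y b \<le> 2 * t * (\<Sum>k<n. (y k)\<^sup>2)"
    and t: "0 \<le> t" and p: "1 \<le> p"
  shows "schatten_norm (ereal p) A \<le> 4 * t * real n powr (1 / p) + 4 * s"
proof -
  obtain Q d where spec: "spectral_decomposition n A Q d"
    using symmetric_mat_spectral_decomposition[OF A] by blast
  define r where "r = (\<lambda>i. (Q $$ (a,i))\<^sup>2 + (Q $$ (b,i))\<^sup>2)"
  note sp = spiked_spectrum[OF A spec ab s nn le]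
  have sp1: "\<bar>d i\<bar> \<le> 2 * t + s * r i" and r1: "r i \<le> 1" if "i < n" for i
    using sp(1,2)[OF that] by (simp_all add: r_def)
  have r0: "0 \<le> r i" for i by (simp add: r_def)
  have "\<bar>d i\<bar> powr p \<le> (4 * t) powr p + (2 * s) powr p * r i" if i: "i < n" for i
  proof -
    have "\<bar>d i\<bar> \<le> max (4 * t) (2 * s * r i)" using sp1[OF i] by linarith
    then have "\<bar>d i\<bar> powr p \<le> max (4 * t) (2 * s * r i) powr p" using p by (intro powr_mono2) auto
    also have "\<dots> \<le> (4 * t) powr p + (2 * s * r i) powr p" by (auto simp: max_def)
    also have "(2 * s * r i) powr p \<le> (2 * s) powr p * r i"
    proof -
      have "r i powr p \<le> r i"
      proof (cases "r i = 0")
        case False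
        then have "r i powr p \<le> r i powr 1" using r1[OF i] r0[of i] p by (intro powr_mono') auto
        then show ?thesis using r0[of i] by simp
      qed simp
      then show ?thesis using s r0 by (simp add: powr_mult mult_left_mono)
    qed
    finally show ?thesis by simp
  qed
  then have "(\<Sum>i<n. \<bar>d i\<bar> powr p) \<le> (\<Sum>i<n. (4 * t) powr p + (2 * s) powr p * r i)"
    by (intro sum_mono) auto
  also have "\<dots> = real n * (4 * t) powr p + 2 * (2 * s) powr p"
    using sp(3) by (simp add: sum.distrib r_def flip: sum_distrib_left)
  also have "\<dots> \<le> (4 * t * real n powr (1 / p) + 4 * s) powr p"
  proof -
    \<comment> \<open>Superadditivity of the \<open>p\<close>-th power, by comparing each summand
      with its share \<open>z / (x + y)\<close> of the total. It merges the two contributions under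
      one \<open>p\<close>-th root and also absorbs the factor 2 in front of
      \<open>(2 * s) powr p\<close>.\<close>
    have add: "x powr p + y powr p \<le> (x + y) powr p" if "0 \<le> x" "0 \<le> y" for x y :: real
    proof (cases "x + y = 0")
      case True then show ?thesis using that p by (simp add: add_nonneg_eq_0_iff)
    next
      case False
      then have xy: "0 < x + y" using that by linarith
      have *: "z powr p \<le> z / (x + y) * (x + y) powr p" if "0 \<le> z" "z \<le> x + y" for z
      proof (cases "z = 0")
        case False
        have "(z / (x + y)) powr p \<le> (z / (x + y)) powr 1"
          using that xy p False by (intro powr_mono') auto
        then show ?thesis using that xy by (simp add: powr_divide field_simps)
      qed simp
      have "x powr p + y powr p \<le> x / (x + y) * (x + y) powr p + y / (x + y) * (x + y) powr p"
        by (intro add_mono *) (use that in auto)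
      also have "\<dots> = (x + y) powr p" using xy by (simp flip: distrib_right add_divide_distrib)
      finally show ?thesis .
    qed
    have "real n * (4 * t) powr p = (4 * t * real n powr (1 / p)) powr p"
      using p t by (simp add: powr_mult powr_powr)
    moreover have "2 * (2 * s) powr p \<le> (4 * s) powr p"
      using add[of "2 * s" "2 * s"] s by simp
    ultimately show ?thesis
      using add[of "4 * t * real n powr (1 / p)" "4 * s"] s t by simp
  qed
  finally have *: "(\<Sum>i<n. \<bar>d i\<bar> powr p) \<le> (4 * t * real n powr (1 / p) + 4 * s) powr p" .
  have "schatten_norm (ereal p) A = (\<Sum>i<n. \<bar>d i\<bar> powr p) powr (1 / p)"
    by (simp add: spectral_decomposition_schatten_norm[OF A spec])
  also have "\<dots> \<le> ((4 * t * real n powr (1 / p) + 4 * s) powr p) powr (1 / p)"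
    using * p by (intro powr_mono2) (auto intro: sum_nonneg)
  also have "\<dots> = 4 * t * real n powr (1 / p) + 4 * s"
    using p s t by (simp add: powr_powr)
  finally show ?thesis .
qed

section \<open>Gaussian product measures\<close>

definition std_gauss :: "real measure" where
  "std_gauss = density lborel std_normal_density"

definition gauss :: "'i set \<Rightarrow> ('i \<Rightarrow> real) measure" where
  "gauss I = (\<Pi>\<^sub>M i\<in>I. std_gauss)"

definition dot :: "'i set \<Rightarrow> ('i \<Rightarrow> real) \<Rightarrow> ('i \<Rightarrow> real) \<Rightarrow> real" where
  "dot I q x = (\<Sum>i\<in>I. q i * x i)"

text \<open>Restricting to \<open>I\<close> keeps the result among the extensional functions that
  form the space of \<open>pts I\<close>.\<close>

definition translate :: "'i set \<Rightarrow> ('i \<Rightarrow> real) \<Rightarrow> ('i \<Rightarrow> real) \<Rightarrow> 'i \<Rightarrow> real" where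
  "translate I v x = (\<lambda>i\<in>I. x i + v i)"

abbreviation pts :: "'i set \<Rightarrow> ('i \<Rightarrow> real) measure" where
  "pts I \<equiv> \<Pi>\<^sub>M i\<in>I. borel"

lemma sets_std_gauss [simp, measurable_cong]: "sets std_gauss = sets borel"
  by (simp add: std_gauss_def)

lemma space_std_gauss [simp]: "space std_gauss = UNIV"
  by (simp add: std_gauss_def)

lemma sets_gauss [measurable_cong]: "sets (gauss I) = sets (pts I)"
  unfolding gauss_def by (intro sets_PiM_cong) auto

lemma space_gauss: "space (gauss I) = space (pts I)"
  using sets_eq_imp_space_eq[OF sets_gauss] .

interpretation std_gauss: prob_space std_gauss
  unfolding std_gauss_def by (rule prob_space_normal_density) simp

interpretation std_gauss_prod: product_sigma_finite "\<lambda>_. std_gauss" ..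

lemma prob_space_gauss: "prob_space (gauss I)"
  unfolding gauss_def by (rule prob_space_PiM) (rule std_gauss.prob_space_axioms)

lemma measurable_dot [measurable]: "dot I q \<in> borel_measurable (pts I)"
  unfolding dot_def by measurable

lemma measurable_translate [measurable]: "translate I v \<in> measurable (pts I) (pts I)"
  unfolding translate_def by measurable

lemma translate_space [simp]: "translate I v x \<in> space (pts I)"
  by (simp add: translate_def space_PiM)

interpretation lborel_prod: product_sigma_finite "\<lambda>_. lborel :: real measure" ..

lemma sets_PiM_lborel [measurable_cong]: "sets (\<Pi>\<^sub>M i\<in>I. (lborel :: real measure)) = sets (pts I)"
  by (intro sets_PiM_cong) auto

lemma emeasure_lborel_translate:
  fixes c :: real
  assumes "A \<in> sets borel"
  shows "emeasure lborel ((\<lambda>x. x + c) -` A) = emeasure lborel A"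
proof -
  have "emeasure lborel A = emeasure (distr lborel borel ((+) c)) A" by (simp add: lborel_distr_plus)
  also have "\<dots> = emeasure lborel ((+) c -` A)" using assms by (subst emeasure_distr) auto
  also have "(+) c = (\<lambda>x. x + c)" by (simp add: fun_eq_iff add.commute)
  finally show ?thesis ..
qed

text \<open>A product measure is determined by its values on boxes, and the preimage of a box is a
  box with sides of the same length.\<close>

lemma lborel_PiM_translate:
  fixes v :: "'i \<Rightarrow> real"
  assumes I: "finite I"
  shows "distr (\<Pi>\<^sub>M i\<in>I. lborel) (\<Pi>\<^sub>M i\<in>I. lborel) (translate I v) = (\<Pi>\<^sub>M i\<in>I. lborel)"
proof (rule lborel_prod.PiM_eqI[OF I])
  fix A :: "'i \<Rightarrow> real set" assume A: "\<And>i. i \<in> I \<Longrightarrow> A i \<in> sets lborel"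
  have "translate I v -` Pi\<^sub>E I A \<inter> space (\<Pi>\<^sub>M i\<in>I. lborel) = Pi\<^sub>E I (\<lambda>i. (\<lambda>x. x + v i) -` A i)"
    by (auto simp: translate_def space_PiM PiE_def Pi_def)
  moreover have "Pi\<^sub>E I A \<in> sets (\<Pi>\<^sub>M i\<in>I. lborel)" using A I by (intro sets_PiM_I_finite) auto
  ultimately have "emeasure (distr (\<Pi>\<^sub>M i\<in>I. lborel) (\<Pi>\<^sub>M i\<in>I. lborel) (translate I v)) (Pi\<^sub>E I A)
      = emeasure (\<Pi>\<^sub>M i\<in>I. lborel) (Pi\<^sub>E I (\<lambda>i. (\<lambda>x. x + v i) -` A i))"
    by (subst emeasure_distr) (auto simp: sets_PiM_lborel measurable_cong_sets[OF sets_PiM_lborel sets_PiM_lborel])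
  also have "\<dots> = (\<Prod>i\<in>I. emeasure lborel ((\<lambda>x. x + v i) -` A i))"
  proof (intro lborel_prod.emeasure_PiM[OF I])
    fix i assume "i \<in> I"
    then show "(\<lambda>x. x + v i) -` A i \<in> sets lborel"
      using A measurable_sets[of "\<lambda>x. x + v i" borel borel "A i"] by simp
  qed
  also have "\<dots> = (\<Prod>i\<in>I. emeasure lborel (A i))"
    using A by (intro prod.cong refl emeasure_lborel_translate) auto
  finally show "emeasure (distr (\<Pi>\<^sub>M i\<in>I. lborel) (\<Pi>\<^sub>M i\<in>I. lborel) (translate I v)) (Pi\<^sub>E I A)
      = (\<Prod>i\<in>I. emeasure lborel (A i))" .
qed simp

lemma nn_integral_PiM_translate:
  assumes "finite I" and f [measurable]: "f \<in> borel_measurable (pts I)"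
  shows "(\<integral>\<^sup>+x. f (translate I v x) \<partial>(\<Pi>\<^sub>M i\<in>I. lborel)) = (\<integral>\<^sup>+x. f x \<partial>(\<Pi>\<^sub>M i\<in>I. lborel))"
  by (subst (2) lborel_PiM_translate[OF assms(1), symmetric, of v], subst nn_integral_distr) simp_all

definition gauss_density :: "'i set \<Rightarrow> ('i \<Rightarrow> real) \<Rightarrow> real" where
  "gauss_density I x = (\<Prod>i\<in>I. std_normal_density (x i))"

lemma measurable_gauss_density [measurable]: "gauss_density I \<in> borel_measurable (pts I)"
  unfolding gauss_density_def by measurable

lemma gauss_eq_density:
  fixes I :: "'i set"
  assumes I: "finite I"
  shows "gauss I = density (\<Pi>\<^sub>M i\<in>I. lborel) (gauss_density I)"
proof -
  have "density (\<Pi>\<^sub>M i\<in>I. lborel) (gauss_density I) = (\<Pi>\<^sub>M i\<in>I. std_gauss)"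
  proof (rule std_gauss_prod.PiM_eqI[OF I])
    fix A :: "'i \<Rightarrow> real set" assume A: "\<And>i. i \<in> I \<Longrightarrow> A i \<in> sets std_gauss"
    then have B: "Pi\<^sub>E I A \<in> sets (\<Pi>\<^sub>M i\<in>I. lborel)" using I by (intro sets_PiM_I_finite) auto
    have "emeasure (density (\<Pi>\<^sub>M i\<in>I. lborel) (gauss_density I)) (Pi\<^sub>E I A)
        = (\<integral>\<^sup>+x. ennreal (gauss_density I x) * indicator (Pi\<^sub>E I A) x \<partial>(\<Pi>\<^sub>M i\<in>I. lborel))"
      using B by (intro emeasure_density) auto
    also have "\<dots> = (\<integral>\<^sup>+x. (\<Prod>i\<in>I. ennreal (std_normal_density (x i)) * indicator (A i) (x i)) \<partial>(\<Pi>\<^sub>M i\<in>I. lborel))"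
      using I by (intro nn_integral_cong)
        (auto simp: gauss_density_def prod_ennreal prod.distrib space_PiM indicator_def PiE_def Pi_def
          intro!: prod_zero)
    also have "\<dots> = (\<Prod>i\<in>I. \<integral>\<^sup>+x. ennreal (std_normal_density x) * indicator (A i) x \<partial>lborel)"
      using A by (intro lborel_prod.product_nn_integral_prod[OF I]) auto
    also have "\<dots> = (\<Prod>i\<in>I. emeasure std_gauss (A i))"
      unfolding std_gauss_def using A by (intro prod.cong refl emeasure_density[symmetric]) auto
    finally show "emeasure (density (\<Pi>\<^sub>M i\<in>I. lborel) (gauss_density I)) (Pi\<^sub>E I A)
        = (\<Prod>i\<in>I. emeasure std_gauss (A i))" .
  qed (simp add: sets_PiM_lborel sets_gauss[unfolded gauss_def])
  then show ?thesis by (simp add: gauss_def)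
qed

lemma nn_integral_std_gauss:
  assumes [measurable]: "f \<in> borel_measurable borel"
  shows "(\<integral>\<^sup>+y. f y \<partial>std_gauss) = (\<integral>\<^sup>+y. ennreal (std_normal_density y) * f y \<partial>lborel)"
  unfolding std_gauss_def by (subst nn_integral_density) auto

lemma nn_integral_gauss:
  assumes "finite I" and [measurable]: "f \<in> borel_measurable (pts I)"
  shows "(\<integral>\<^sup>+x. f x \<partial>gauss I) = (\<integral>\<^sup>+x. ennreal (gauss_density I x) * f x \<partial>(\<Pi>\<^sub>M i\<in>I. lborel))"
  unfolding gauss_eq_density[OF assms(1)] by (subst nn_integral_density) auto

lemma gauss_density_eq:
  "gauss_density I x = (1 / sqrt (2 * pi)) ^ card I * exp (- (\<Sum>i\<in>I. (x i)\<^sup>2) / 2)"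
  unfolding gauss_density_def std_normal_density_def prod.distrib
  by (cases "finite I") (simp_all add: sum_divide_distrib flip: exp_sum sum_negf)

section \<open>Resampling a Gaussian vector along one direction\<close>

text \<open>For a unit vector \<open>u\<close>, this replaces the component of \<open>x\<close>
  along \<open>u\<close> by \<open>y\<close> and keeps the component orthogonal to
  \<open>u\<close>.\<close>

definition set_coord :: "'i set \<Rightarrow> ('i \<Rightarrow> real) \<Rightarrow> real \<Rightarrow> ('i \<Rightarrow> real) \<Rightarrow> 'i \<Rightarrow> real" where
  "set_coord I u y x = (\<lambda>i\<in>I. x i + (y - dot I u x) * u i)"

lemma set_coord_space [simp]: "set_coord I u y x \<in> space (pts I)"
  by (simp add: set_coord_def space_PiM)

lemma measurable_set_coord [measurable]:
  "(\<lambda>(y, x). set_coord I u y x) \<in> measurable (borel \<Otimes>\<^sub>M pts I) (pts I)"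
  unfolding set_coord_def by measurable

lemma measurable_set_coord_snd [measurable]: "set_coord I u y \<in> measurable (pts I) (pts I)"
  unfolding set_coord_def by measurable

text \<open>The map \<open>(y, x) \<mapsto> (dot I u x, set_coord I u y x)\<close> is a reflection of \<open>\<real> \<times> \<real>\<^sup>I\<close>; the proof
  writes it as a composition of shears, each of which preserves Lebesgue measure by Fubini.\<close>

lemma nn_integral_gauss_set_coord:
  fixes I :: "'i set"
  assumes I: "finite I" and u: "dot I u u = 1" and f [measurable]: "f \<in> borel_measurable (pts I)"
  shows "(\<integral>\<^sup>+y. \<integral>\<^sup>+x. f (set_coord I u y x) \<partial>gauss I \<partial>std_gauss) = (\<integral>\<^sup>+x. f x \<partial>gauss I)"
proof -
  let ?L = "\<Pi>\<^sub>M i\<in>I. (lborel :: real measure)"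
  let ?\<phi> = "\<lambda>y. ennreal (std_normal_density y)"
  let ?G = "\<lambda>x. ennreal (gauss_density I x)"
  interpret L: sigma_finite_measure ?L by (rule lborel_prod.sigma_finite[OF I])
  interpret P: pair_sigma_finite lborel ?L ..
  let ?a = "\<lambda>z x. translate I (\<lambda>i. z * u i) x"
  have [measurable]: "(\<lambda>(z, x). ?a z x) \<in> measurable (borel \<Otimes>\<^sub>M pts I) (pts I)"
    unfolding translate_def by measurable
  have sc: "set_coord I u y x = ?a (y - dot I u x) x" for y x
    by (simp add: set_coord_def translate_def)
  have "(\<integral>\<^sup>+y. \<integral>\<^sup>+x. f (set_coord I u y x) \<partial>gauss I \<partial>std_gauss)
      = (\<integral>\<^sup>+y. \<integral>\<^sup>+x. ?\<phi> y * (?G x * f (set_coord I u y x)) \<partial>?L \<partial>lborel)"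
    by (simp add: nn_integral_std_gauss nn_integral_gauss[OF I] nn_integral_cmult)
  also have "\<dots> = (\<integral>\<^sup>+x. \<integral>\<^sup>+y. ?\<phi> y * (?G x * f (set_coord I u y x)) \<partial>lborel \<partial>?L)"
    by (rule P.Fubini'[symmetric]) measurable
  \<comment> \<open>First shear, with \<open>x\<close> fixed:
    \<open>y = z + dot I u x\<close>.\<close>
  also have "\<dots> = (\<integral>\<^sup>+x. \<integral>\<^sup>+z. ?\<phi> (z + dot I u x) * (?G x * f (?a z x)) \<partial>lborel \<partial>?L)"
  proof (rule nn_integral_cong)
    fix x :: "'i \<Rightarrow> real" assume [measurable]: "x \<in> space ?L"
    then have [measurable]: "x \<in> space (pts I)" by (simp add: space_PiM)
    show "(\<integral>\<^sup>+y. ?\<phi> y * (?G x * f (set_coord I u y x)) \<partial>lborel)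
        = (\<integral>\<^sup>+z. ?\<phi> (z + dot I u x) * (?G x * f (?a z x)) \<partial>lborel)"
      unfolding sc
      by (subst nn_integral_real_affine[where c = 1 and t = "dot I u x"]) (simp_all add: add.commute)
  qed
  also have "\<dots> = (\<integral>\<^sup>+z. \<integral>\<^sup>+x. ?\<phi> (z + dot I u x) * (?G x * f (?a z x)) \<partial>?L \<partial>lborel)"
    by (rule P.Fubini') measurable
  \<comment> \<open>Second shear, with \<open>z\<close> fixed: translating \<open>x\<close> by
    \<open>- z\<close> times \<open>u\<close> cancels the displacement inside
    \<open>f\<close>.\<close>
  also have "\<dots> = (\<integral>\<^sup>+z. \<integral>\<^sup>+x. ?\<phi> (z - dot I u x) * (?G x * f x) \<partial>?L \<partial>lborel)"
  proof (rule nn_integral_cong)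
    fix z :: real
    let ?h = "\<lambda>x. ?\<phi> (z + dot I u x) * (?G x * f (?a z x))"
    have "(\<integral>\<^sup>+x. ?h x \<partial>?L) = (\<integral>\<^sup>+x. ?h (translate I (\<lambda>i. - (z * u i)) x) \<partial>?L)"
      by (rule nn_integral_PiM_translate[OF I, symmetric]) measurable
    also have "\<dots> = (\<integral>\<^sup>+x. ?\<phi> (z - dot I u x) * (?G x * f x) \<partial>?L)"
    proof (rule nn_integral_cong)
      fix x :: "'i \<Rightarrow> real" assume x: "x \<in> space ?L"
      let ?x = "translate I (\<lambda>i. - (z * u i)) x"
      have 1: "?a z ?x = x" using x by (auto simp: translate_def space_PiM PiE_def extensional_def)
      have 2: "dot I u ?x = dot I u x - z"
        using u by (simp add: dot_def translate_def algebra_simps sum.distrib sum_subtractf flip: sum_distrib_left)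
      have "(\<Sum>i\<in>I. (?x i)\<^sup>2) = (\<Sum>i\<in>I. (x i)\<^sup>2 - 2 * z * (u i * x i) + z\<^sup>2 * (u i * u i))"
        by (intro sum.cong refl) (simp add: translate_def power2_eq_square algebra_simps)
      also have "\<dots> = (\<Sum>i\<in>I. (x i)\<^sup>2) - 2 * z * dot I u x + z\<^sup>2"
        using u by (simp add: sum.distrib sum_subtractf dot_def flip: sum_distrib_left)
      finally have sq: "(\<Sum>i\<in>I. (?x i)\<^sup>2) = (\<Sum>i\<in>I. (x i)\<^sup>2) - 2 * z * dot I u x + z\<^sup>2" .
      \<comment> \<open>On both sides the exponent is minus half of the squared norm of
        \<open>x\<close> plus \<open>(z - dot I u x)^2\<close>. This is the invariance of the joint
        Gaussian density under the reflection.\<close>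
      have "std_normal_density (dot I u x) * gauss_density I ?x
          = std_normal_density (z - dot I u x) * gauss_density I x"
        unfolding gauss_density_eq std_normal_density_def sq
        by (simp flip: exp_add) (simp add: power2_eq_square algebra_simps flip: exp_add add_divide_distrib)
      then have 3: "?\<phi> (dot I u x) * ?G ?x = ?\<phi> (z - dot I u x) * ?G x"
        by (simp add: gauss_density_def prod_nonneg flip: ennreal_mult)
      show "?h ?x = ?\<phi> (z - dot I u x) * (?G x * f x)"
        unfolding 1 2 using 3 by (simp flip: mult.assoc)
    qed
    finally show "(\<integral>\<^sup>+x. ?h x \<partial>?L) = (\<integral>\<^sup>+x. ?\<phi> (z - dot I u x) * (?G x * f x) \<partial>?L)" .
  qed
  also have "\<dots> = (\<integral>\<^sup>+x. \<integral>\<^sup>+z. ?\<phi> (z - dot I u x) * (?G x * f x) \<partial>lborel \<partial>?L)"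
    by (rule P.Fubini'[symmetric]) measurable
  also have "\<dots> = (\<integral>\<^sup>+x. ?G x * f x \<partial>?L)"
  proof (rule nn_integral_cong)
    fix x :: "'i \<Rightarrow> real"
    \<comment> \<open>Third shear: with \<open>x\<close> fixed, \<open>z\<close> now occurs only in
      a shifted Gaussian density, which integrates to 1.\<close>
    have "(\<integral>\<^sup>+z. ?\<phi> (z - dot I u x) \<partial>lborel) = (\<integral>\<^sup>+z. ?\<phi> z \<partial>lborel)"
      by (subst nn_integral_real_affine[where c = 1 and t = "dot I u x"]) simp_all
    also have "\<dots> = (\<integral>\<^sup>+z. 1 \<partial>std_gauss)" using nn_integral_std_gauss[of "\<lambda>_. 1"] by simp
    also have "\<dots> = 1" using std_gauss.emeasure_space_1 by simp
    finally show "(\<integral>\<^sup>+z. ?\<phi> (z - dot I u x) * (?G x * f x) \<partial>lborel) = ?G x * f x"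
      by (simp add: nn_integral_multc)
  qed
  also have "\<dots> = (\<integral>\<^sup>+x. f x \<partial>gauss I)" by (simp add: nn_integral_gauss[OF I])
  finally show ?thesis .
qed

text \<open>As an identity of measures, resampling also applies to Bochner integrals of functions of
  either sign.\<close>

lemma gauss_eq_distr_set_coord:
  fixes I :: "'i set"
  assumes I: "finite I" and u: "dot I u u = 1"
  shows "gauss I = distr (std_gauss \<Otimes>\<^sub>M gauss I) (pts I) (\<lambda>(y, x). set_coord I u y x)"
    (is "_ = ?R")
proof (rule measure_eqI)
  interpret G: prob_space "gauss I" by (rule prob_space_gauss)
  show "sets (gauss I) = sets ?R" by (simp add: sets_gauss)
  fix A assume "A \<in> sets (gauss I)"
  then have A [measurable]: "A \<in> sets (pts I)" by (simp add: sets_gauss)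
  have "emeasure ?R A = (\<integral>\<^sup>+z. indicator A (case z of (y, x) \<Rightarrow> set_coord I u y x) \<partial>(std_gauss \<Otimes>\<^sub>M gauss I))"
    by (simp add: nn_integral_distr flip: nn_integral_indicator)
  also have "\<dots> = (\<integral>\<^sup>+y. \<integral>\<^sup>+x. indicator A (set_coord I u y x) \<partial>gauss I \<partial>std_gauss)"
    by (subst G.nn_integral_fst[symmetric]) simp_all
  also have "\<dots> = emeasure (gauss I) A"
    using A by (subst nn_integral_gauss_set_coord[OF I u]) (simp_all add: sets_gauss)
  finally show "emeasure (gauss I) A = emeasure ?R A" ..
qed

lemma integral_gauss_set_coord:
  fixes I :: "'i set" and f :: "('i \<Rightarrow> real) \<Rightarrow> real"
  assumes I: "finite I" and u: "dot I u u = 1" and f [measurable]: "f \<in> borel_measurable (pts I)"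
    and bd: "\<And>x. \<bar>f x\<bar> \<le> M"
  shows "(\<integral>x. f x \<partial>gauss I) = (\<integral>y. \<integral>x. f (set_coord I u y x) \<partial>gauss I \<partial>std_gauss)"
proof -
  interpret G: prob_space "gauss I" by (rule prob_space_gauss)
  interpret P: pair_prob_space std_gauss "gauss I" ..
  have "(\<integral>x. f x \<partial>gauss I) = (\<integral>z. f (case z of (y, x) \<Rightarrow> set_coord I u y x) \<partial>(std_gauss \<Otimes>\<^sub>M gauss I))"
    by (subst gauss_eq_distr_set_coord[OF I u], subst integral_distr) simp_all
  also have "\<dots> = (\<integral>y. \<integral>x. f (set_coord I u y x) \<partial>gauss I \<partial>std_gauss)"
  proof -
    have "integrable (std_gauss \<Otimes>\<^sub>M gauss I) (\<lambda>(y, x). f (set_coord I u y x))"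
      by (rule P.integrable_const_bound[of _ M]) (auto simp: bd split_beta)
    from P.integral_fst'[OF this] show ?thesis by (simp add: case_prod_unfold)
  qed
  finally show ?thesis .
qed

section \<open>Adaptive linear queries\<close>

text \<open>The Donsker-Varadhan inequality for a standard Gaussian and its translate by
  \<open>m\<close>, whose relative entropy is \<open>m^2 / 2\<close>. The term
  \<open>m * y - m^2 / 2\<close> is the logarithm of the density ratio, so adding it to
  \<open>L\<close> moves the exponential moment to the translate and lowers the mean by
  \<open>m^2 / 2\<close>; Jensen's inequality for \<open>exp\<close> compares the two.\<close>

lemma integral_std_gauss_le_ln_shifted:
  fixes L :: "real \<Rightarrow> real"
  assumes [measurable]: "L \<in> borel_measurable borel" and bd: "\<And>y. \<bar>L y\<bar> \<le> M"
  shows "(\<integral>y. L y \<partial>std_gauss) \<le> ln (\<integral>y. exp (L (y + m)) \<partial>std_gauss) + m\<^sup>2 / 2"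
proof -
  let ?X = "\<lambda>y. L y + (m * y - m\<^sup>2 / 2)"
  have dens: "(\<integral>y. f y \<partial>std_gauss) = (\<integral>y. std_normal_density y * f y \<partial>lborel)"
    if [measurable]: "f \<in> borel_measurable borel" for f :: "real \<Rightarrow> real"
    unfolding std_gauss_def by (subst integral_density) auto
  have int_L: "integrable std_gauss L"
    by (rule std_gauss.integrable_const_bound[of _ M]) (auto simp: bd)
  have int_id: "integrable std_gauss (\<lambda>y. y)"
    unfolding std_gauss_def using integrable_normal_moment_nz_1[of 1 0]
    by (subst integrable_density) auto
  have mean: "(\<integral>y. y \<partial>std_gauss) = 0"
    using integral_normal_moment_nz_1[of 1 0] by (simp add: dens)
  have int_X: "integrable std_gauss ?X" using int_L int_id by auto
  have EX: "(\<integral>y. ?X y \<partial>std_gauss) = (\<integral>y. L y \<partial>std_gauss) - m\<^sup>2 / 2"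
    using int_L int_id mean by (simp add: std_gauss.prob_space[simplified])
  have shift: "std_normal_density y * exp (m * y - m\<^sup>2 / 2) = std_normal_density (y - m)" for y
    unfolding std_normal_density_def
    by (simp flip: exp_add) (simp add: power2_eq_square field_simps)
  have eq: "(\<integral>y. exp (?X y) \<partial>std_gauss) = (\<integral>y. exp (L (y + m)) \<partial>std_gauss)"
  proof -
    have "(\<integral>y. exp (?X y) \<partial>std_gauss) = (\<integral>y. std_normal_density (y - m) * exp (L y) \<partial>lborel)"
      by (simp add: dens exp_add flip: shift) (simp add: mult_ac)
    also have "\<dots> = (\<integral>y. std_normal_density y * exp (L (y + m)) \<partial>lborel)"
      by (subst lborel_integral_real_affine[where c = 1 and t = m]) (simp_all add: add.commute)
    finally show ?thesis by (simp add: dens)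
  qed
  have int_eX: "integrable std_gauss (\<lambda>y. exp (?X y))"
  proof -
    have "integrable lborel (\<lambda>y. std_normal_density (y - m) * exp (L y))"
    proof (rule Bochner_Integration.integrable_bound)
      have "std_normal_density (y - m) = normal_density m 1 y" for y by (simp add: normal_density_def)
      then show "integrable lborel (\<lambda>y. exp M * std_normal_density (y - m))"
        by (simp only: integrable_mult_right integrable_normal_density zero_less_one)
      show "AE y in lborel. norm (std_normal_density (y - m) * exp (L y)) \<le> norm (exp M * std_normal_density (y - m))"
        using bd by (auto simp: abs_mult intro!: mult_right_mono simp: mult.commute[of _ "exp _"] abs_le_iff)
    qed measurable
    then show ?thesis
      unfolding std_gauss_def
      by (subst integrable_density) (auto simp: exp_add mult_ac simp flip: shift)
  qed
  have "exp (\<integral>y. ?X y \<partial>std_gauss) \<le> (\<integral>y. exp (?X y) \<partial>std_gauss)"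
    by (rule std_gauss.jensens_inequality[where I = UNIV])
      (use int_X int_eX in \<open>auto intro: exp_convex convex_on_exp\<close>)
  then have "(\<integral>y. L y \<partial>std_gauss) - m\<^sup>2 / 2 \<le> ln (\<integral>y. exp (L (y + m)) \<partial>std_gauss)"
    unfolding EX eq by (metis exp_gt_zero ln_exp ln_le_cancel_iff order_less_le_trans)
  then show ?thesis by simp
qed

text \<open>The value is a family indexed by \<open>I\<close>, so that one and the same sequence of queries can be scored
  differently for each location of the spike.\<close>

primrec adaptive :: "'i set \<Rightarrow> real \<Rightarrow> nat \<Rightarrow> (('i \<Rightarrow> real) \<Rightarrow> 'i \<Rightarrow> real) \<Rightarrow> bool" where
  "adaptive I M 0 \<Phi> \<longleftrightarrow> (\<exists>c. (\<forall>a. \<bar>c a\<bar> \<le> M) \<and> (\<forall>x \<in> space (pts I). \<Phi> x = c))"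
| "adaptive I M (Suc k) \<Phi> \<longleftrightarrow>
     (\<exists>q \<Psi>. (\<forall>a\<in>I. (\<lambda>(y, x). \<Psi> y x a) \<in> borel_measurable (borel \<Otimes>\<^sub>M pts I)) \<and>
       (\<forall>y. adaptive I M k (\<Psi> y)) \<and> (\<forall>x \<in> space (pts I). \<Phi> x = \<Psi> (dot I q x) x))"

lemma adaptive_bounded:
  "adaptive I M k \<Phi> \<Longrightarrow> x \<in> space (pts I) \<Longrightarrow> \<bar>\<Phi> x a\<bar> \<le> M"
  by (induction k arbitrary: \<Phi> x) auto

lemma adaptive_measurable:
  "adaptive I M k \<Phi> \<Longrightarrow> a \<in> I \<Longrightarrow> (\<lambda>x. \<Phi> x a) \<in> borel_measurable (pts I)"
proof (cases k)
  case 0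
  assume "adaptive I M k \<Phi>"
  then obtain c where "\<forall>x \<in> space (pts I). \<Phi> x = c" using 0 by auto
  then show ?thesis by (subst measurable_cong[of _ _ "\<lambda>_. c a"]) auto
next
  case (Suc k')
  assume "adaptive I M k \<Phi>" and a: "a \<in> I"
  then obtain q \<Psi> where [measurable]: "(\<lambda>(y, x). \<Psi> y x a) \<in> borel_measurable (borel \<Otimes>\<^sub>M pts I)"
    and eq: "\<forall>x \<in> space (pts I). \<Phi> x = \<Psi> (dot I q x) x"
    using Suc by auto
  have "(\<lambda>x. case (dot I q x, x) of (y, x) \<Rightarrow> \<Psi> y x a) \<in> borel_measurable (pts I)" by measurable
  then show ?thesis using eq by (subst measurable_cong[of _ _ "\<lambda>x. \<Psi> (dot I q x) x a"]) auto
qed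

text \<open>A query composed with \<open>T\<close> is a linear query plus a constant, and the
  constant is absorbed into the continuation \<open>\<Psi>\<close>; the number of queries stays
  \<open>k\<close>. The lemma serves to fix the first answer by \<open>set_coord\<close> and to keep
  the rest adaptive.\<close>

lemma adaptive_affine:
  assumes "adaptive I M k \<Phi>" and T [measurable]: "T \<in> measurable (pts I) (pts I)"
    and aff: "\<And>q. \<exists>c q'. \<forall>x \<in> space (pts I). dot I q (T x) = c + dot I q' x"
  shows "adaptive I M k (\<lambda>x. \<Phi> (T x))"
  using assms(1)
proof (induction k arbitrary: \<Phi>)
  case 0
  then show ?case using measurable_space[OF T] by auto
next
  case (Suc k)
  then obtain q \<Psi> where m: "\<forall>a\<in>I. (\<lambda>(y, x). \<Psi> y x a) \<in> borel_measurable (borel \<Otimes>\<^sub>M pts I)"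
    and ad: "\<forall>y. adaptive I M k (\<Psi> y)"
    and eq: "\<forall>x \<in> space (pts I). \<Phi> x = \<Psi> (dot I q x) x"
    by auto
  obtain c q' where q': "\<forall>x \<in> space (pts I). dot I q (T x) = c + dot I q' x" using aff by blast
  have "(\<lambda>(y, x). \<Psi> (c + y) (T x) a) \<in> borel_measurable (borel \<Otimes>\<^sub>M pts I)" if "a \<in> I" for a
  proof -
    have [measurable]: "(\<lambda>(y, x). \<Psi> y x a) \<in> borel_measurable (borel \<Otimes>\<^sub>M pts I)" using m that by blast
    have "(\<lambda>z. case (c + fst z, T (snd z)) of (y, x) \<Rightarrow> \<Psi> y x a) \<in> borel_measurable (borel \<Otimes>\<^sub>M pts I)"
      by measurable
    then show ?thesis by (simp add: split_beta)
  qed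
  moreover have "adaptive I M k (\<lambda>x. \<Psi> (c + y) (T x))" for y using Suc.IH ad by blast
  ultimately show ?case
    using eq q' measurable_space[OF T]
    by (auto intro!: exI[of _ q'] exI[of _ "\<lambda>y x. \<Psi> (c + y) (T x)"])
qed

definition spike :: "'i \<Rightarrow> real \<Rightarrow> 'i \<Rightarrow> real" where
  "spike a s = (\<lambda>i. if i = a then s else 0)"

text \<open>A chain rule for the relative entropy between the Gaussian and its translates, in the
  variational (Donsker--Varadhan) form: each query, normalised, adds at most \<open>s\<^sup>2 / 2\<close>
  in total over all the translates.\<close>

theorem adaptive_entropy_bound:
  fixes I :: "'i set"
  assumes I: "finite I" and "adaptive I M k \<Phi>"
  shows "(\<Sum>a\<in>I. \<integral>x. \<Phi> x a \<partial>gauss I)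
    \<le> (\<Sum>a\<in>I. ln (\<integral>x. exp (\<Phi> (translate I (spike a s) x) a) \<partial>gauss I)) + real k * s\<^sup>2 / 2"
  using assms(2)
proof (induction k arbitrary: \<Phi>)
  case 0
  interpret G: prob_space "gauss I" by (rule prob_space_gauss)
  from 0 obtain c where c: "\<forall>x \<in> space (pts I). \<Phi> x = c" by auto
  have "(\<integral>x. \<Phi> x a \<partial>gauss I) = c a" "(\<integral>x. exp (\<Phi> (translate I v x) a) \<partial>gauss I) = exp (c a)" for a v
  proof -
    have "(\<integral>x. \<Phi> x a \<partial>gauss I) = (\<integral>x. c a \<partial>gauss I)"
      using c by (intro Bochner_Integration.integral_cong) (auto simp: space_gauss)
    then show "(\<integral>x. \<Phi> x a \<partial>gauss I) = c a" using G.prob_space by simp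
    show "(\<integral>x. exp (\<Phi> (translate I v x) a) \<partial>gauss I) = exp (c a)"
      using c G.prob_space by simp
  qed
  then show ?case by simp
next
  case (Suc k)
  interpret G: prob_space "gauss I" by (rule prob_space_gauss)
  from Suc.prems obtain q \<Psi>
    where *: "\<forall>a\<in>I. (\<lambda>(y, x). \<Psi> y x a) \<in> borel_measurable (borel \<Otimes>\<^sub>M pts I)"
      "\<forall>y. adaptive I M k (\<Psi> y)" "\<forall>x \<in> space (pts I). \<Phi> x = \<Psi> (dot I q x) x"
    by auto
  have m: "(\<lambda>(y, x). \<Psi> y x a) \<in> borel_measurable (borel \<Otimes>\<^sub>M pts I)" if "a \<in> I" for a using * that by blast
  have ad: "adaptive I M k (\<Psi> y)" for y using * by blast
  have eq: "\<Phi> x = \<Psi> (dot I q x) x" if "x \<in> space (pts I)" for x using * that by blast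
  show ?case
  proof (cases "dot I q q = 0")
    case True
    then have "q i = 0" if "i \<in> I" for i
      using I that by (simp add: dot_def sum_nonneg_eq_0_iff)
    \<comment> \<open>The answer to such a query is always 0 and carries no information.\<close>
    then have "dot I q x = 0" for x by (simp add: dot_def)
    then have eq0: "\<Phi> x = \<Psi> 0 x" if "x \<in> space (pts I)" for x using eq that by simp
    have "(\<Sum>a\<in>I. \<integral>x. \<Phi> x a \<partial>gauss I) = (\<Sum>a\<in>I. \<integral>x. \<Psi> 0 x a \<partial>gauss I)"
      by (intro sum.cong refl Bochner_Integration.integral_cong) (simp_all add: eq0 space_gauss)
    also have "\<dots> \<le> (\<Sum>a\<in>I. ln (\<integral>x. exp (\<Psi> 0 (translate I (spike a s) x) a) \<partial>gauss I)) + real k * s\<^sup>2 / 2"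
      by (rule Suc.IH[OF ad])
    also have "(\<Sum>a\<in>I. ln (\<integral>x. exp (\<Psi> 0 (translate I (spike a s) x) a) \<partial>gauss I))
        = (\<Sum>a\<in>I. ln (\<integral>x. exp (\<Phi> (translate I (spike a s) x) a) \<partial>gauss I))"
      by (simp add: eq0)
    finally show ?thesis by (simp add: algebra_simps add_divide_distrib) (use zero_le_power2[of s] in linarith)
  next
    case False
    have "0 \<le> dot I q q" by (simp add: dot_def sum_nonneg)
    with False have pos: "0 < dot I q q" by simp
    define \<rho> where "\<rho> = sqrt (dot I q q)"
    have \<rho>: "0 < \<rho>" "\<rho> * \<rho> = dot I q q" using pos by (simp_all add: \<rho>_def)
    define u where "u = (\<lambda>i. q i / \<rho>)"
    have qu: "q i = \<rho> * u i" for i using \<rho> by (simp add: u_def)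
    have dq: "dot I q x = \<rho> * dot I u x" for x by (simp add: dot_def qu sum_distrib_left mult_ac)
    have "dot I u u = dot I q q / (\<rho> * \<rho>)" by (simp add: dot_def u_def sum_divide_distrib)
    then have u: "dot I u u = 1" using \<rho> pos by simp
    \<comment> \<open>The rest of the process once the first, normalised, answer is
      \<open>y\<close>: it sees a fresh Gaussian vector through its part orthogonal to
      \<open>u\<close>.\<close>
    define \<Theta> where "\<Theta> y x = \<Psi> (\<rho> * y) (set_coord I u y x)" for y x
    \<comment> \<open>The part of \<open>v\<close> along \<open>u\<close> only sees
      \<open>y\<close>, and the orthogonal part only sees \<open>x\<close>. This is the affine form
      that \<open>adaptive_affine\<close> asks for.\<close>
    have dT: "dot I v (set_coord I u y x) = y * dot I v u + dot I (\<lambda>i. v i - dot I v u * u i) x" for v y x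
    proof -
      have "dot I v (set_coord I u y x) = (\<Sum>i\<in>I. v i * x i + (y - dot I u x) * (v i * u i))"
        unfolding dot_def[of I v] by (intro sum.cong refl) (simp add: set_coord_def algebra_simps)
      also have "\<dots> = dot I v x + (y - dot I u x) * dot I v u"
        by (simp add: dot_def[of I v] sum.distrib sum_distrib_left)
      also have "dot I v x = dot I (\<lambda>i. v i - dot I v u * u i) x + dot I v u * dot I u x"
        by (simp add: dot_def[of I "\<lambda>i. v i - dot I v u * u i"] dot_def[of I v x] dot_def[of I u x]
            left_diff_distrib sum_subtractf sum_distrib_left mult.assoc)
      finally show ?thesis by (simp add: algebra_simps)
    qed
    have dTu: "dot I u (set_coord I u y x) = y" for y x
      unfolding dT u by (simp add: dot_def)
    have adT: "adaptive I M k (\<Theta> y)" for y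
      unfolding \<Theta>_def
    proof (rule adaptive_affine[OF ad measurable_set_coord_snd])
      show "\<exists>c q'. \<forall>x \<in> space (pts I). dot I v (set_coord I u y x) = c + dot I q' x" for v
        using dT by blast
    qed
    have m\<Theta>: "(\<lambda>(y, x). \<Theta> y x a) \<in> borel_measurable (borel \<Otimes>\<^sub>M pts I)" if "a \<in> I" for a
    proof -
      note [measurable] = m[OF that]
      have "(\<lambda>z. case (\<rho> * fst z, (case z of (y, x) \<Rightarrow> set_coord I u y x)) of (y, x) \<Rightarrow> \<Psi> y x a)
        \<in> borel_measurable (borel \<Otimes>\<^sub>M pts I)" by measurable
      then show ?thesis by (simp add: split_beta \<Theta>_def)
    qed
    have eqT: "\<Phi> (set_coord I u y x) = \<Theta> y x" for y x
      by (simp add: eq \<Theta>_def dq dTu)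
    have bdT: "\<bar>\<Theta> y x a\<bar> \<le> M" if "x \<in> space (pts I)" for y x a
      by (rule adaptive_bounded[OF adT that])
    \<comment> \<open>The log-moment of the remaining process under a spike at \<open>a\<close>, as
      a function of the first answer. It inherits the bound \<open>M\<close> and serves as the score
      in the one-dimensional inequality.\<close>
    define L where "L a y = ln (\<integral>x. exp (\<Theta> y (translate I (spike a s) x) a) \<partial>gauss I)" for a y
    have Lint: "integrable (gauss I) (\<lambda>x. exp (\<Theta> y (translate I (spike a s) x) a))" if "a \<in> I" for a y
    proof (rule G.integrable_const_bound[of _ "exp M"])
      note [measurable] = adaptive_measurable[OF adT that]
      show "(\<lambda>x. exp (\<Theta> y (translate I (spike a s) x) a)) \<in> borel_measurable (gauss I)" by measurable
      show "AE x in gauss I. norm (exp (\<Theta> y (translate I (spike a s) x) a)) \<le> exp M"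
        using bdT[OF translate_space] by (auto simp: abs_le_iff)
    qed
    have Lbd: "exp (- M) \<le> exp (L a y) \<and> exp (L a y) \<le> exp M
        \<and> exp (L a y) = (\<integral>x. exp (\<Theta> y (translate I (spike a s) x) a) \<partial>gauss I)" if "a \<in> I" for a y
    proof -
      have "exp (- M) \<le> (\<integral>x. exp (\<Theta> y (translate I (spike a s) x) a) \<partial>gauss I)"
        using bdT[OF translate_space] by (intro G.integral_ge_const Lint[OF that]) (auto simp: abs_le_iff minus_le_iff)
      moreover have "(\<integral>x. exp (\<Theta> y (translate I (spike a s) x) a) \<partial>gauss I) \<le> exp M"
        using bdT[OF translate_space] by (intro G.integral_le_const Lint[OF that]) (auto simp: abs_le_iff)
      moreover from calculation have "0 < (\<integral>x. exp (\<Theta> y (translate I (spike a s) x) a) \<partial>gauss I)"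
        by (meson exp_gt_zero less_le_trans)
      ultimately show ?thesis by (simp add: L_def)
    qed
    then have Lbd': "\<bar>L a y\<bar> \<le> M" if "a \<in> I" for a y
      using that by (fastforce simp: abs_le_iff)
    have Lm [measurable]: "L a \<in> borel_measurable borel" if "a \<in> I" for a
    proof -
      note [measurable] = m\<Theta>[OF that]
      have [measurable]: "(\<lambda>z. case (fst z, translate I (spike a s) (snd z)) of (y, x) \<Rightarrow> \<Theta> y x a)
          \<in> borel_measurable (borel \<Otimes>\<^sub>M pts I)" by measurable
      show ?thesis unfolding L_def
        by (intro borel_measurable_ln G.borel_measurable_lebesgue_integral)
           (simp add: split_beta)
    qed
    have step1: "(\<integral>x. \<Phi> x a \<partial>gauss I) = (\<integral>y. \<integral>x. \<Theta> y x a \<partial>gauss I \<partial>std_gauss)" if a: "a \<in> I" for a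
    proof -
      \<comment> \<open>\<open>integral_gauss_set_coord\<close> asks for a bound at every function,
        whereas \<open>adaptive_bounded\<close> controls only points of the space; hence the
        extension by 0.\<close>
      let ?f = "\<lambda>x. if x \<in> space (pts I) then \<Phi> x a else 0"
      note [measurable] = adaptive_measurable[OF Suc.prems a]
      have M0: "0 \<le> M" using Lbd'[OF a] abs_ge_zero order_trans by blast
      have "(\<integral>x. \<Phi> x a \<partial>gauss I) = (\<integral>x. ?f x \<partial>gauss I)"
        by (intro Bochner_Integration.integral_cong) (simp_all add: space_gauss)
      also have "\<dots> = (\<integral>y. \<integral>x. ?f (set_coord I u y x) \<partial>gauss I \<partial>std_gauss)"
        using adaptive_bounded[OF Suc.prems] M0
        by (intro integral_gauss_set_coord[OF I u, of _ M]) auto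
      finally show ?thesis by (simp add: eqT)
    qed
    have step2: "(\<integral>x. exp (\<Phi> (translate I (spike a s) x) a) \<partial>gauss I) = (\<integral>y. exp (L a (y + s * u a)) \<partial>std_gauss)"
      if a: "a \<in> I" for a
    proof -
      let ?f = "\<lambda>x. exp (\<Phi> (translate I (spike a s) x) a)"
      note [measurable] = adaptive_measurable[OF Suc.prems a]
      have "(\<integral>x. ?f x \<partial>gauss I) = (\<integral>y. \<integral>x. ?f (set_coord I u y x) \<partial>gauss I \<partial>std_gauss)"
        using adaptive_bounded[OF Suc.prems translate_space]
        by (intro integral_gauss_set_coord[OF I u, of _ "exp M"]) (auto simp: abs_le_iff)
      also have "\<dots> = (\<integral>y. \<integral>x. exp (\<Theta> (y + s * u a) (translate I (spike a s) x) a) \<partial>gauss I \<partial>std_gauss)"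
      proof -
        have "dot I u (translate I (spike a s) x) = dot I u x + s * u a" for x
          using a I by (simp add: dot_def translate_def spike_def algebra_simps sum.distrib
              if_distrib[of "\<lambda>z. _ * z"] sum.delta cong: if_cong)
        \<comment> \<open>The spike acts on the first answer as a shift by \<open>s * u a\<close>
          and on the resampled remainder as the same spike again. This is what makes the chain rule
          close.\<close>
        then have "translate I (spike a s) (set_coord I u y x)
            = set_coord I u (y + s * u a) (translate I (spike a s) x)" for x y
          by (auto simp: translate_def set_coord_def)
        then show ?thesis by (simp add: eqT)
      qed
      also have "\<dots> = (\<integral>y. exp (L a (y + s * u a)) \<partial>std_gauss)" using Lbd[OF a] by simp
      finally show ?thesis .
    qed
    have int1: "integrable std_gauss (\<lambda>y. \<integral>x. \<Theta> y x a \<partial>gauss I)" if a: "a \<in> I" for a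
    proof (rule std_gauss.integrable_const_bound[of _ M])
      note [measurable] = m\<Theta>[OF a]
      show "(\<lambda>y. \<integral>x. \<Theta> y x a \<partial>gauss I) \<in> borel_measurable std_gauss"
        by (intro G.borel_measurable_lebesgue_integral) measurable
      have "\<bar>\<integral>x. \<Theta> y x a \<partial>gauss I\<bar> \<le> M" for y
      proof -
        note [measurable] = adaptive_measurable[OF adT a]
        have i: "integrable (gauss I) (\<lambda>x. \<Theta> y x a)"
          by (rule G.integrable_const_bound[of _ M]) (auto simp: space_gauss intro!: AE_I2 bdT)
        have le: "\<Theta> y x a \<le> M" "- M \<le> \<Theta> y x a" if "x \<in> space (gauss I)" for x
          using bdT[of x y a] that by (simp_all add: space_gauss abs_le_iff minus_le_iff)
        show ?thesis
          using G.integral_le_const[OF i AE_I2[OF le(1)]] G.integral_ge_const[OF i AE_I2[OF le(2)]]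
          by simp
      qed
      then show "AE y in std_gauss. norm (\<integral>x. \<Theta> y x a \<partial>gauss I) \<le> M" by simp
    qed
    have int2: "integrable std_gauss (L a)" if "a \<in> I" for a
      by (rule std_gauss.integrable_const_bound[of _ M]) (use that Lbd' in auto)
    have "(\<Sum>a\<in>I. \<integral>x. \<Phi> x a \<partial>gauss I) = (\<integral>y. (\<Sum>a\<in>I. \<integral>x. \<Theta> y x a \<partial>gauss I) \<partial>std_gauss)"
      by (simp add: step1 int1 Bochner_Integration.integral_sum)
    \<comment> \<open>The induction hypothesis holds for every fixed first answer \<open>y\<close>
      and is then averaged.\<close>
    also have "\<dots> \<le> (\<integral>y. (\<Sum>a\<in>I. L a y) + real k * s\<^sup>2 / 2 \<partial>std_gauss)"
      using int1 int2 Suc.IH[OF adT, folded L_def] by (intro integral_mono) auto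
    also have "\<dots> = (\<Sum>a\<in>I. \<integral>y. L a y \<partial>std_gauss) + real k * s\<^sup>2 / 2"
      using int2 std_gauss.prob_space by (simp add: Bochner_Integration.integral_sum)
    also have "\<dots> \<le> (\<Sum>a\<in>I. ln (\<integral>y. exp (L a (y + s * u a)) \<partial>std_gauss) + (s * u a)\<^sup>2 / 2) + real k * s\<^sup>2 / 2"
      by (intro add_right_mono sum_mono integral_std_gauss_le_ln_shifted[OF Lm Lbd'])
    also have "\<dots> = (\<Sum>a\<in>I. ln (\<integral>x. exp (\<Phi> (translate I (spike a s) x) a) \<partial>gauss I)) + real (Suc k) * s\<^sup>2 / 2"
    proof -
      \<comment> \<open>One query has a single unit of squared length to spread over all the
        positions.\<close>
      have "(\<Sum>a\<in>I. (s * u a)\<^sup>2 / 2) = s\<^sup>2 / 2 * dot I u u"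
        unfolding dot_def sum_distrib_left by (intro sum.cong refl) (simp add: power2_eq_square)
      then have "(\<Sum>a\<in>I. (s * u a)\<^sup>2 / 2) = s\<^sup>2 / 2" unfolding u by simp
      moreover have "(\<Sum>a\<in>I. ln (\<integral>y. exp (L a (y + s * u a)) \<partial>std_gauss))
          = (\<Sum>a\<in>I. ln (\<integral>x. exp (\<Phi> (translate I (spike a s) x) a) \<partial>gauss I))"
        by (rule sum.cong[OF refl]) (simp only: step2)
      ultimately show ?thesis unfolding sum.distrib by (simp add: field_simps)
    qed
    finally show ?thesis .
  qed
qed

section \<open>Quadratic forms with Gaussian coefficients\<close>

text \<open>Along the normalised \<open>c\<close> the vector is a standard Gaussian, by resampling.
  For \<open>y \<ge> r\<close> one has \<open>y^2 \<ge> r^2 + (y - r)^2\<close>, so there the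
  density is at most \<open>exp (- r^2 / 2)\<close> times that of the unit Gaussian centred at
  \<open>r\<close>, which has total mass 1.\<close>

lemma gauss_tail:
  fixes I :: "'i set"
  assumes I: "finite I" and c: "dot I c c \<le> \<sigma>\<^sup>2" and \<sigma>: "0 < \<sigma>" and \<tau>: "0 < \<tau>"
  shows "measure (gauss I) {x \<in> space (pts I). \<tau> \<le> dot I c x} \<le> exp (- \<tau>\<^sup>2 / (2 * \<sigma>\<^sup>2))"
proof (cases "dot I c c = 0")
  case True
  then have "c i = 0" if "i \<in> I" for i
    using I that by (simp add: dot_def sum_nonneg_eq_0_iff)
  then have "dot I c x = 0" for x by (simp add: dot_def)
  then show ?thesis using \<tau> by simp
next
  case False
  interpret G: prob_space "gauss I" by (rule prob_space_gauss)
  have "0 \<le> dot I c c" by (simp add: dot_def sum_nonneg)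
  with False have pos: "0 < dot I c c" by simp
  define \<rho> where "\<rho> = sqrt (dot I c c)"
  have \<rho>: "0 < \<rho>" "\<rho>\<^sup>2 = dot I c c" "\<rho> \<le> \<sigma>"
    using pos c \<sigma> by (simp_all add: \<rho>_def real_le_lsqrt)
  define u where "u = (\<lambda>i. c i / \<rho>)"
  have cu: "c i = \<rho> * u i" for i using \<rho> by (simp add: u_def)
  have dc: "dot I c x = \<rho> * dot I u x" for x by (simp add: dot_def cu sum_distrib_left mult_ac)
  have "dot I u u = dot I c c / \<rho>\<^sup>2" by (simp add: dot_def u_def sum_divide_distrib power2_eq_square)
  then have u: "dot I u u = 1" using \<rho> pos by simp
  have dTu: "dot I u (set_coord I u y x) = y" for y x
  proof -
    have "dot I u (set_coord I u y x) = (\<Sum>i\<in>I. u i * x i + (y - dot I u x) * (u i * u i))"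
      unfolding dot_def[of I u "set_coord I u y x"]
      by (intro sum.cong refl) (simp add: set_coord_def algebra_simps)
    also have "\<dots> = dot I u x + (y - dot I u x) * dot I u u"
      by (simp add: dot_def[of I u] sum.distrib sum_distrib_left)
    finally show ?thesis by (simp add: u)
  qed
  define r where "r = \<tau> / \<sigma>"
  have r: "0 < r" using \<tau> \<sigma> by (simp add: r_def)
  have sub: "{x \<in> space (pts I). \<tau> \<le> dot I c x} \<subseteq> {x \<in> space (gauss I). r \<le> dot I u x}"
  proof safe
    fix x assume "\<tau> \<le> dot I c x"
    then have "\<tau> / \<rho> \<le> dot I u x" using \<rho> by (simp add: dc field_simps)
    moreover have "r \<le> \<tau> / \<rho>" unfolding r_def using \<rho> \<sigma> \<tau> by (intro divide_left_mono) auto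
    ultimately show "r \<le> dot I u x" by simp
  qed (simp add: space_gauss)
  have "emeasure (gauss I) {x \<in> space (gauss I). r \<le> dot I u x}
      = (\<integral>\<^sup>+x. indicator {x \<in> space (gauss I). r \<le> dot I u x} x \<partial>gauss I)"
    by (rule nn_integral_indicator[symmetric]) measurable
  also have "\<dots> = (\<integral>\<^sup>+x. indicator {r..} (dot I u x) \<partial>gauss I)"
    by (rule nn_integral_cong) (simp add: indicator_def)
  also have "\<dots> = (\<integral>\<^sup>+y. \<integral>\<^sup>+x. indicator {r..} (dot I u (set_coord I u y x)) \<partial>gauss I \<partial>std_gauss)"
    by (rule nn_integral_gauss_set_coord[OF I u, symmetric]) measurable
  also have "\<dots> = (\<integral>\<^sup>+y. indicator {r..} y \<partial>std_gauss)"
    unfolding dTu using G.emeasure_space_1 by simp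
  also have "\<dots> = (\<integral>\<^sup>+y. ennreal (std_normal_density y) * indicator {r..} y \<partial>lborel)"
    by (rule nn_integral_std_gauss) simp
  also have "\<dots> \<le> (\<integral>\<^sup>+y. ennreal (exp (- r\<^sup>2 / 2)) * ennreal (normal_density r 1 y) \<partial>lborel)"
  proof (rule nn_integral_mono)
    fix y :: real
    show "ennreal (std_normal_density y) * indicator {r..} y \<le> ennreal (exp (- r\<^sup>2 / 2)) * ennreal (normal_density r 1 y)"
    proof (cases "r \<le> y")
      case True
      have "0 \<le> r * (y - r)" using True r by simp
      then have "- y\<^sup>2 / 2 \<le> - r\<^sup>2 / 2 + - (y - r)\<^sup>2 / 2" by (simp add: power2_eq_square algebra_simps)
      then have "exp (- y\<^sup>2 / 2) \<le> exp (- r\<^sup>2 / 2) * exp (- (y - r)\<^sup>2 / 2)"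
        by (simp only: exp_le_cancel_iff flip: exp_add)
      then have "std_normal_density y \<le> exp (- r\<^sup>2 / 2) * normal_density r 1 y"
        by (simp add: normal_density_def divide_right_mono)
      then show ?thesis using True by (simp add: flip: ennreal_mult)
    qed simp
  qed
  also have "\<dots> = ennreal (exp (- r\<^sup>2 / 2)) * (\<integral>\<^sup>+y. ennreal (normal_density r 1 y) \<partial>lborel)"
    by (rule nn_integral_cmult) simp
  also have "(\<integral>\<^sup>+y. ennreal (normal_density r 1 y) \<partial>lborel) = 1"
    by (subst nn_integral_eq_integral) simp_all
  finally have "measure (gauss I) {x \<in> space (gauss I). r \<le> dot I u x} \<le> exp (- r\<^sup>2 / 2)"
    by (simp add: G.emeasure_eq_measure)
  moreover have "measure (gauss I) {x \<in> space (pts I). \<tau> \<le> dot I c x} \<le> measure (gauss I) {x \<in> space (gauss I). r \<le> dot I u x}"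
    using sub by (rule G.finite_measure_mono) measurable
  ultimately show ?thesis by (simp add: r_def power_divide mult.commute)
qed

lemma gauss_tail_abs:
  fixes I :: "'i set"
  assumes I: "finite I" and c: "dot I c c \<le> \<sigma>\<^sup>2" and "0 < \<sigma>" "0 < \<tau>"
  shows "measure (gauss I) {x \<in> space (pts I). \<tau> \<le> \<bar>dot I c x\<bar>} \<le> 2 * exp (- \<tau>\<^sup>2 / (2 * \<sigma>\<^sup>2))"
proof -
  interpret G: prob_space "gauss I" by (rule prob_space_gauss)
  have neg: "dot I (\<lambda>i. - c i) x = - dot I c x" for x by (simp add: dot_def sum_negf)
  have cc: "dot I (\<lambda>i. - c i) (\<lambda>i. - c i) \<le> \<sigma>\<^sup>2" using c by (simp add: dot_def)
  have "measure (gauss I) {x \<in> space (pts I). \<tau> \<le> \<bar>dot I c x\<bar>}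
      \<le> measure (gauss I) ({x \<in> space (pts I). \<tau> \<le> dot I c x} \<union> {x \<in> space (pts I). \<tau> \<le> dot I (\<lambda>i. - c i) x})"
    by (intro G.finite_measure_mono) (auto simp: neg sets_gauss)
  also have "\<dots> \<le> measure (gauss I) {x \<in> space (pts I). \<tau> \<le> dot I c x}
      + measure (gauss I) {x \<in> space (pts I). \<tau> \<le> dot I (\<lambda>i. - c i) x}"
    by (intro measure_Un_le) (auto simp: sets_gauss)
  also have "\<dots> \<le> exp (- \<tau>\<^sup>2 / (2 * \<sigma>\<^sup>2)) + exp (- \<tau>\<^sup>2 / (2 * \<sigma>\<^sup>2))"
    using assms cc by (intro add_mono gauss_tail) auto
  finally show ?thesis by simp
qed

definition pairs :: "nat \<Rightarrow> (nat \<times> nat) set" where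
  "pairs d = {(i, j). i < j \<and> j < d}"

lemma finite_pairs [simp]: "finite (pairs d)"
  by (rule finite_subset[of _ "{..<d} \<times> {..<d}"]) (auto simp: pairs_def)

text \<open>The quadratic form of the symmetric matrix with zero diagonal and entries \<open>x\<close> above it.\<close>

definition pair_form :: "nat \<Rightarrow> (nat \<times> nat \<Rightarrow> real) \<Rightarrow> (nat \<Rightarrow> real) \<Rightarrow> real" where
  "pair_form d x y = dot (pairs d) (\<lambda>(i, j). 2 * y i * y j) x"

abbreviation sqnorm :: "nat \<Rightarrow> (nat \<Rightarrow> real) \<Rightarrow> real" where
  "sqnorm d y \<equiv> (\<Sum>i<d. (y i)\<^sup>2)"

lemma sqnorm_scale: "sqnorm d (\<lambda>i. r * y i) = r\<^sup>2 * sqnorm d y"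
  by (simp add: power_mult_distrib sum_distrib_left)

lemma pair_form_scale: "pair_form d x (\<lambda>i. r * y i) = r\<^sup>2 * pair_form d x y"
  by (simp add: pair_form_def dot_def sum_distrib_left power2_eq_square split_beta mult_ac)

text \<open>Polarization of the product of \<open>y - w\<close> and \<open>y + w\<close>, with a
  factor 2 moved from the second to the first. The first vector will be short and the second long;
  without this rebalancing the sum of the two squared norms would be too large for the contraction
  in \<open>pair_form_bound_of_net\<close>.\<close>

lemma pair_form_polarization:
  "4 * (pair_form d x y - pair_form d x w)
    = pair_form d x (\<lambda>i. 2 * (y i - w i) + (y i + w i) / 2) - pair_form d x (\<lambda>i. 2 * (y i - w i) - (y i + w i) / 2)"
  unfolding pair_form_def dot_def sum_subtractf[symmetric] sum_distrib_left
  by (intro sum.cong refl) (auto simp: split_beta field_simps)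

section \<open>A net in the unit ball\<close>

text \<open>After division by \<open>4 * sqrt d\<close> these are the points of a cubic grid inside
  the unit ball. The box exhibits them as a subset of a finite product, over which the weights used
  for counting factorise.\<close>

definition net :: "nat \<Rightarrow> (nat \<Rightarrow> int) set" where
  "net d = {z \<in> {..<d} \<rightarrow>\<^sub>E {- int (16 * d)..int (16 * d)}. (\<Sum>i<d. (z i)\<^sup>2) \<le> int (16 * d)}"

lemma finite_net: "finite (net d)"
  by (rule finite_subset[of _ "{..<d} \<rightarrow>\<^sub>E {- int (16 * d)..int (16 * d)}"])
     (auto simp: net_def intro: finite_PiE)

lemma sum_half_power_abs: "(\<Sum>k\<in>{- int m..int m}. (1 / 2 :: real) ^ nat \<bar>k\<bar>) = 3 - 2 * (1 / 2) ^ m"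
proof (induction m)
  case (Suc m)
  have "{- int (Suc m)..int (Suc m)} = insert (- int (Suc m)) (insert (int (Suc m)) {- int m..int m})"
    by auto
  then show ?case using Suc by (simp add: nat_add_distrib)
qed simp

lemma abs_le_square_int: "\<bar>k :: int\<bar> \<le> k\<^sup>2"
proof (cases "k = 0")
  case False
  then have "\<bar>k\<bar> * 1 \<le> \<bar>k\<bar> * \<bar>k\<bar>" by (intro mult_left_mono) auto
  then show ?thesis by (simp add: power2_eq_square)
qed simp

text \<open>Each point of the net is weighted by \<open>\<Prod>i<d. 2 ^ 16 * (1 / 2) ^ \<bar>z i\<bar> \<ge> 1\<close>; the total weight is a product.\<close>

lemma card_net: "real (card (net d)) \<le> 2 ^ (18 * d)"
proof -
  let ?Z = "{- int (16 * d)..int (16 * d)}"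
  have one_le: "1 \<le> (\<Prod>i<d. 2 ^ 16 * (1 / 2 :: real) ^ nat \<bar>z i\<bar>)" if z: "z \<in> net d" for z
  proof -
    have "(\<Sum>i<d. \<bar>z i\<bar>) \<le> (\<Sum>i<d. (z i)\<^sup>2)" by (rule sum_mono) (rule abs_le_square_int)
    also have "\<dots> \<le> int (16 * d)" using z by (simp add: net_def)
    finally have "int (\<Sum>i<d. nat \<bar>z i\<bar>) \<le> int (16 * d)" by simp
    then have "(\<Sum>i<d. nat \<bar>z i\<bar>) \<le> 16 * d" by (simp only: of_nat_le_iff)
    then have "(1 / 2 :: real) ^ (16 * d) \<le> (1 / 2) ^ (\<Sum>i<d. nat \<bar>z i\<bar>)" by (intro power_decreasing) auto
    then have "1 \<le> 2 ^ (16 * d) * (1 / 2 :: real) ^ (\<Sum>i<d. nat \<bar>z i\<bar>)" by (simp add: field_simps)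
    also have "\<dots> = (\<Prod>i<d. 2 ^ 16 * (1 / 2 :: real) ^ nat \<bar>z i\<bar>)"
      unfolding prod.distrib power_sum by (simp add: power_mult)
    finally show ?thesis .
  qed
  have "real (card (net d)) = (\<Sum>z\<in>net d. 1)" by simp
  also have "\<dots> \<le> (\<Sum>z\<in>net d. \<Prod>i<d. 2 ^ 16 * (1 / 2 :: real) ^ nat \<bar>z i\<bar>)"
    by (intro sum_mono one_le)
  also have "\<dots> \<le> (\<Sum>z\<in>{..<d} \<rightarrow>\<^sub>E ?Z. \<Prod>i<d. 2 ^ 16 * (1 / 2 :: real) ^ nat \<bar>z i\<bar>)"
  proof (rule sum_mono2)
    show "finite ({..<d} \<rightarrow>\<^sub>E ?Z)" by (rule finite_PiE) simp_all
    show "net d \<subseteq> {..<d} \<rightarrow>\<^sub>E ?Z" by (simp only: net_def Collect_subset)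
  qed (rule prod_nonneg, simp)
  also have "\<dots> = (\<Prod>i<d. \<Sum>k\<in>?Z. 2 ^ 16 * (1 / 2 :: real) ^ nat \<bar>k\<bar>)"
    by (rule prod_sum_PiE[symmetric]) auto
  \<comment> \<open>The two-sided geometric sum stays below 4, so each factor is at most
    \<open>2 ^ 16 * 4\<close>.\<close>
  also have "\<dots> \<le> (\<Prod>i<d. 2 ^ 18)"
  proof (intro prod_mono conjI)
    fix i
    have "(\<Sum>k\<in>?Z. 2 ^ 16 * (1 / 2 :: real) ^ nat \<bar>k\<bar>) = 2 ^ 16 * (3 - 2 * (1 / 2) ^ (16 * d))"
      unfolding sum_distrib_left[symmetric] sum_half_power_abs ..
    also have "\<dots> \<le> 2 ^ 16 * 4" proof (rule mult_left_mono)
      have "0 \<le> 2 * (1 / 2 :: real) ^ (16 * d)" by simp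
      then show "3 - 2 * (1 / 2 :: real) ^ (16 * d) \<le> 4" by linarith
    qed simp
    finally show "(\<Sum>k\<in>?Z. 2 ^ 16 * (1 / 2 :: real) ^ nat \<bar>k\<bar>) \<le> 2 ^ 18" by simp
  qed (auto intro!: sum_nonneg)
  also have "\<dots> = 2 ^ (18 * d)" by (simp add: power_mult)
  finally show ?thesis .
qed

definition net_point :: "nat \<Rightarrow> (nat \<Rightarrow> int) \<Rightarrow> nat \<Rightarrow> real" where
  "net_point d z = (\<lambda>i. of_int (z i) / (4 * sqrt (real d)))"

lemma sqnorm_net_point:
  assumes "z \<in> net d" "0 < d" shows "sqnorm d (net_point d z) \<le> 1"
proof -
  have "sqnorm d (net_point d z) = of_int (\<Sum>i<d. (z i)\<^sup>2) / (16 * real d)"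
    using assms(2) by (simp add: net_point_def power_divide power_mult_distrib sum_divide_distrib)
  also have "\<dots> \<le> of_int (int (16 * d)) / (16 * real d)"
  proof (rule divide_right_mono)
    have "(\<Sum>i<d. (z i)\<^sup>2) \<le> int (16 * d)" using assms(1) by (simp only: net_def mem_Collect_eq)
    then show "real_of_int (\<Sum>i<d. (z i)\<^sup>2) \<le> real_of_int (int (16 * d))" by (simp only: of_int_le_iff)
  qed simp
  finally show ?thesis using assms(2) by simp
qed

text \<open>Round the scaled coordinates to integers towards zero. This does not increase the norm,
  so the point stays in the net, and an error of at most 1 in each of \<open>d\<close> coordinates
  becomes \<open>d / (16 * d)\<close> after scaling back.\<close>

lemma net_approximation:
  assumes y: "sqnorm d y = 1" and d: "0 < d"
  shows "\<exists>z\<in>net d. sqnorm d (\<lambda>i. y i - net_point d z i) \<le> 1 / 16"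
proof -
  define a where "a i = 4 * sqrt (real d) * y i" for i
  define z where "z = (\<lambda>i\<in>{..<d}. if 0 \<le> a i then \<lfloor>a i\<rfloor> else \<lceil>a i\<rceil>)"
  have z12: "\<bar>real_of_int (z i)\<bar> \<le> \<bar>a i\<bar> \<and> \<bar>a i - of_int (z i)\<bar> \<le> 1" if i: "i < d" for i
  proof (cases "0 \<le> a i")
    case True
    then have "0 \<le> real_of_int \<lfloor>a i\<rfloor>" by simp
    then show ?thesis using i True floor_correct[of "a i"] by (simp add: z_def) linarith
  next
    case False
    then have "real_of_int \<lceil>a i\<rceil> \<le> 0" by simp
    then show ?thesis using i False ceiling_correct[of "a i"] by (simp add: z_def)
  qed
  then have z1: "\<bar>real_of_int (z i)\<bar> \<le> \<bar>a i\<bar>" and z2: "\<bar>a i - of_int (z i)\<bar> \<le> 1" if "i < d" for i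
    using that by blast+
  have "real_of_int (\<Sum>i<d. (z i)\<^sup>2) \<le> (\<Sum>i<d. (a i)\<^sup>2)"
    using z1 by (auto simp: abs_le_square_iff intro!: sum_mono)
  also have "\<dots> = 16 * real d"
    using y by (simp add: a_def power_mult_distrib flip: sum_distrib_left)
  finally have "real_of_int (\<Sum>i<d. (z i)\<^sup>2) \<le> real_of_int (int (16 * d))" by simp
  then have sq: "(\<Sum>i<d. (z i)\<^sup>2) \<le> int (16 * d)" by (simp only: of_int_le_iff)
  have "\<bar>z i\<bar> \<le> int (16 * d)" if "i < d" for i
  proof -
    have "\<bar>z i\<bar> \<le> (z i)\<^sup>2"
      by (rule abs_le_square_int)
    also have "\<dots> \<le> (\<Sum>i<d. (z i)\<^sup>2)" using that by (intro member_le_sum) auto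
    finally show ?thesis using sq by simp
  qed
  then have "z \<in> net d" using sq by (auto simp: net_def z_def abs_le_iff minus_le_iff)
  moreover have "sqnorm d (\<lambda>i. y i - net_point d z i) \<le> (\<Sum>i<d. 1 / (16 * real d))"
  proof (rule sum_mono)
    fix i assume "i \<in> {..<d}"
    then have "(a i - of_int (z i))\<^sup>2 \<le> 1" using z2[of i] by (simp add: abs_square_le_1)
    moreover have "y i - net_point d z i = (a i - of_int (z i)) / (4 * sqrt (real d))"
      using d by (simp add: a_def net_point_def field_simps)
    ultimately show "(y i - net_point d z i)\<^sup>2 \<le> 1 / (16 * real d)"
      using d by (simp add: power_divide power_mult_distrib divide_right_mono)
  qed
  ultimately show ?thesis using d by (intro bexI[of _ z]) simp_all
qed

text \<open>A bound \<open>M\<close> on the form improves to \<open>\<tau> + 5 / 8 * M\<close> by the net; iterating, one reaches the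
  fixed point \<open>8 / 3 * \<tau>\<close>.\<close>

lemma pair_form_bound_of_net:
  assumes d: "0 < d" and net: "\<And>z. z \<in> net d \<Longrightarrow> \<bar>pair_form d x (net_point d z)\<bar> \<le> \<tau>"
  shows "\<bar>pair_form d x y\<bar> \<le> 8 / 3 * \<tau> * sqnorm d y"
proof -
  define P where "P M \<longleftrightarrow> (\<forall>y. \<bar>pair_form d x y\<bar> \<le> M * sqnorm d y)" for M
  have improve: "P (\<tau> + 5 / 8 * M)" if M: "P M" for M
    unfolding P_def
  proof
    fix y
    show "\<bar>pair_form d x y\<bar> \<le> (\<tau> + 5 / 8 * M) * sqnorm d y"
    proof (cases "sqnorm d y = 0")
      case True
      then show ?thesis using M by (auto simp: P_def) (metis abs_le_zero_iff mult_zero_right)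
    next
      case False
      have "0 \<le> sqnorm d y" by (simp add: sum_nonneg)
      with False have pos: "0 < sqnorm d y" by simp
      define r where "r = sqrt (sqnorm d y)"
      have r: "0 < r" "r\<^sup>2 = sqnorm d y" using pos by (simp_all add: r_def)
      define v where "v = (\<lambda>i. inverse r * y i)"
      have v: "sqnorm d v = 1" unfolding v_def sqnorm_scale using r pos by (simp add: power_inverse)
      obtain z where z: "z \<in> net d" "sqnorm d (\<lambda>i. v i - net_point d z i) \<le> 1 / 16"
        using net_approximation[OF v d] by blast
      let ?w = "net_point d z"
      let ?p = "\<lambda>i. 2 * (v i - ?w i) + (v i + ?w i) / 2" and ?m = "\<lambda>i. 2 * (v i - ?w i) - (v i + ?w i) / 2"
      have "sqnorm d ?p + sqnorm d ?m = 8 * sqnorm d (\<lambda>i. v i - ?w i) + sqnorm d (\<lambda>i. v i + ?w i) / 2"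
        unfolding sum.distrib[symmetric] sum_distrib_left sum_divide_distrib
        by (intro sum.cong refl) (simp add: power2_eq_square field_simps)
      moreover have "sqnorm d (\<lambda>i. v i + ?w i) + sqnorm d (\<lambda>i. v i - ?w i) = 2 * sqnorm d v + 2 * sqnorm d ?w"
        unfolding sum.distrib[symmetric] sum_distrib_left
        by (intro sum.cong refl) (simp add: power2_eq_square field_simps)
      moreover have "0 \<le> sqnorm d (\<lambda>i. v i - ?w i)" by (simp add: sum_nonneg)
      \<comment> \<open>With squared distance \<open>e \<le> 1 / 16\<close> the sum is at most
        \<open>8 * e + (4 - e) / 2\<close>, below \<open>5 / 2\<close>; division by the 4 of the
        polarization identity gives the factor \<open>5 / 8\<close>.\<close>
      ultimately have le: "sqnorm d ?p + sqnorm d ?m \<le> 5 / 2"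
        using z(2) v sqnorm_net_point[OF z(1) d] by linarith
      have M0: "0 \<le> M" using M[unfolded P_def, rule_format, of v] v by simp
      have "\<bar>pair_form d x ?p\<bar> \<le> M * sqnorm d ?p" "\<bar>pair_form d x ?m\<bar> \<le> M * sqnorm d ?m"
        using M by (simp_all only: P_def)
      then have "4 * \<bar>pair_form d x v - pair_form d x ?w\<bar> \<le> M * (sqnorm d ?p + sqnorm d ?m)"
        using pair_form_polarization[of d x v ?w] unfolding distrib_left by linarith
      also have "\<dots> \<le> M * (5 / 2)" using le M0 by (rule mult_left_mono)
      finally have vb: "\<bar>pair_form d x v\<bar> \<le> \<tau> + 5 / 8 * M" using net[OF z(1)] abs_triangle_ineq2[of "pair_form d x v" "pair_form d x ?w"] by simp
      have "pair_form d x y = r\<^sup>2 * pair_form d x v"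
        unfolding v_def pair_form_scale using r(1) by (simp add: power_inverse)
      then have "\<bar>pair_form d x y\<bar> = r\<^sup>2 * \<bar>pair_form d x v\<bar>" by (simp add: abs_mult)
      also have "\<dots> \<le> r\<^sup>2 * (\<tau> + 5 / 8 * M)" by (rule mult_left_mono[OF vb]) simp
      finally show ?thesis unfolding r(2) by (simp only: mult.commute)
    qed
  qed
  \<comment> \<open>A crude finite bound from which the iteration can start; its size disappears in
    the limit.\<close>
  have "P (\<Sum>(i, j)\<in>pairs d. \<bar>x (i, j)\<bar>)"
    unfolding P_def
  proof
    fix y
    have "\<bar>pair_form d x y\<bar> \<le> (\<Sum>(i, j)\<in>pairs d. \<bar>2 * y i * y j * x (i, j)\<bar>)"
      unfolding pair_form_def dot_def by (rule order_trans[OF sum_abs]) (simp add: split_beta)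
    also have "\<dots> \<le> (\<Sum>(i, j)\<in>pairs d. \<bar>x (i, j)\<bar> * sqnorm d y)"
    proof (intro sum_mono, clarify)
      fix i j assume ij: "(i, j) \<in> pairs d"
      have "\<bar>2 * y i * y j\<bar> \<le> (y i)\<^sup>2 + (y j)\<^sup>2"
      proof -
        have "0 \<le> (y i + y j)\<^sup>2" "0 \<le> (y i - y j)\<^sup>2" by simp_all
        then show ?thesis unfolding power2_sum power2_diff abs_le_iff by linarith
      qed
      also have "\<dots> = (\<Sum>k\<in>{i, j}. (y k)\<^sup>2)" using ij by (simp add: pairs_def)
      also have "\<dots> \<le> sqnorm d y" using ij by (intro sum_mono2) (auto simp: pairs_def)
      finally show "\<bar>2 * y i * y j * x (i, j)\<bar> \<le> \<bar>x (i, j)\<bar> * sqnorm d y"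
        unfolding abs_mult[of _ "x (i, j)"] by (subst mult.commute) (rule mult_left_mono, auto)
    qed
    finally show "\<bar>pair_form d x y\<bar> \<le> (\<Sum>(i, j)\<in>pairs d. \<bar>x (i, j)\<bar>) * sqnorm d y"
      by (simp add: sum_distrib_right split_beta)
  qed
  then obtain B where B: "P B" by blast
  have iter: "P (8 / 3 * \<tau> + (5 / 8) ^ n * (B - 8 / 3 * \<tau>))" for n
  proof (induction n)
    case (Suc n)
    have "\<tau> + 5 / 8 * (8 / 3 * \<tau> + e * c) = 8 / 3 * \<tau> + 5 / 8 * e * c" for e c :: real by (simp add: field_simps)
    with improve[OF Suc] show ?case by (simp only: power_Suc)
  qed (use B in simp)
  have "(\<lambda>n. (8 / 3 * \<tau> + (5 / 8) ^ n * (B - 8 / 3 * \<tau>)) * sqnorm d y)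
      \<longlonglongrightarrow> (8 / 3 * \<tau> + 0 * (B - 8 / 3 * \<tau>)) * sqnorm d y"
    by (intro tendsto_intros LIMSEQ_power_zero) simp
  then have "\<bar>pair_form d x y\<bar> \<le> (8 / 3 * \<tau> + 0 * (B - 8 / 3 * \<tau>)) * sqnorm d y"
    by (rule LIMSEQ_le_const) (use iter in \<open>auto simp: P_def\<close>)
  then show ?thesis by simp
qed

section \<open>The event that the Gaussian matrix has small norm\<close>

text \<open>Finitely many conditions, hence measurable at once and open to a union bound, yet enough
  to control the form at every vector. The constant 14 makes the Gaussian tail beat the cardinality
  of the net.\<close>

definition good :: "nat \<Rightarrow> (nat \<times> nat \<Rightarrow> real) set" where
  "good d = {x \<in> space (pts (pairs d)). \<forall>z\<in>net d. \<bar>pair_form d x (net_point d z)\<bar> < 14 * sqrt (real d)}"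

lemma good_pair_form:
  assumes "x \<in> good d" "0 < d"
  shows "\<bar>pair_form d x y\<bar> \<le> 38 * sqrt (real d) * sqnorm d y"
proof -
  \<comment> \<open>The constant 38 rounds up \<open>8 / 3 * 14\<close>.\<close>
  have "\<bar>pair_form d x y\<bar> \<le> 8 / 3 * (14 * sqrt (real d)) * sqnorm d y"
    using assms by (intro pair_form_bound_of_net) (auto simp: good_def)
  also have "\<dots> \<le> 38 * sqrt (real d) * sqnorm d y"
    by (intro mult_right_mono) (auto intro: sum_nonneg)
  finally show ?thesis .
qed

lemma measurable_pair_form [measurable]: "(\<lambda>x. pair_form d x y) \<in> borel_measurable (pts (pairs d))"
  unfolding pair_form_def by measurable

lemma sets_good [measurable]: "good d \<in> sets (pts (pairs d))"
  unfolding good_def using finite_net by measurable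

text \<open>Union bound. At a point of the unit ball the form has variance at most 4, so it exceeds
  the threshold with probability at most \<open>2 * exp (- 24.5 * d)\<close>, which is below
  \<open>2 * (1 / 2) ^ (24 * d)\<close>. Against \<open>2 ^ (18 * d)\<close> points this leaves
  \<open>2 * (1 / 64) ^ d\<close>, at most \<open>1 / 20\<close>.\<close>

lemma measure_good:
  assumes d: "0 < d"
  shows "19 / 20 \<le> measure (gauss (pairs d)) (good d)"
proof -
  interpret G: prob_space "gauss (pairs d)" by (rule prob_space_gauss)
  let ?\<tau> = "14 * sqrt (real d)"
  define bad where "bad z = {x \<in> space (pts (pairs d)). ?\<tau> \<le> \<bar>pair_form d x (net_point d z)\<bar>}" for z
  have bad_meas: "bad z \<in> sets (gauss (pairs d))" for z
    unfolding bad_def sets_gauss by measurable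
  have bad_le: "measure (gauss (pairs d)) (bad z) \<le> 2 * (1 / 2) ^ (24 * d)" if z: "z \<in> net d" for z
  proof -
    let ?y = "net_point d z"
    let ?c = "\<lambda>(i, j). 2 * ?y i * ?y j"
    have "dot (pairs d) ?c ?c = (\<Sum>(i, j)\<in>pairs d. (2 * ?y i * ?y j)\<^sup>2)"
      by (simp add: dot_def power2_eq_square split_beta)
    also have "\<dots> \<le> (\<Sum>(i, j)\<in>{..<d} \<times> {..<d}. (2 * ?y i * ?y j)\<^sup>2)"
      by (rule sum_mono2) (auto simp: pairs_def)
    also have "\<dots> = 4 * (sqnorm d ?y)\<^sup>2"
      unfolding sum.cartesian_product[symmetric] power2_eq_square[of "sqnorm d ?y"] sum_product
      by (simp add: sum_distrib_left power_mult_distrib mult_ac)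
    also have "\<dots> \<le> 2\<^sup>2"
      using power_le_one[OF _ sqnorm_net_point[OF z d], of 2] by (simp add: sum_nonneg)
    finally have "measure (gauss (pairs d)) (bad z) \<le> 2 * exp (- ?\<tau>\<^sup>2 / (2 * 2\<^sup>2))"
      unfolding bad_def pair_form_def using d by (intro gauss_tail_abs) auto
    also have "- ?\<tau>\<^sup>2 / (2 * 2\<^sup>2) \<le> - real (24 * d)" by (simp add: power_mult_distrib)
    also have "exp (- real (24 * d)) = (1 / exp 1) ^ (24 * d)"
      by (simp add: exp_minus power_divide inverse_eq_divide flip: exp_of_nat_mult)
    also have "\<dots> \<le> (1 / 2) ^ (24 * d)"
      using exp_ge_add_one_self[of 1] by (intro power_mono divide_left_mono) auto
    finally show ?thesis by simp
  qed
  have "space (gauss (pairs d)) - good d = (\<Union>z\<in>net d. bad z)"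
    by (auto simp: good_def bad_def space_gauss not_less)
  then have "measure (gauss (pairs d)) (space (gauss (pairs d)) - good d) \<le> (\<Sum>z\<in>net d. measure (gauss (pairs d)) (bad z))"
    using finite_net bad_meas by (simp add: G.finite_measure_subadditive_finite image_subset_iff)
  also have "\<dots> \<le> (\<Sum>z\<in>net d. 2 * (1 / 2) ^ (24 * d))" by (intro sum_mono bad_le)
  also have "\<dots> \<le> 2 ^ (18 * d) * (2 * (1 / 2) ^ (24 * d))"
    using card_net[of d] by (simp add: mult_right_mono)
  also have "\<dots> = 2 * (1 / 64) ^ d"
  proof -
    have "(2::real) ^ (18 * d) * (1 / 2) ^ (24 * d) = (2 ^ 18 * (1 / 2) ^ 24) ^ d"
      unfolding power_mult power_mult_distrib ..
    also have "(2::real) ^ 18 * (1 / 2) ^ 24 = 1 / 64" by (simp add: power_one_over)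
    finally show ?thesis by (simp only: mult.left_commute)
  qed
  also have "\<dots> \<le> 2 * (1 / 64) ^ 1" using d by (intro mult_left_mono power_decreasing) auto
  finally have "measure (gauss (pairs d)) (space (gauss (pairs d)) - good d) \<le> 1 / 20" by simp
  then show ?thesis by (subst (asm) G.prob_compl) (auto simp: sets_gauss)
qed

section \<open>Testers on spiked Gaussian matrices\<close>

definition instance_mat :: "nat \<Rightarrow> real \<Rightarrow> (nat \<times> nat \<Rightarrow> real) \<Rightarrow> real mat" where
  "instance_mat d t x = mat d d (\<lambda>(i, j). if i = j then t else if i < j then x (i, j) else x (j, i))"

lemma instance_mat_carrier [simp]: "instance_mat d t x \<in> carrier_mat d d"
  by (simp add: instance_mat_def)

lemma instance_mat_symmetric: "transpose_mat (instance_mat d t x) = instance_mat d t x"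
  by (rule eq_matI) (auto simp: instance_mat_def)

lemma instance_mat_sym_mats [simp]: "instance_mat d t x \<in> sym_mats d"
  by (simp add: sym_mats_def instance_mat_symmetric)

lemma sum_square_split_pairs:
  fixes f :: "nat \<Rightarrow> nat \<Rightarrow> real"
  shows "(\<Sum>i<d. \<Sum>j<d. f i j) = (\<Sum>i<d. f i i) + (\<Sum>(i, j)\<in>pairs d. f i j + f j i)"
proof -
  let ?D = "(\<lambda>i. (i, i)) ` {..<d}" and ?S = "(\<lambda>(i, j). (j, i)) ` pairs d"
  have "{..<d} \<times> {..<d} = ?D \<union> (pairs d \<union> ?S)"
    by (auto simp: pairs_def image_iff)
  then have "(\<Sum>i<d. \<Sum>j<d. f i j) = (\<Sum>(i, j)\<in>?D \<union> (pairs d \<union> ?S). f i j)"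
    by (simp add: sum.cartesian_product)
  also have "\<dots> = (\<Sum>(i, j)\<in>?D. f i j) + ((\<Sum>(i, j)\<in>pairs d. f i j) + (\<Sum>(i, j)\<in>?S. f i j))"
    by (subst sum.union_disjoint, simp, simp, force simp: pairs_def,
        subst sum.union_disjoint, simp, simp, force simp: pairs_def, rule refl)
  also have "(\<Sum>(i, j)\<in>?D. f i j) = (\<Sum>i<d. f i i)"
    by (subst sum.reindex) (auto simp: inj_on_def)
  also have "(\<Sum>(i, j)\<in>?S. f i j) = (\<Sum>(i, j)\<in>pairs d. f j i)"
    by (subst sum.reindex) (auto simp: inj_on_def split_beta)
  finally show ?thesis by (simp add: sum.distrib split_beta)
qed

text \<open>The diagonal contributes a number determined by the query alone, so an answer is a known
  shift of a linear functional of the Gaussian entries.\<close>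

lemma bilinear_instance_mat:
  "(\<Sum>i<d. \<Sum>j<d. instance_mat d t x $$ (i, j) * v i * w j)
    = t * (\<Sum>i<d. v i * w i) + dot (pairs d) (\<lambda>(i, j). v i * w j + v j * w i) x"
proof -
  have "(\<Sum>i<d. instance_mat d t x $$ (i, i) * v i * w i) = t * (\<Sum>i<d. v i * w i)"
    unfolding sum_distrib_left by (intro sum.cong refl) (simp add: instance_mat_def)
  moreover have "(\<Sum>(i, j)\<in>pairs d. instance_mat d t x $$ (i, j) * v i * w j + instance_mat d t x $$ (j, i) * v j * w i)
      = dot (pairs d) (\<lambda>(i, j). v i * w j + v j * w i) x"
    unfolding dot_def by (intro sum.cong refl) (auto simp: instance_mat_def pairs_def algebra_simps)
  ultimately show ?thesis unfolding sum_square_split_pairs by simp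
qed

lemma query_instance_mat:
  assumes "v \<in> carrier_vec d" "w \<in> carrier_vec d"
  shows "v \<bullet> (instance_mat d t x *\<^sub>v w)
    = t * (\<Sum>i<d. v $ i * w $ i) + dot (pairs d) (\<lambda>(i, j). v $ i * w $ j + v $ j * w $ i) x"
proof -
  have "v \<bullet> (instance_mat d t x *\<^sub>v w) = (\<Sum>i<d. \<Sum>j<d. instance_mat d t x $$ (i, j) * v $ i * w $ j)"
    using assms carrier_matD[OF instance_mat_carrier[of d t x]]
    by (auto simp: scalar_prod_def lessThan_atLeast0 sum_distrib_left mult_ac intro!: sum.cong)
  then show ?thesis by (simp only: bilinear_instance_mat)
qed

lemma quad_form_instance_mat:
  "quad_form d (instance_mat d t x) y = t * sqnorm d y + pair_form d x y"
proof -
  have "quad_form d (instance_mat d t x) y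
      = t * (\<Sum>i<d. y i * y i) + dot (pairs d) (\<lambda>(i, j). y i * y j + y j * y i) x"
    unfolding quad_form_def by (rule bilinear_instance_mat)
  also have "(\<lambda>(i, j). y i * y j + y j * y i) = (\<lambda>(i, j). 2 * y i * y j)"
    by (auto simp: fun_eq_iff)
  finally show ?thesis by (simp add: pair_form_def power2_eq_square)
qed

lemma psd_instance_mat:
  assumes "\<And>y. \<bar>pair_form d x y\<bar> \<le> t * sqnorm d y"
  shows "psd_mat (instance_mat d t x)"
proof -
  have "0 \<le> v \<bullet> (instance_mat d t x *\<^sub>v v)" if v: "v \<in> carrier_vec d" for v
  proof -
    have "v \<bullet> (instance_mat d t x *\<^sub>v v) = quad_form d (instance_mat d t x) (\<lambda>i. v $ i)"
      using v carrier_matD[OF instance_mat_carrier[of d t x]]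
      by (auto simp: quad_form_def scalar_prod_def lessThan_atLeast0 sum_distrib_left mult_ac intro!: sum.cong)
    then show ?thesis using assms[of "\<lambda>i. v $ i"] by (simp add: quad_form_instance_mat abs_le_iff)
  qed
  then show ?thesis
    unfolding psd_mat_def carrier_matD(1)[OF instance_mat_carrier] by simp
qed

lemma pair_form_translate_spike:
  assumes "(a, b) \<in> pairs d"
  shows "pair_form d (translate (pairs d) (spike (a, b) s) x) y = pair_form d x y + 2 * s * y a * y b"
proof -
  have "pair_form d (translate (pairs d) (spike (a, b) s) x) y
      = (\<Sum>c\<in>pairs d. (case c of (i, j) \<Rightarrow> 2 * y i * y j) * x c + (if c = (a, b) then 2 * s * y a * y b else 0))"
    unfolding pair_form_def dot_def
    by (intro sum.cong refl) (auto simp: translate_def spike_def algebra_simps)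
  then show ?thesis using assms by (simp add: sum.distrib pair_form_def dot_def)
qed

lemma card_pairs: "2 * card (pairs d) = d * (d - 1)"
proof (induction d)
  case (Suc d)
  have "pairs (Suc d) = pairs d \<union> {..<d} \<times> {d}" by (auto simp: pairs_def)
  moreover have "card (pairs d \<union> {..<d} \<times> {d}) = card (pairs d) + card ({..<d} \<times> {d})"
    by (rule card_Un_disjoint, simp, simp, force simp: pairs_def)
  ultimately show ?case using Suc by (cases d) auto
qed (simp add: pairs_def)

lemma card_pairs_ge: assumes "2 \<le> d" shows "(real d)\<^sup>2 / 4 \<le> real (card (pairs d))"
proof -
  have "real (2 * card (pairs d)) = real d * (real d - 1)"
    unfolding card_pairs using assms by (simp add: of_nat_diff)
  moreover have "real d * (real d / 2) \<le> real d * (real d - 1)"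
    using assms by (intro mult_left_mono) auto
  ultimately show ?thesis by (simp add: power2_eq_square)
qed

text \<open>Queries are made even after \<open>T\<close> has halted, so that all histories have the same length; the verdict
  is read off at the first prefix on which \<open>T\<close> halts.\<close>

definition accepts :: "vmv_algorithm \<Rightarrow> nat \<Rightarrow> real \<Rightarrow> (nat \<Rightarrow> real) \<Rightarrow> bool" where
  "accepts T m \<omega> y \<longleftrightarrow> (\<exists>n\<in>{..m}. halts T \<omega> (map y [0..<n]) \<and>
     (\<forall>j\<in>{..<n}. \<not> halts T \<omega> (map y [0..<j])) \<and> verdict T \<omega> (map y [0..<n]))"

definition query :: "vmv_algorithm \<Rightarrow> real mat \<Rightarrow> real \<Rightarrow> real list \<Rightarrow> real" where
  "query T A \<omega> h = left_vec T \<omega> h \<bullet> (A *\<^sub>v right_vec T \<omega> h)"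

text \<open>\<open>m\<close> answers are stored in \<open>y\<close> and \<open>n\<close> queries
  remain. Peeling off the next query first matches the recursion of \<open>adaptive\<close>, and
  storing answers in a function rather than a list matches \<open>history_space\<close>.\<close>

primrec run :: "vmv_algorithm \<Rightarrow> real mat \<Rightarrow> real \<Rightarrow> nat \<Rightarrow> nat \<Rightarrow> (nat \<Rightarrow> real) \<Rightarrow> bool" where
  "run T A \<omega> 0 m y = accepts T m \<omega> y"
| "run T A \<omega> (Suc n) m y = run T A \<omega> n (Suc m) (y(m := query T A \<omega> (map y [0..<m])))"

lemma answers_after_halt:
  "halts T \<omega> (answers T A \<omega> n) \<Longrightarrow> n \<le> l \<Longrightarrow> answers T A \<omega> l = answers T A \<omega> n"
  by (induction l) (auto simp: Let_def le_Suc_eq)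

lemma outputs_iff_verdict:
  assumes "halts T \<omega> (answers T A \<omega> n)"
  shows "outputs T A \<omega> b \<longleftrightarrow> verdict T \<omega> (answers T A \<omega> n) = b"
proof
  assume "outputs T A \<omega> b"
  then obtain l where "halts T \<omega> (answers T A \<omega> l)" "verdict T \<omega> (answers T A \<omega> l) = b"
    by (auto simp: outputs_def)
  then show "verdict T \<omega> (answers T A \<omega> n) = b"
    using answers_after_halt[OF assms, of l] answers_after_halt[of T \<omega> A l n] by (metis nat_le_linear)
qed (use assms in \<open>auto simp: outputs_def\<close>)

text \<open>Unrolls the recursion into one complete transcript \<open>z\<close>, described by the
  fact that every new entry answers the query determined by the entries before it.\<close>

lemma run_eq_accepts:
  "\<exists>z. run T A \<omega> n m y = accepts T (m + n) \<omega> z \<and> (\<forall>j<m. z j = y j) \<and>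
     (\<forall>j. m \<le> j \<and> j < m + n \<longrightarrow> z j = query T A \<omega> (map z [0..<j]))"
proof (induction n arbitrary: m y)
  case (Suc n)
  let ?y = "y(m := query T A \<omega> (map y [0..<m]))"
  obtain z where z: "run T A \<omega> n (Suc m) ?y = accepts T (Suc m + n) \<omega> z" "\<forall>j<Suc m. z j = ?y j"
    "\<forall>j. Suc m \<le> j \<and> j < Suc m + n \<longrightarrow> z j = query T A \<omega> (map z [0..<j])"
    using Suc by blast
  have "map z [0..<m] = map y [0..<m]" using z(2) by auto
  moreover have "z m = ?y m" using z(2) by blast
  ultimately have "z m = query T A \<omega> (map z [0..<m])" by (simp only: fun_upd_same)
  then have "\<forall>j. m \<le> j \<and> j < m + Suc n \<longrightarrow> z j = query T A \<omega> (map z [0..<j])"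
    using z(3) by (metis Suc_leI add_Suc_shift le_neq_implies_less)
  moreover have "\<forall>j<m. z j = y j" using z(2) by auto
  ultimately show ?case using z(1) by auto
qed auto

text \<open>Up to the first halting time the prefixes of the padded transcript are the true answer
  lists, and \<open>accepts\<close> looks no further than the first halting prefix.\<close>

lemma run_iff_outputs:
  assumes "n \<le> k" and "halts T \<omega> (answers T A \<omega> n)"
  shows "run T A \<omega> k 0 y \<longleftrightarrow> outputs T A \<omega> True"
proof -
  obtain z where z: "run T A \<omega> k 0 y = accepts T k \<omega> z"
    "\<And>j. j < k \<Longrightarrow> z j = query T A \<omega> (map z [0..<j])"
    using run_eq_accepts[of T A \<omega> k 0 y] by auto
  define m where "m = (LEAST n. halts T \<omega> (answers T A \<omega> n))"
  have m: "halts T \<omega> (answers T A \<omega> m)" unfolding m_def by (rule LeastI) (rule assms(2))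
  have before: "\<not> halts T \<omega> (answers T A \<omega> j)" if "j < m" for j
    using that not_less_Least unfolding m_def by blast
  have mk: "m \<le> k" using Least_le[of "\<lambda>n. halts T \<omega> (answers T A \<omega> n)", OF assms(2)] assms(1)
    by (simp add: m_def)
  have eq: "map z [0..<j] = answers T A \<omega> j" if "j \<le> m" for j
    using that
  proof (induction j)
    case (Suc j)
    then have "z j = query T A \<omega> (map z [0..<j])" using z(2) mk by simp
    then show ?case using Suc before[of j] by (simp add: Let_def query_def)
  qed simp
  have "accepts T k \<omega> z \<longleftrightarrow> verdict T \<omega> (answers T A \<omega> m)"
  proof
    assume "accepts T k \<omega> z"
    then obtain n where n: "halts T \<omega> (map z [0..<n])" "\<forall>j<n. \<not> halts T \<omega> (map z [0..<j])"
      "verdict T \<omega> (map z [0..<n])" by (auto simp: accepts_def)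
    have "n = m"
    proof (rule ccontr)
      assume "n \<noteq> m"
      then consider "n < m" | "m < n" by linarith
      then show False
      proof cases
        case 1 then show False using n(1) eq[of n] before[of n] by simp
      next
        case 2 then show False using n(2)[rule_format, OF 2] eq[of m] m by simp
      qed
    qed
    then show "verdict T \<omega> (answers T A \<omega> m)" using n(3) eq[of m] by simp
  next
    assume "verdict T \<omega> (answers T A \<omega> m)"
    then show "accepts T k \<omega> z"
      unfolding accepts_def using m mk before eq by (intro bexI[of _ m]) auto
  qed
  then show ?thesis using z(1) outputs_iff_verdict[OF m, of True] by simp
qed

section \<open>Measurability of runs, and runs as adaptive linear queries\<close>

context
  fixes d :: nat and T :: vmv_algorithm and t :: real
  assumes T: "is_vmv_algorithm d T"
begin

lemma left_vec_carrier: "\<omega> \<in> space (coins T) \<Longrightarrow> left_vec T \<omega> h \<in> carrier_vec d"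
  and right_vec_carrier: "\<omega> \<in> space (coins T) \<Longrightarrow> right_vec T \<omega> h \<in> carrier_vec d"
  using T by (auto simp: is_vmv_algorithm_def)

text \<open>Composition with arbitrary measurable \<open>W\<close> and \<open>Y\<close> covers both
  uses below: fixed coins with Gaussian input, and coins and input drawn jointly.\<close>

lemma measurable_on_history:
  assumes W: "W \<in> measurable M (coins T)" and Y: "Y \<in> measurable M (\<Pi>\<^sub>M i\<in>{..<m}. (borel :: real measure))"
  shows "Measurable.pred M (\<lambda>z. halts T (W z) (map (Y z) [0..<m]))"
    and "Measurable.pred M (\<lambda>z. verdict T (W z) (map (Y z) [0..<m]))"
    and "i < d \<Longrightarrow> (\<lambda>z. left_vec T (W z) (map (Y z) [0..<m]) $ i) \<in> borel_measurable M"
    and "i < d \<Longrightarrow> (\<lambda>z. right_vec T (W z) (map (Y z) [0..<m]) $ i) \<in> borel_measurable M"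
proof -
  have WY: "(\<lambda>z. (W z, Y z)) \<in> measurable M (history_space T m)"
    unfolding history_space_def using W Y by measurable
  have compose: "(\<lambda>z. f (W z) (map (Y z) [0..<m])) \<in> measurable M N"
    if "on_history m f \<in> measurable (history_space T m) N" for f :: "real \<Rightarrow> real list \<Rightarrow> 'c" and N
    using measurable_compose[OF WY that] by (simp add: on_history_def)
  note alg = T[unfolded is_vmv_algorithm_def]
  show "Measurable.pred M (\<lambda>z. halts T (W z) (map (Y z) [0..<m]))"
    using alg by (intro compose) blast
  show "Measurable.pred M (\<lambda>z. verdict T (W z) (map (Y z) [0..<m]))"
    using alg by (intro compose) blast
  show "(\<lambda>z. left_vec T (W z) (map (Y z) [0..<m]) $ i) \<in> borel_measurable M" if "i < d"
    using alg that by (intro compose[of "\<lambda>\<omega> h. left_vec T \<omega> h $ i"]) blast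
  show "(\<lambda>z. right_vec T (W z) (map (Y z) [0..<m]) $ i) \<in> borel_measurable M" if "i < d"
    using alg that by (intro compose[of "\<lambda>\<omega> h. right_vec T \<omega> h $ i"]) blast
qed

lemma measurable_accepts:
  assumes W: "W \<in> measurable M (coins T)" and Y: "Y \<in> measurable M (\<Pi>\<^sub>M i\<in>{..<m}. (borel :: real measure))"
  shows "Measurable.pred M (\<lambda>z. accepts T m (W z) (Y z))"
proof -
  \<comment> \<open>A decision after \<open>n\<close> answers is measurable over \<open>n\<close>
    coordinates only, so the longer transcript is cut down to its prefix.\<close>
  have Yn: "(\<lambda>z. restrict (Y z) {..<n}) \<in> measurable M (\<Pi>\<^sub>M i\<in>{..<n}. borel)" if "n \<le> m" for n
    by (rule measurable_compose[OF Y measurable_restrict_subset]) (use that in auto)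
  have eq: "map (restrict (Y z) {..<n}) [0..<n] = map (Y z) [0..<n]" for z n by auto
  have [measurable]: "Measurable.pred M (\<lambda>z. halts T (W z) (map (Y z) [0..<n]))"
    "Measurable.pred M (\<lambda>z. verdict T (W z) (map (Y z) [0..<n]))" if "n \<le> m" for n
    using measurable_on_history(1,2)[OF W Yn[OF that]] by (simp_all only: eq)
  show ?thesis unfolding accepts_def
    by (intro pred_intros_finite pred_intros_logic) auto
qed

lemma query_instance_mat_eq:
  assumes "\<omega> \<in> space (coins T)"
  shows "query T (instance_mat d t x) \<omega> h
    = t * (\<Sum>i<d. left_vec T \<omega> h $ i * right_vec T \<omega> h $ i)
      + dot (pairs d) (\<lambda>(i, j). left_vec T \<omega> h $ i * right_vec T \<omega> h $ j + left_vec T \<omega> h $ j * right_vec T \<omega> h $ i) x"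
  unfolding query_def by (rule query_instance_mat[OF left_vec_carrier[OF assms] right_vec_carrier[OF assms]])

lemma measurable_query:
  assumes W: "W \<in> measurable M (coins T)" and Y: "Y \<in> measurable M (\<Pi>\<^sub>M i\<in>{..<m}. (borel :: real measure))"
    and X: "X \<in> measurable M (pts (pairs d))"
  shows "(\<lambda>z. query T (instance_mat d t (X z)) (W z) (map (Y z) [0..<m])) \<in> borel_measurable M"
proof -
  let ?l = "\<lambda>z. left_vec T (W z) (map (Y z) [0..<m])" and ?r = "\<lambda>z. right_vec T (W z) (map (Y z) [0..<m])"
  note l [measurable] = measurable_on_history(3)[OF W Y] and r [measurable] = measurable_on_history(4)[OF W Y]
  have "(\<lambda>z. t * (\<Sum>i<d. ?l z $ i * ?r z $ i)
      + (\<Sum>c\<in>pairs d. (?l z $ fst c * ?r z $ snd c + ?l z $ snd c * ?r z $ fst c) * X z c)) \<in> borel_measurable M"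
  proof (intro borel_measurable_add borel_measurable_times borel_measurable_sum borel_measurable_const)
    fix c assume c: "c \<in> pairs d"
    show "(\<lambda>z. X z c) \<in> borel_measurable M" by (rule measurable_compose[OF X measurable_component_singleton[OF c]])
  qed (auto simp: pairs_def intro: l r)
  then show ?thesis
    by (rule measurable_cong[THEN iffD1, rotated])
      (simp add: query_instance_mat_eq[OF measurable_space[OF W]] dot_def split_beta)
qed

lemma measurable_run:
  assumes W: "W \<in> measurable M (coins T)" and Y: "Y \<in> measurable M (\<Pi>\<^sub>M i\<in>{..<m}. (borel :: real measure))"
    and X: "X \<in> measurable M (pts (pairs d))"
  shows "Measurable.pred M (\<lambda>z. run T (instance_mat d t (X z)) (W z) n m (Y z))"
  using Y
proof (induction n arbitrary: m Y)
  case 0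
  then show ?case using measurable_accepts[OF W] by simp
next
  case (Suc n)
  have "(\<lambda>z. (Y z)(m := query T (instance_mat d t (X z)) (W z) (map (Y z) [0..<m])))
      \<in> measurable M (\<Pi>\<^sub>M i\<in>insert m {..<m}. borel)"
    by (rule measurable_fun_upd[OF _ Suc.prems measurable_query[OF W Suc.prems X]]) auto
  then have "(\<lambda>z. (Y z)(m := query T (instance_mat d t (X z)) (W z) (map (Y z) [0..<m])))
      \<in> measurable M (\<Pi>\<^sub>M i\<in>{..<Suc m}. borel)"
    by (simp only: lessThan_Suc)
  from Suc.IH[OF this] show ?case by (simp only: run.simps)
qed

text \<open>With the coins fixed, the next query is determined by the stored answers. Its known
  shift \<open>c\<close> is moved into the continuation, because the queries of
  \<open>adaptive\<close> are homogeneous.\<close>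

lemma adaptive_run:
  assumes \<omega>: "\<omega> \<in> space (coins T)" and "y \<in> space (\<Pi>\<^sub>M i\<in>{..<m}. (borel :: real measure))" and r: "0 \<le> r"
  shows "adaptive (pairs d) r n (\<lambda>x a. if run T (instance_mat d t x) \<omega> n m y then r else 0)"
  using assms(2)
proof (induction n arbitrary: m y)
  case 0
  show ?case using r by (auto intro!: exI[of _ "\<lambda>_. if accepts T m \<omega> y then r else 0"])
next
  case (Suc n)
  let ?h = "map y [0..<m]"
  define c where "c = t * (\<Sum>i<d. left_vec T \<omega> ?h $ i * right_vec T \<omega> ?h $ i)"
  define q where "q = (\<lambda>(i, j). left_vec T \<omega> ?h $ i * right_vec T \<omega> ?h $ j + left_vec T \<omega> ?h $ j * right_vec T \<omega> ?h $ i)"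
  have query: "query T (instance_mat d t x) \<omega> ?h = c + dot (pairs d) q x" for x
    unfolding c_def q_def by (rule query_instance_mat_eq[OF \<omega>])
  let ?\<Psi> = "\<lambda>v x (a :: nat \<times> nat). if run T (instance_mat d t x) \<omega> n (Suc m) (y(m := c + v)) then r else 0"
  have upd: "(\<lambda>z. y(m := c + fst z)) \<in> measurable (borel \<Otimes>\<^sub>M pts (pairs d)) (\<Pi>\<^sub>M i\<in>{..<Suc m}. borel)"
    unfolding lessThan_Suc using Suc.prems
    by (intro measurable_fun_upd[of _ "{..<m}"]) auto
  have "Measurable.pred (borel \<Otimes>\<^sub>M pts (pairs d))
      (\<lambda>z. run T (instance_mat d t (snd z)) \<omega> n (Suc m) (y(m := c + fst z)))"
    using \<omega> by (intro measurable_run upd) auto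
  then have "(\<lambda>(v, x). ?\<Psi> v x a) \<in> borel_measurable (borel \<Otimes>\<^sub>M pts (pairs d))" for a
    by (simp add: split_beta)
  moreover have "adaptive (pairs d) r n (?\<Psi> v)" for v
  proof (rule Suc.IH)
    show "y(m := c + v) \<in> space (\<Pi>\<^sub>M i\<in>{..<Suc m}. borel)"
      using Suc.prems by (auto simp: space_PiM PiE_def extensional_def)
  qed
  moreover have "(\<lambda>a. if run T (instance_mat d t x) \<omega> (Suc n) m y then r else 0) = ?\<Psi> (dot (pairs d) q x) x" for x
    by (simp add: query)
  ultimately show ?case by (auto intro!: exI[of _ q] exI[of _ ?\<Psi>])
qed

end

section \<open>Averaging over coins and inputs\<close>

lemma halts_within_worst_case_queries:
  assumes "worst_case_queries d T = enat k" "A \<in> sym_mats d" "\<omega> \<in> space (coins T)"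
  shows "\<exists>n\<le>k. halts T \<omega> (answers T A \<omega> n)"
proof (rule ccontr)
  assume "\<not> ?thesis"
  then have "enat (Suc k) \<le> query_count T A \<omega>"
    unfolding query_count_def by (intro INF_greatest) (auto simp: not_le Suc_le_eq)
  also have "\<dots> \<le> worst_case_queries d T"
    unfolding worst_case_queries_def using assms(2,3) by (meson SUP_upper order_trans)
  finally show False using assms(1) by simp
qed

text \<open>An infinite query count satisfies any lower bound, so a uniform bound \<open>k\<close>
  on the halting time may be assumed.\<close>

lemma tester_lower_boundI:
  assumes "\<And>T k. psd_tester d \<epsilon> p T
    \<Longrightarrow> (\<And>A \<omega>. A \<in> sym_mats d \<Longrightarrow> \<omega> \<in> space (coins T) \<Longrightarrow> \<exists>n\<le>k. halts T \<omega> (answers T A \<omega> n))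
    \<Longrightarrow> b \<le> real k"
  shows "tester_lower_bound d \<epsilon> p b"
  unfolding tester_lower_bound_def
proof (intro allI impI)
  fix T assume T: "psd_tester d \<epsilon> p T"
  show "ereal b \<le> ereal_of_enat (worst_case_queries d T)"
  proof (cases "worst_case_queries d T")
    case (enat k)
    then have "b \<le> real k" using halts_within_worst_case_queries by (intro assms[OF T]) blast
    then show ?thesis using enat by simp
  qed simp
qed

context
  fixes d k :: nat and T :: vmv_algorithm
  assumes T: "is_vmv_algorithm d T"
    and halt: "\<And>A \<omega>. A \<in> sym_mats d \<Longrightarrow> \<omega> \<in> space (coins T) \<Longrightarrow> \<exists>n\<le>k. halts T \<omega> (answers T A \<omega> n)"
begin

text \<open>The function that is \<open>undefined\<close> everywhere is the only point of the
  product over no coordinates: the empty history.\<close>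

private abbreviation "decides t x \<omega> \<equiv> run T (instance_mat d t x) \<omega> k 0 (\<lambda>_. undefined)"

private lemma decides_iff_outputs:
  assumes "\<omega> \<in> space (coins T)"
  shows "decides t x \<omega> \<longleftrightarrow> outputs T (instance_mat d t x) \<omega> True"
  using halt[OF instance_mat_sym_mats assms] run_iff_outputs by blast

private lemma measurable_decides:
  assumes "W \<in> measurable M (coins T)" "X \<in> measurable M (pts (pairs d))"
  shows "Measurable.pred M (\<lambda>z. decides t (X z) (W z))"
  using assms by (intro measurable_run[OF T]) (auto simp: space_PiM)

text \<open>The two outputs exclude each other. The event of output False is only compared with the
  complement of the event of output True, which is measurable because it is described by
  \<open>run\<close>.\<close>

lemma output_prob_False_disjoint:
  assumes "x \<in> space (pts (pairs d))" "2 / 3 \<le> output_prob T (instance_mat d t x) False"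
  shows "output_prob T (instance_mat d t x) True \<le> 1 / 3"
proof -
  interpret C: prob_space "coins T" using T by (simp add: is_vmv_algorithm_def)
  let ?A = "instance_mat d t x"
  have "Measurable.pred (coins T) (decides t x)"
    using measurable_decides[of "\<lambda>\<omega>. \<omega>" "coins T" "\<lambda>_. x" t] assms(1) by simp
  moreover have "{\<omega> \<in> space (coins T). outputs T ?A \<omega> True} = {\<omega> \<in> space (coins T). decides t x \<omega>}"
    using decides_iff_outputs by auto
  ultimately have meas: "{\<omega> \<in> space (coins T). outputs T ?A \<omega> True} \<in> sets (coins T)"
    by (simp add: pred_def)
  have "\<not> (outputs T ?A \<omega> True \<and> outputs T ?A \<omega> False)" if "\<omega> \<in> space (coins T)" for \<omega>
    using halt[OF instance_mat_sym_mats[of d t x] that] outputs_iff_verdict by metis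
  then have "measure (coins T) {\<omega> \<in> space (coins T). outputs T ?A \<omega> False}
      \<le> measure (coins T) (space (coins T) - {\<omega> \<in> space (coins T). outputs T ?A \<omega> True})"
    using meas by (intro C.finite_measure_mono) auto
  also have "\<dots> = 1 - measure (coins T) {\<omega> \<in> space (coins T). outputs T ?A \<omega> True}"
    by (rule C.prob_compl[OF meas])
  finally show ?thesis using assms(2) by (simp add: output_prob_def)
qed

text \<open>The entropy bound holds for fixed coins and a random matrix, the guarantee of a tester
  for a fixed matrix and random coins. Fubini's theorem passes from one to the other.\<close>

private lemma expected_decision:
  assumes X: "X \<in> measurable (pts (pairs d)) (pts (pairs d))"
  shows "(\<integral>\<omega>. (\<integral>x. of_bool (decides t (X x) \<omega>) \<partial>gauss (pairs d)) \<partial>coins T)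
      = (\<integral>x. output_prob T (instance_mat d t (X x)) True \<partial>gauss (pairs d))" (is ?eq)
    and "integrable (coins T) (\<lambda>\<omega>. \<integral>x. of_bool (decides t (X x) \<omega>) \<partial>gauss (pairs d) :: real)" (is ?i1)
    and "integrable (gauss (pairs d)) (\<lambda>x. output_prob T (instance_mat d t (X x)) True)" (is ?i2)
proof -
  interpret C: prob_space "coins T" using T by (simp add: is_vmv_algorithm_def)
  interpret G: prob_space "gauss (pairs d)" by (rule prob_space_gauss)
  interpret P: pair_prob_space "coins T" "gauss (pairs d)" ..
  let ?h = "\<lambda>\<omega> x. of_bool (decides t (X x) \<omega>) :: real"
  have snd: "snd \<in> measurable (coins T \<Otimes>\<^sub>M gauss (pairs d)) (pts (pairs d))"
    by (simp add: measurable_cong_sets[OF refl sets_gauss, symmetric])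
  have "Measurable.pred (coins T \<Otimes>\<^sub>M gauss (pairs d)) (\<lambda>z. decides t (X (snd z)) (fst z))"
    by (intro measurable_decides measurable_compose[OF snd X]) simp
  then have "(\<lambda>(\<omega>, x). ?h \<omega> x) \<in> borel_measurable (coins T \<Otimes>\<^sub>M gauss (pairs d))"
    unfolding split_beta of_bool_def by measurable
  then have int: "integrable (coins T \<Otimes>\<^sub>M gauss (pairs d)) (\<lambda>(\<omega>, x). ?h \<omega> x)"
    by (intro P.integrable_const_bound[of _ 1]) auto
  have inner: "(\<integral>\<omega>. ?h \<omega> x \<partial>coins T) = output_prob T (instance_mat d t (X x)) True"
    if x: "x \<in> space (gauss (pairs d))" for x
  proof -
    have Xx: "X x \<in> space (pts (pairs d))" using measurable_space[OF X] x by (simp add: space_gauss)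
    have "Measurable.pred (coins T) (decides t (X x))"
      using measurable_decides[of "\<lambda>\<omega>. \<omega>" "coins T" "\<lambda>_. X x" t] Xx by simp
    then have "{\<omega> \<in> space (coins T). decides t (X x) \<omega>} \<in> sets (coins T)" by (simp add: pred_def)
    then have "measure (coins T) {\<omega> \<in> space (coins T). decides t (X x) \<omega>}
        = (\<integral>\<omega>. indicator {\<omega> \<in> space (coins T). decides t (X x) \<omega>} \<omega> \<partial>coins T)" by simp
    also have "\<dots> = (\<integral>\<omega>. ?h \<omega> x \<partial>coins T)"
      by (intro Bochner_Integration.integral_cong) (auto simp: indicator_def)
    also have "{\<omega> \<in> space (coins T). decides t (X x) \<omega>}
        = {\<omega> \<in> space (coins T). outputs T (instance_mat d t (X x)) \<omega> True}"
      using decides_iff_outputs by auto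
    finally show ?thesis by (simp add: output_prob_def)
  qed
  have "(\<integral>\<omega>. (\<integral>x. ?h \<omega> x \<partial>gauss (pairs d)) \<partial>coins T) = (\<integral>x. (\<integral>\<omega>. ?h \<omega> x \<partial>coins T) \<partial>gauss (pairs d))"
    by (rule P.Fubini_integral[OF int, symmetric])
  also have "\<dots> = (\<integral>x. output_prob T (instance_mat d t (X x)) True \<partial>gauss (pairs d))"
    by (intro Bochner_Integration.integral_cong refl inner)
  finally show ?eq .
  show ?i1 using P.integrable_fst'[OF int] by simp
  have "integrable (gauss (pairs d)) (\<lambda>x. \<integral>\<omega>. ?h \<omega> x \<partial>coins T)"
    by (rule P.integrable_snd[OF int])
  then show ?i2 by (rule Bochner_Integration.integrable_cong[THEN iffD1, rotated -1]) (auto simp: inner)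
qed

text \<open>\<open>adaptive_entropy_bound\<close> with the score \<open>r\<close> on acceptance and
  0 otherwise. The exponential moment is 1 plus \<open>exp r - 1\<close> times the acceptance
  probability; \<open>ln (1 + z) \<le> z\<close> makes this linear, so that it can be averaged over
  the coins.\<close>

lemma decision_entropy_bound:
  assumes \<omega>: "\<omega> \<in> space (coins T)" and r: "0 \<le> r"
  shows "real (card (pairs d)) * (r * (\<integral>x. of_bool (decides t x \<omega>) \<partial>gauss (pairs d)))
    \<le> (\<Sum>a\<in>pairs d. (exp r - 1) * (\<integral>x. of_bool (decides t (translate (pairs d) (spike a s) x) \<omega>) \<partial>gauss (pairs d)))
      + real k * s\<^sup>2 / 2"
proof -
  interpret G: prob_space "gauss (pairs d)" by (rule prob_space_gauss)
  let ?\<Phi> = "\<lambda>x (a :: nat \<times> nat). if decides t x \<omega> then r else 0"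
  have ad: "adaptive (pairs d) r k ?\<Phi>"
    by (rule adaptive_run[OF T \<omega> _ r]) (auto simp: space_PiM)
  have int: "integrable (gauss (pairs d)) (\<lambda>x. of_bool (decides t (X x) \<omega>) :: real)"
    if X: "X \<in> measurable (pts (pairs d)) (pts (pairs d))" for X
  proof -
    have X': "X \<in> measurable (gauss (pairs d)) (pts (pairs d))"
      using X by (simp add: measurable_cong_sets[OF sets_gauss refl])
    have "Measurable.pred (gauss (pairs d)) (\<lambda>x. decides t (X x) \<omega>)"
      using \<omega> by (intro measurable_decides X') auto
    then have "(\<lambda>x. of_bool (decides t (X x) \<omega>) :: real) \<in> borel_measurable (gauss (pairs d))"
      unfolding of_bool_def by measurable
    then show ?thesis by (intro G.integrable_const_bound[of _ 1]) auto
  qed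
  have lhs: "(\<integral>x. ?\<Phi> x a \<partial>gauss (pairs d)) = r * (\<integral>x. of_bool (decides t x \<omega>) \<partial>gauss (pairs d))"
    for a :: "nat \<times> nat"
  proof -
    have "?\<Phi> x a = r * of_bool (decides t x \<omega>)" for x by simp
    then show ?thesis by (simp only: integral_mult_right_zero)
  qed
  have rhs: "ln (\<integral>x. exp (?\<Phi> (translate (pairs d) (spike a s) x) a) \<partial>gauss (pairs d))
      \<le> (exp r - 1) * (\<integral>x. of_bool (decides t (translate (pairs d) (spike a s) x) \<omega>) \<partial>gauss (pairs d))" for a
  proof -
    let ?b = "\<lambda>x. of_bool (decides t (translate (pairs d) (spike a s) x) \<omega>) :: real"
    have "(\<integral>x. exp (?\<Phi> (translate (pairs d) (spike a s) x) a) \<partial>gauss (pairs d))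
        = (\<integral>x. 1 + (exp r - 1) * ?b x \<partial>gauss (pairs d))"
      by (intro Bochner_Integration.integral_cong) auto
    also have "\<dots> = 1 + (exp r - 1) * (\<integral>x. ?b x \<partial>gauss (pairs d))"
      using int[OF measurable_translate] G.prob_space by (subst Bochner_Integration.integral_add) auto
    finally have eq: "(\<integral>x. exp (?\<Phi> (translate (pairs d) (spike a s) x) a) \<partial>gauss (pairs d))
        = 1 + (exp r - 1) * (\<integral>x. ?b x \<partial>gauss (pairs d))" .
    have "0 \<le> (exp r - 1) * (\<integral>x. ?b x \<partial>gauss (pairs d))" using r by (intro mult_nonneg_nonneg) auto
    then show ?thesis unfolding eq by (rule ln_add_one_self_le_self)
  qed
  have "real (card (pairs d)) * (r * (\<integral>x. of_bool (decides t x \<omega>) \<partial>gauss (pairs d)))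
      = (\<Sum>a\<in>pairs d. \<integral>x. ?\<Phi> x a \<partial>gauss (pairs d))" unfolding lhs by simp
  also have "\<dots> \<le> (\<Sum>a\<in>pairs d. ln (\<integral>x. exp (?\<Phi> (translate (pairs d) (spike a s) x) a) \<partial>gauss (pairs d))) + real k * s\<^sup>2 / 2"
    by (rule adaptive_entropy_bound[OF finite_pairs ad])
  also have "\<dots> \<le> (\<Sum>a\<in>pairs d. (exp r - 1) * (\<integral>x. of_bool (decides t (translate (pairs d) (spike a s) x) \<omega>) \<partial>gauss (pairs d)))
      + real k * s\<^sup>2 / 2"
    by (intro add_right_mono sum_mono rhs)
  finally show ?thesis .
qed

text \<open>The good event has mass at least \<open>19 / 20\<close>, so on average the plain
  instance is accepted with probability at least \<open>19 / 30\<close> and each spiked one with at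
  most \<open>11 / 30\<close>. With \<open>r = 1 / 10\<close> and
  \<open>exp r - 1 \<le> 11 / 100\<close> the gap per position is
  \<open>19 / 300 - 121 / 3000 = 23 / 1000\<close>, and \<open>k * s^2 / 2\<close> must cover it for
  all positions.\<close>

lemma query_count_lower_bound:
  assumes d: "0 < d"
    and yes: "\<And>x. x \<in> good d \<Longrightarrow> 2 / 3 \<le> output_prob T (instance_mat d t x) True"
    and no: "\<And>x a. x \<in> good d \<Longrightarrow> a \<in> pairs d
      \<Longrightarrow> 2 / 3 \<le> output_prob T (instance_mat d t (translate (pairs d) (spike a s) x)) False"
  shows "real (card (pairs d)) \<le> 25 * real k * s\<^sup>2"
proof -
  interpret C: prob_space "coins T" using T by (simp add: is_vmv_algorithm_def)
  interpret G: prob_space "gauss (pairs d)" by (rule prob_space_gauss)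
  let ?I = "pairs d" and ?N = "real (card (pairs d))" and ?r = "1 / 10 :: real"
  let ?P = "\<lambda>X \<omega>. \<integral>x. of_bool (decides t (X x) \<omega>) \<partial>gauss (pairs d) :: real"
  let ?E = "\<lambda>X. \<integral>\<omega>. ?P X \<omega> \<partial>coins T"
  let ?tr = "\<lambda>a. translate ?I (spike a s)"
  have good [measurable]: "good d \<in> sets (gauss ?I)" by (simp add: sets_gauss)
  have int_good: "integrable (gauss ?I) (\<lambda>x. 2 / 3 * indicator (good d) x :: real)"
    by (intro integrable_mult_right) (simp add: integrable_indicator_iff less_top[symmetric])
  have good_mass: "19 / 30 \<le> (\<integral>x. 2 / 3 * indicator (good d) x \<partial>gauss ?I :: real)"
    using measure_good[OF d] by simp
  have E0: "19 / 30 \<le> ?E (\<lambda>x. x)"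
  proof -
    note good_mass
    also have "(\<integral>x. 2 / 3 * indicator (good d) x \<partial>gauss ?I)
        \<le> (\<integral>x. output_prob T (instance_mat d t x) True \<partial>gauss ?I)"
    proof (intro integral_mono int_good expected_decision(3)[of "\<lambda>x. x"])
      show "2 / 3 * indicator (good d) x \<le> output_prob T (instance_mat d t x) True" for x
        \<comment> \<open>Off the good event only nonnegativity of the probability is used.\<close>
        using yes[of x] by (cases "x \<in> good d") (simp_all, simp add: output_prob_def)
    qed simp
    also have "\<dots> = ?E (\<lambda>x. x)" by (rule expected_decision(1)[symmetric]) simp
    finally show ?thesis .
  qed
  have Ea: "?E (?tr a) \<le> 11 / 30" if a: "a \<in> ?I" for a
  proof -
    have le: "output_prob T (instance_mat d t (?tr a x)) True \<le> 1 - 2 / 3 * indicator (good d) x" for x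
    proof (cases "x \<in> good d")
      case True
      from output_prob_False_disjoint[OF translate_space no[OF True a]] show ?thesis using True by simp
    qed (simp add: output_prob_def)
    have "?E (?tr a) = (\<integral>x. output_prob T (instance_mat d t (?tr a x)) True \<partial>gauss ?I)"
      by (rule expected_decision(1)) measurable
    also have "\<dots> \<le> (\<integral>x. 1 - 2 / 3 * indicator (good d) x \<partial>gauss ?I)"
      by (intro integral_mono expected_decision(3) measurable_translate Bochner_Integration.integrable_diff int_good le) simp
    also have "\<dots> = 1 - (\<integral>x. 2 / 3 * indicator (good d) x \<partial>gauss ?I)"
      using int_good G.prob_space by (subst Bochner_Integration.integral_diff) simp_all
    finally show ?thesis using good_mass by simp
  qed
  have int0: "integrable (coins T) (?P (\<lambda>x. x))" by (rule expected_decision(2)) simp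
  have int1: "integrable (coins T) (?P (?tr a))" for a by (rule expected_decision(2)) measurable
  have "?N * (?r * ?E (\<lambda>x. x)) = (\<integral>\<omega>. ?N * (?r * ?P (\<lambda>x. x) \<omega>) \<partial>coins T)" by simp
  also have "\<dots> \<le> (\<integral>\<omega>. (\<Sum>a\<in>?I. (exp ?r - 1) * ?P (?tr a) \<omega>) + real k * s\<^sup>2 / 2 \<partial>coins T)"
  proof (rule integral_mono)
    show "integrable (coins T) (\<lambda>\<omega>. ?N * (?r * ?P (\<lambda>x. x) \<omega>))" using int0 by simp
    show "integrable (coins T) (\<lambda>\<omega>. (\<Sum>a\<in>?I. (exp ?r - 1) * ?P (?tr a) \<omega>) + real k * s\<^sup>2 / 2)"
      using int1 by simp
  qed (rule decision_entropy_bound, auto)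
  also have "\<dots> = (\<Sum>a\<in>?I. (exp ?r - 1) * ?E (?tr a)) + real k * s\<^sup>2 / 2"
    using int1 C.prob_space by (simp add: Bochner_Integration.integral_sum)
  also have "(\<Sum>a\<in>?I. (exp ?r - 1) * ?E (?tr a)) \<le> (\<Sum>a\<in>?I. 11 / 100 * (11 / 30))"
  proof (intro sum_mono mult_mono Ea)
    show "exp ?r - 1 \<le> 11 / 100" using exp_bound[of ?r] by (simp add: power2_eq_square)
  qed auto
  finally have "?N * (?r * ?E (\<lambda>x. x)) \<le> ?N * (121 / 3000) + real k * s\<^sup>2 / 2" by simp
  moreover have "?N * (?r * (19 / 30)) \<le> ?N * (?r * ?E (\<lambda>x. x))"
    using E0 by (intro mult_left_mono) auto
  ultimately show ?thesis by simp
qed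

end

section \<open>Choice of the spike and the three regimes\<close>

text \<open>On the good event \<open>t\<close> bounds the Gaussian part on both sides, so before the
  spike is added the form lies between 0 and \<open>2 * t\<close> times the squared norm.\<close>

lemma hard_instances:
  fixes s :: real and d :: nat
  defines "t \<equiv> 38 * sqrt (real d)"
  assumes x: "x \<in> good d" and ab: "(a, b) \<in> pairs d" and s: "2 * t < s"
  defines "A \<equiv> instance_mat d t (translate (pairs d) (spike (a, b) s) x)"
  shows "lambda_min A \<le> - (s - 2 * t)"
    and "A \<noteq> 0\<^sub>m d d"
    and "schatten_norm \<infinity> A \<le> 2 * t + s"
    and "1 \<le> p \<Longrightarrow> schatten_norm (ereal p) A \<le> 4 * t * real d powr (1 / p) + 4 * s"
proof -
  have d: "0 < d" "a < d" "b < d" "a \<noteq> b" using ab by (auto simp: pairs_def)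
  have t: "0 \<le> t" by (simp add: t_def)
  have s0: "0 \<le> s" using s t by simp
  have A: "A \<in> carrier_mat d d" "transpose_mat A = A"
    by (simp_all add: A_def instance_mat_symmetric)
  have q: "quad_form d A y - 2 * s * y a * y b = t * sqnorm d y + pair_form d x y" for y
    unfolding A_def quad_form_instance_mat pair_form_translate_spike[OF ab] by simp
  have bd: "\<bar>pair_form d x y\<bar> \<le> t * sqnorm d y" for y
    unfolding t_def by (rule good_pair_form[OF x d(1)])
  have nn: "0 \<le> quad_form d A y - 2 * s * y a * y b"
    and le: "quad_form d A y - 2 * s * y a * y b \<le> 2 * t * sqnorm d y" for y
    unfolding q using bd[of y] by (simp_all add: abs_le_iff)
  show "lambda_min A \<le> - (s - 2 * t)" by (rule spiked_lambda_min[OF A d(2-4) le])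
  show "schatten_norm \<infinity> A \<le> 2 * t + s" by (rule spiked_schatten_norm_infinity[OF A d(2-4) s0 nn le])
  show "schatten_norm (ereal p) A \<le> 4 * t * real d powr (1 / p) + 4 * s" if "1 \<le> p"
    by (rule spiked_schatten_norm_finite[OF A d(2-4) s0 nn le t that])
  show "A \<noteq> 0\<^sub>m d d"
  proof
    assume "A = 0\<^sub>m d d"
    \<comment> \<open>At this vector the spike contributes \<open>- 2 * s\<close>. If
      \<open>A\<close> vanished, the form without spike would be \<open>2 * s\<close>, above its
      bound \<open>4 * t\<close>.\<close>
    define y where "y = (\<lambda>k. if k = a then 1 else if k = b then - 1 else (0::real))"
    have "sqnorm d y = (\<Sum>k\<in>{a,b}. (y k)\<^sup>2)"
      using d by (intro sum.mono_neutral_right) (auto simp: y_def)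
    then have "sqnorm d y = 2" using d by (simp add: y_def)
    moreover have "quad_form d A y = 0" by (simp add: quad_form_def \<open>A = 0\<^sub>m d d\<close>)
    ultimately show False using le[of y] d s by (simp add: y_def)
  qed
qed

text \<open>The assumption \<open>norm\<close> is the threshold at which the tester must reject,
  since the smallest eigenvalue is at most \<open>76 * sqrt d - s\<close>. The constant 100 is 25
  times the 4 of \<open>card_pairs_ge\<close>.\<close>

lemma tester_query_bound:
  assumes tester: "psd_tester d \<epsilon> p T"
    and halt: "\<And>A \<omega>. A \<in> sym_mats d \<Longrightarrow> \<omega> \<in> space (coins T) \<Longrightarrow> \<exists>n\<le>k. halts T \<omega> (answers T A \<omega> n)"
    and d: "2 \<le> d" and s: "76 * sqrt (real d) < s" and \<epsilon>: "0 < \<epsilon>"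
    and norm: "\<And>x a. x \<in> good d \<Longrightarrow> a \<in> pairs d
      \<Longrightarrow> \<epsilon> * schatten_norm p (instance_mat d (38 * sqrt (real d)) (translate (pairs d) (spike a s) x)) \<le> s - 76 * sqrt (real d)"
  shows "(real d)\<^sup>2 \<le> 100 * real k * s\<^sup>2"
proof -
  let ?t = "38 * sqrt (real d)"
  have T: "is_vmv_algorithm d T" using tester by (simp add: psd_tester_def)
  have yes: "2 / 3 \<le> output_prob T (instance_mat d ?t x) True" if "x \<in> good d" for x
  proof -
    have "psd_mat (instance_mat d ?t x)"
      by (rule psd_instance_mat) (use good_pair_form[OF that] d in simp)
    then show ?thesis using tester by (simp add: psd_tester_def)
  qed
  have no: "2 / 3 \<le> output_prob T (instance_mat d ?t (translate (pairs d) (spike a s) x)) False"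
    if x: "x \<in> good d" and a: "a \<in> pairs d" for x a
  proof -
    let ?A = "instance_mat d ?t (translate (pairs d) (spike a s) x)"
    have "lambda_min ?A \<le> - (s - 2 * ?t)" "?A \<noteq> 0\<^sub>m d d"
      using hard_instances(1,2)[of x d "fst a" "snd a" s] x a s by simp_all
    then have "lambda_min ?A \<le> - \<epsilon> * schatten_norm p ?A" using norm[OF x a] by simp
    then show ?thesis using tester \<open>?A \<noteq> 0\<^sub>m d d\<close> by (simp add: psd_tester_def)
  qed
  have "real (card (pairs d)) \<le> 25 * real k * s\<^sup>2"
    using d by (intro query_count_lower_bound[OF T halt _ yes no]) auto
  with card_pairs_ge[OF d] show ?thesis by simp
qed

lemma tester_query_bound_finite:
  fixes p :: real
  assumes tester: "psd_tester d \<epsilon> (ereal p) T"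
    and halt: "\<And>A \<omega>. A \<in> sym_mats d \<Longrightarrow> \<omega> \<in> space (coins T) \<Longrightarrow> \<exists>n\<le>k. halts T \<omega> (answers T A \<omega> n)"
    and p: "1 \<le> p" and \<epsilon>: "0 < \<epsilon>" "\<epsilon> \<le> 1 / 16" and d: "\<epsilon> powr (- p) \<le> real d"
  shows "real d \<le> 10 ^ 7 * real k * (\<epsilon> * real d powr (1 / p))\<^sup>2"
proof -
  let ?D = "\<epsilon> * real d powr (1 / p)" and ?t = "38 * sqrt (real d)"
  \<comment> \<open>The norm condition becomes
    \<open>4 * ?t * ?D + 4 * \<epsilon> * s \<le> s / 2 + s / 4\<close>. What remains,
    \<open>s / 4 = 2 * ?t * ?D\<close>, covers \<open>2 * ?t\<close> because the assumption on
    \<open>d\<close> gives \<open>?D \<ge> 1\<close>.\<close>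
  define s where "s = 8 * ?t * ?D"
  have "16 \<le> \<epsilon> powr (- 1)" using \<epsilon> by (simp add: powr_minus field_simps)
  also have "\<dots> \<le> \<epsilon> powr (- p)" using \<epsilon> p by (intro powr_mono') auto
  finally have d16: "16 \<le> real d" using d by simp
  have "1 / \<epsilon> = \<epsilon> powr (- 1)" using \<epsilon> by (simp add: powr_minus_divide)
  also have "\<dots> = (\<epsilon> powr (- p)) powr (1 / p)" using p by (simp add: powr_powr)
  also have "\<dots> \<le> real d powr (1 / p)" using d p by (intro powr_mono2) auto
  finally have D: "1 \<le> ?D" using \<epsilon> by (simp add: field_simps)
  have t: "0 < ?t" using d16 by simp
  have tD: "?t \<le> ?t * ?D" using mult_left_mono[OF D, of ?t] t by simp
  have "(real d)\<^sup>2 \<le> 100 * real k * s\<^sup>2"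
  proof (rule tester_query_bound[OF tester halt])
    show "2 \<le> d" using d16 by simp
    show "76 * sqrt (real d) < s" using tD t unfolding s_def by linarith
    fix x a assume xa: "x \<in> good d" "a \<in> pairs d"
    have "\<epsilon> * schatten_norm p (instance_mat d ?t (translate (pairs d) (spike a s) x))
        \<le> \<epsilon> * (4 * ?t * real d powr (1 / p) + 4 * s)"
      using hard_instances(4)[of x d "fst a" "snd a" s p] xa p tD t \<epsilon>
      by (intro mult_left_mono) (auto simp: s_def)
    also have "\<dots> = 4 * (?t * ?D) + 4 * \<epsilon> * s" by (simp add: algebra_simps)
    also have "4 * \<epsilon> * s \<le> 1 / 4 * s" using \<epsilon> D t by (intro mult_right_mono) (auto simp: s_def)
    also have "4 * (?t * ?D) + 1 / 4 * s \<le> s - 76 * sqrt (real d)" using tD unfolding s_def by linarith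
    finally show "\<epsilon> * schatten_norm p (instance_mat d ?t (translate (pairs d) (spike a s) x)) \<le> s - 76 * sqrt (real d)"
      by simp
  qed (use \<epsilon> in auto)
  \<comment> \<open>\<open>92416 = (8 * 38)^2\<close>; after multiplication by 100 it is rounded up
    to \<open>10 ^ 7\<close>.\<close>
  also have "s\<^sup>2 = 92416 * real d * ?D\<^sup>2" by (simp add: s_def power_mult_distrib)
  finally have "real d * real d \<le> real d * (9241600 * real k * ?D\<^sup>2)"
    by (simp add: power2_eq_square mult_ac)
  then have "real d \<le> 9241600 * real k * ?D\<^sup>2" using d16 by (simp add: mult_le_cancel_left_pos)
  also have "\<dots> \<le> 10 ^ 7 * real k * ?D\<^sup>2" by (intro mult_right_mono) auto
  finally show ?thesis .
qed

lemma tester_query_bound_infinity: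
  assumes tester: "psd_tester d \<epsilon> \<infinity> T"
    and halt: "\<And>A \<omega>. A \<in> sym_mats d \<Longrightarrow> \<omega> \<in> space (coins T) \<Longrightarrow> \<exists>n\<le>k. halts T \<omega> (answers T A \<omega> n)"
    and \<epsilon>: "0 < \<epsilon>" "\<epsilon> \<le> 1 / 16" and d: "2 \<le> d"
  shows "real d \<le> 10 ^ 7 * real k"
proof -
  let ?t = "38 * sqrt (real d)"
  \<comment> \<open>The operator norm sees the spike without a factor growing in \<open>d\<close>:
    \<open>\<epsilon> * (2 * ?t + s) \<le> 10 / 16 * ?t\<close>, well below
    \<open>s - 2 * ?t = 6 * ?t\<close>.\<close>
  define s where "s = 8 * ?t"
  have t: "0 < ?t" using d by simp
  have "(real d)\<^sup>2 \<le> 100 * real k * s\<^sup>2"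
  proof (rule tester_query_bound[OF tester halt])
    show "76 * sqrt (real d) < s" using t unfolding s_def by linarith
    fix x a assume xa: "x \<in> good d" "a \<in> pairs d"
    have "\<epsilon> * schatten_norm \<infinity> (instance_mat d ?t (translate (pairs d) (spike a s) x)) \<le> \<epsilon> * (2 * ?t + s)"
      using hard_instances(3)[of x d "fst a" "snd a" s] xa t \<epsilon>
      by (intro mult_left_mono) (auto simp: s_def)
    also have "\<dots> \<le> 1 / 16 * (2 * ?t + s)" using \<epsilon> t by (intro mult_right_mono) (auto simp: s_def)
    also have "\<dots> \<le> s - 76 * sqrt (real d)" by (simp add: s_def)
    finally show "\<epsilon> * schatten_norm \<infinity> (instance_mat d ?t (translate (pairs d) (spike a s) x)) \<le> s - 76 * sqrt (real d)" .
  qed (use \<epsilon> d in auto)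
  also have "s\<^sup>2 = 92416 * real d" by (simp add: s_def power_mult_distrib)
  finally have "real d * real d \<le> real d * (9241600 * real k)"
    by (simp add: power2_eq_square mult_ac)
  then have "real d \<le> 9241600 * real k" using d by (simp add: mult_le_cancel_left_pos)
  then show ?thesis by simp
qed

text \<open>In dimension 1 there is no off-diagonal position for a spike. Instead the matrices with
  single entry 1 and - 1 need opposite verdicts, whereas without a query the verdict depends on the
  coins alone.\<close>

lemma tester_makes_query:
  assumes tester: "psd_tester 1 \<epsilon> \<infinity> T"
    and halt: "\<And>A \<omega>. A \<in> sym_mats 1 \<Longrightarrow> \<omega> \<in> space (coins T) \<Longrightarrow> \<exists>n\<le>k. halts T \<omega> (answers T A \<omega> n)"
    and \<epsilon>: "0 < \<epsilon>" "\<epsilon> \<le> 1"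
  shows "1 \<le> k"
proof (rule ccontr)
  assume "\<not> 1 \<le> k"
  then have k: "k = 0" by simp
  have T: "is_vmv_algorithm 1 T" using tester by (simp add: psd_tester_def)
  have no_pairs: "pairs (Suc 0) = {}" by (auto simp: pairs_def)
  let ?x = "\<lambda>_ :: nat \<times> nat. undefined :: real" and ?A = "instance_mat 1 (- 1) (\<lambda>_. undefined)"
  have x: "?x \<in> space (pts (pairs 1))" by (simp add: no_pairs space_PiM)
  have "psd_mat (instance_mat 1 1 ?x)"
    by (rule psd_instance_mat) (simp add: pair_form_def dot_def no_pairs)
  then have yes: "2 / 3 \<le> output_prob T (instance_mat 1 1 ?x) True"
    using tester by (simp add: psd_tester_def)
  have spec: "spectral_decomposition 1 ?A (1\<^sub>m 1) (\<lambda>_. - 1)"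
    by (auto simp: spectral_decomposition_def orthogonal_real_mat_def instance_mat_def)
  have "lambda_min ?A = - 1"
    unfolding lambda_min_def
      spectral_decomposition_eigenvalues[OF instance_mat_carrier instance_mat_symmetric spec] by (simp add: lessThan_Suc)
  moreover have "schatten_norm \<infinity> ?A = 1"
    unfolding spectral_decomposition_schatten_norm[OF instance_mat_carrier instance_mat_symmetric spec]
    by (simp add: lessThan_Suc)
  moreover have "?A \<noteq> 0\<^sub>m 1 1"
  proof
    assume "?A = 0\<^sub>m 1 1"
    then have "?A $$ (0, 0) = 0" by simp
    then show False by (simp add: instance_mat_def)
  qed
  ultimately have "2 / 3 \<le> output_prob T ?A False"
    using tester \<epsilon> by (simp add: psd_tester_def)
  then have "output_prob T ?A True \<le> 1 / 3"
    using output_prob_False_disjoint[OF T halt x] by blast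
  moreover have "outputs T A \<omega> True \<longleftrightarrow> verdict T \<omega> []" if "A \<in> sym_mats 1" "\<omega> \<in> space (coins T)" for A \<omega>
    using halt[OF that] outputs_iff_verdict[of T \<omega> A 0 True] k by simp
  then have "output_prob T ?A True = output_prob T (instance_mat 1 1 ?x) True"
    unfolding output_prob_def by (intro arg_cong2[of _ _ _ _ measure] refl) auto
  ultimately show False using yes by simp
qed

theorem corollary33:
  fixes p :: ereal
  assumes "1 \<le> p"
  shows "\<exists>c C \<epsilon>0 :: real. 0 < c \<and> 0 < C \<and> 0 < \<epsilon>0 \<and> \<epsilon>0 < 1 \<and>
    (\<forall>\<epsilon>. 0 < \<epsilon> \<and> \<epsilon> \<le> \<epsilon>0 \<longrightarrow>
      (p \<le> 2 \<longrightarrow>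
        (\<exists>d\<ge>1. tester_lower_bound d \<epsilon> p (c * \<epsilon> powr (- real_of_ereal p)))) \<and>
      (2 < p \<and> p < \<infinity> \<longrightarrow>
        (\<forall>d. C * \<epsilon> powr (- real_of_ereal p) \<le> real d \<longrightarrow>
          tester_lower_bound d \<epsilon> p (c * (1 / \<epsilon>\<^sup>2) * real d powr (1 - 2 / real_of_ereal p)))) \<and>
      (p = \<infinity> \<longrightarrow>
        (\<forall>d\<ge>1. tester_lower_bound d \<epsilon> \<infinity> (c * real d))))"
\<comment> \<open>The factor \<open>10 ^ 7\<close> of the query bounds is enlarged to
  \<open>10 ^ 8\<close> to absorb the \<open>2^2\<close> lost in the first case by rounding the
  dimension.\<close>
proof (rule exI[of _ "1 / 10 ^ 8"], rule exI[of _ 1], rule exI[of _ "1 / 16"], intro conjI allI impI)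
  fix \<epsilon> :: real
  assume "0 < \<epsilon> \<and> \<epsilon> \<le> 1 / 16"
  then have \<epsilon>: "0 < \<epsilon>" "\<epsilon> \<le> 1 / 16" by auto
  {
    assume "p \<le> 2"
    with assms obtain q where q: "p = ereal q" "1 \<le> q" by (cases p) auto
    \<comment> \<open>The least dimension that \<open>tester_query_bound_finite\<close> admits.
      Rounding up at most doubles \<open>\<epsilon> powr (- q)\<close>, which keeps
      \<open>\<epsilon> * real d powr (1 / q)\<close> at most 2.\<close>
    define d where "d = nat \<lceil>\<epsilon> powr (- q)\<rceil>"
    have e1: "1 \<le> \<epsilon> powr (- q)" using \<epsilon> q powr_mono'[of "- q" 0 \<epsilon>] by simp
    then have "real d = of_int \<lceil>\<epsilon> powr (- q)\<rceil>" by (simp add: d_def)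
    then have d: "\<epsilon> powr (- q) \<le> real d" "real d \<le> 2 * \<epsilon> powr (- q)"
      using e1 ceiling_correct[of "\<epsilon> powr (- q)"] by auto
    have "tester_lower_bound d \<epsilon> p (1 / 10 ^ 8 * \<epsilon> powr (- real_of_ereal p))"
    proof (rule tester_lower_boundI)
      fix T k assume T: "psd_tester d \<epsilon> p T"
        "\<And>A \<omega>. A \<in> sym_mats d \<Longrightarrow> \<omega> \<in> space (coins T) \<Longrightarrow> \<exists>n\<le>k. halts T \<omega> (answers T A \<omega> n)"
      have "real d powr (1 / q) \<le> (2 * \<epsilon> powr (- q)) powr (1 / q)"
        using d q by (intro powr_mono2) auto
      also have "\<dots> = 2 powr (1 / q) * \<epsilon> powr (- 1)"
        using q by (simp add: powr_mult powr_powr)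
      also have "\<dots> = 2 powr (1 / q) / \<epsilon>" using \<epsilon> by (simp add: powr_minus_divide)
      also have "\<dots> \<le> 2 powr 1 / \<epsilon>" using \<epsilon> q by (intro divide_right_mono powr_mono) auto
      finally have "\<epsilon> * real d powr (1 / q) \<le> 2" using \<epsilon> by (simp add: field_simps)
      then have D: "(\<epsilon> * real d powr (1 / q))\<^sup>2 \<le> 2\<^sup>2" using \<epsilon> by (intro power_mono) auto
      have "\<epsilon> powr (- q) \<le> 10 ^ 7 * real k * (\<epsilon> * real d powr (1 / q))\<^sup>2"
        using tester_query_bound_finite[OF T[unfolded q(1)] q(2) \<epsilon> d(1)] d(1) by simp
      also have "\<dots> \<le> 10 ^ 7 * real k * 2\<^sup>2" by (rule mult_left_mono[OF D]) simp
      finally show "1 / 10 ^ 8 * \<epsilon> powr (- real_of_ereal p) \<le> real k" by (simp add: q(1))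
    qed
    moreover have "1 \<le> d" using d(1) e1 by (cases d) auto
    ultimately show "\<exists>d\<ge>1. tester_lower_bound d \<epsilon> p (1 / 10 ^ 8 * \<epsilon> powr (- real_of_ereal p))" by blast
  }
  {
    fix d :: nat
    assume "2 < p \<and> p < \<infinity>" and d: "1 * \<epsilon> powr (- real_of_ereal p) \<le> real d"
    with assms obtain q where q: "p = ereal q" "1 \<le> q" by (cases p) auto
    show "tester_lower_bound d \<epsilon> p (1 / 10 ^ 8 * (1 / \<epsilon>\<^sup>2) * real d powr (1 - 2 / real_of_ereal p))"
    proof (rule tester_lower_boundI)
      fix T k assume T: "psd_tester d \<epsilon> p T"
        "\<And>A \<omega>. A \<in> sym_mats d \<Longrightarrow> \<omega> \<in> space (coins T) \<Longrightarrow> \<exists>n\<le>k. halts T \<omega> (answers T A \<omega> n)"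
      have d0: "0 < real d"
      proof -
        have "0 < \<epsilon> powr (- q)" using \<epsilon> by simp
        also have "\<dots> \<le> real d" using d by (simp add: q(1))
        finally show ?thesis .
      qed
      have pw: "(real d powr (1 / q))\<^sup>2 = real d powr (2 / q)"
        using d0 by (simp add: powr_powr power2_eq_square flip: powr_add)
      have "real d \<le> 10 ^ 7 * real k * (\<epsilon> * real d powr (1 / q))\<^sup>2"
        using tester_query_bound_finite[OF T[unfolded q(1)] q(2) \<epsilon>] d by (simp add: q(1))
      then have "real d \<le> 10 ^ 7 * real k * \<epsilon>\<^sup>2 * real d powr (2 / q)"
        by (simp add: power_mult_distrib pw mult_ac)
      then have "real d powr (1 - 2 / q) \<le> 10 ^ 7 * real k * \<epsilon>\<^sup>2"
        using d0 by (simp add: powr_diff field_simps)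
      then have "1 / \<epsilon>\<^sup>2 * real d powr (1 - 2 / q) \<le> 10 ^ 7 * real k"
        using \<epsilon> by (simp add: field_simps)
      then show "1 / 10 ^ 8 * (1 / \<epsilon>\<^sup>2) * real d powr (1 - 2 / real_of_ereal p) \<le> real k"
        by (simp add: q(1))
    qed
  }
  {
    fix d :: nat
    assume d: "1 \<le> d"
    show "tester_lower_bound d \<epsilon> \<infinity> (1 / 10 ^ 8 * real d)"
    proof (rule tester_lower_boundI)
      fix T k assume T: "psd_tester d \<epsilon> \<infinity> T"
        "\<And>A \<omega>. A \<in> sym_mats d \<Longrightarrow> \<omega> \<in> space (coins T) \<Longrightarrow> \<exists>n\<le>k. halts T \<omega> (answers T A \<omega> n)"
      show "1 / 10 ^ 8 * real d \<le> real k"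
      proof (cases "d = 1")
        case True
        then show ?thesis using tester_makes_query[of \<epsilon> T k] T \<epsilon> by simp
      next
        case False
        then show ?thesis using tester_query_bound_infinity[OF T \<epsilon>] d by simp
      qed
    qed
  }
qed auto

end
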